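(* Let $(\overline{M}^{m+1},\overline{g})$ be a spacetime carrying a conformal timelike vector field $\overline{X}\in\mathfrak{X}(\overline{M})$, and suppose that $\mathcal{L}_{\overline{X}}\overline{g}=2\eta\,\overline{g}$ with $\eta\in C^\infty(\overline{M})$, $\eta>0$. Set $\alpha=\sqrt{-\overline{g}(\overline{X},\overline{X})}$ and $\mathcal{H}=\eta/\alpha$. Let $\psi:M^m\to\overline{M}$ be a compact immersed spacelike hypersurface whose mean curvature function $H$ in the direction of the future-pointing unit normal satisfies $H\geq\mathcal{H}\circ\psi$ on $M$. Then $\overline{X}$ is orthogonal to $\psi$ (that is, $\overline{g}(\overline{X}_{\psi(q)},(\mathrm{d}\psi)_q V)=0$ for all $q\in M$, $V\in T_qM$) and $H=\mathcal{H}\circ\psi$ on $M$.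
   Context: Manifolds are smooth, connected and without boundary; $(\overline{M},\overline{g})$ is an $(m+1)$-dimensional Lorentzian manifold (signature $(-,+,\dots,+)$), time-oriented by the timelike vector field $\overline{X}$ (i.e. $\overline{g}(\overline{X},\overline{X})<0$ everywhere). $\mathcal{L}$ denotes the Lie derivative. A spacelike hypersurface $\psi:M\to\overline{M}$ is a smooth immersion of an $m$-dimensional manifold $M$ such that $g=\psi^*\overline{g}$ is a Riemannian metric. There is a unique global unit timelike normal vector field $N$ along $\psi$ with $\overline{g}(N,N)=-1$ and $\overline{g}(N,\overline{X})<0$; it is called the future-pointing unit normal. With $\nabla,\overline{\nabla}$ the Levi-Civita connections of $g,\overline{g}$, the second fundamental form is $\mathrm{II}(V,W)=\overline{\nabla}_V W-\nabla_V W$, the mean curvature vector is $\mathbf{H}=\frac{1}{m}\mathrm{trace}_g(\mathrm{II})$, and the mean curvature function in the direction of $N$ is $H=-\overline{g}(\mathbf{H},N)$, so that $\mathbf{H}=HN$. *)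

theory Defs
  imports "HOL-Analysis.Analysis"
begin

section \<open>Smooth maps between Euclidean spaces\<close>

fun times_differentiable_on ::
    "nat \<Rightarrow> 'a::euclidean_space set \<Rightarrow> ('a \<Rightarrow> 'b::real_normed_vector) \<Rightarrow> bool" where
  "times_differentiable_on 0 S f \<longleftrightarrow> continuous_on S f"
| "times_differentiable_on (Suc k) S f \<longleftrightarrow>
     (\<forall>x\<in>S. f differentiable (at x)) \<and>
     (\<forall>v. times_differentiable_on k S (\<lambda>x. frechet_derivative f (at x) v))"

text \<open>Derivatives are taken at \<open>at x\<close>, so this is only meaningful for open \<open>S\<close>.\<close>

definition smooth_on :: "'a::euclidean_space set \<Rightarrow> ('a \<Rightarrow> 'b::real_normed_vector) \<Rightarrow> bool" where
  "smooth_on S f \<longleftrightarrow> (\<forall>k. times_differentiable_on k S f)"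


section \<open>Smooth manifolds\<close>

datatype ('a, 'e) chart = Chart (cdom: "'a set") (cmap: "'a \<Rightarrow> 'e")

definition cinv :: "('a, 'e) chart \<Rightarrow> 'e \<Rightarrow> 'a" where
  "cinv c = inv_into (cdom c) (cmap c)"

definition cimg :: "('a, 'e) chart \<Rightarrow> 'e set" where
  "cimg c = cmap c ` cdom c"

text \<open>
  A manifold is a Hausdorff, second countable topological space (the whole type \<open>'a\<close>) together
  with a smooth atlas. The atlas need not be maximal: all notions below depend only on the smooth
  structure it generates. The dimension is \<open>DIM('e)\<close>, which is at least 1.
\<close>

definition is_chart ::
    "('a::topological_space, 'e::euclidean_space) chart \<Rightarrow> bool" where
  "is_chart c \<longleftrightarrow> open (cdom c) \<and> open (cimg c) \<and>
     homeomorphism (cdom c) (cimg c) (cmap c) (cinv c)"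

definition connected_manifold ::
    "('a::{t2_space,second_countable_topology}, 'e::euclidean_space) chart set \<Rightarrow> bool" where
  "connected_manifold A \<longleftrightarrow>
     (\<forall>c\<in>A. is_chart c) \<and>
     (\<Union>c\<in>A. cdom c) = UNIV \<and>
     (\<forall>c\<in>A. \<forall>d\<in>A. smooth_on (cmap c ` (cdom c \<inter> cdom d)) (cmap d \<circ> cinv c)) \<and>
     connected (UNIV :: 'a set)"

definition smooth_function ::
    "('a::topological_space, 'e::euclidean_space) chart set \<Rightarrow> ('a \<Rightarrow> real) \<Rightarrow> bool" where
  "smooth_function A f \<longleftrightarrow> (\<forall>c\<in>A. smooth_on (cimg c) (f \<circ> cinv c))"

definition smooth_map ::
    "('a::topological_space, 'f::euclidean_space) chart set \<Rightarrow>
     ('b::topological_space, 'e::euclidean_space) chart set \<Rightarrow> ('a \<Rightarrow> 'b) \<Rightarrow> bool" where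
  "smooth_map A B \<psi> \<longleftrightarrow> continuous_on UNIV \<psi> \<and>
     (\<forall>c\<in>A. \<forall>d\<in>B. smooth_on (cmap c ` (cdom c \<inter> \<psi> -` cdom d)) (cmap d \<circ> \<psi> \<circ> cinv c))"


section \<open>Tangent vectors\<close>

text \<open>
  A tangent vector at \<open>p\<close> is an equivalence class of pairs (chart around \<open>p\<close>, component vector),
  related by the derivatives of the transition maps. Such a class is represented by its component
  vector in one distinguished chart \<open>chart_at A p\<close>, so that every tangent space is, as a vector
  space, the model space \<open>'e\<close>. The distinguished chart varies with \<open>p\<close> in an arbitrary way, hence
  smoothness of fields is expressed through \<open>components\<close>, the components in a fixed chart \<open>c\<close>.
\<close>

definition chart_at :: "('a, 'e) chart set \<Rightarrow> 'a \<Rightarrow> ('a, 'e) chart" where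
  "chart_at A p = (SOME c. c \<in> A \<and> p \<in> cdom c)"

definition components ::
    "('a, 'e::euclidean_space) chart set \<Rightarrow> ('a, 'e) chart \<Rightarrow> 'a \<Rightarrow> 'e \<Rightarrow> 'e" where
  "components A c p v =
     frechet_derivative (cmap c \<circ> cinv (chart_at A p)) (at (cmap (chart_at A p) p)) v"

text \<open>The tangent vector at \<open>p\<close> with components \<open>u\<close> in the chart \<open>c\<close>; inverse to \<open>components A c p\<close>.\<close>

definition tangent_vector ::
    "('a, 'e::euclidean_space) chart set \<Rightarrow> ('a, 'e) chart \<Rightarrow> 'a \<Rightarrow> 'e \<Rightarrow> 'e" where
  "tangent_vector A c p u = frechet_derivative (cmap (chart_at A p) \<circ> cinv c) (at (cmap c p)) u"

definition differential ::
    "('a, 'f::euclidean_space) chart set \<Rightarrow> ('b, 'e::euclidean_space) chart set \<Rightarrow>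
     ('a \<Rightarrow> 'b) \<Rightarrow> 'a \<Rightarrow> 'f \<Rightarrow> 'e" where
  "differential A B \<psi> q v =
     frechet_derivative (cmap (chart_at B (\<psi> q)) \<circ> \<psi> \<circ> cinv (chart_at A q))
       (at (cmap (chart_at A q) q)) v"

definition smooth_vector_field ::
    "('a::topological_space, 'e::euclidean_space) chart set \<Rightarrow> ('a \<Rightarrow> 'e) \<Rightarrow> bool" where
  "smooth_vector_field A X \<longleftrightarrow>
     (\<forall>c\<in>A. smooth_on (cimg c) (\<lambda>x. components A c (cinv c x) (X (cinv c x))))"

text \<open>Vector fields along \<open>\<psi>\<close>: \<open>Y q\<close> is a tangent vector at \<open>\<psi> q\<close>.\<close>

definition smooth_vector_field_along ::
    "('a::topological_space, 'f::euclidean_space) chart set \<Rightarrow>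
     ('b::topological_space, 'e::euclidean_space) chart set \<Rightarrow> ('a \<Rightarrow> 'b) \<Rightarrow> ('a \<Rightarrow> 'e) \<Rightarrow> bool" where
  "smooth_vector_field_along A B \<psi> Y \<longleftrightarrow>
     (\<forall>c\<in>A. \<forall>d\<in>B. smooth_on (cmap c ` (cdom c \<inter> \<psi> -` cdom d))
        (\<lambda>x. components B d (\<psi> (cinv c x)) (Y (cinv c x))))"


section \<open>Metrics\<close>

text \<open>The bilinear form \<open>g\<close> at the point with coordinates \<open>x\<close>, on components in the chart \<open>c\<close>.\<close>

definition metric_in_chart ::
    "('a, 'e::euclidean_space) chart set \<Rightarrow> ('a \<Rightarrow> 'e \<Rightarrow> 'e \<Rightarrow> real) \<Rightarrow> ('a, 'e) chart \<Rightarrow>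
     'e \<Rightarrow> 'e \<Rightarrow> 'e \<Rightarrow> real" where
  "metric_in_chart A g c x u v =
     g (cinv c x) (tangent_vector A c (cinv c x) u) (tangent_vector A c (cinv c x) v)"

definition smooth_symmetric_form ::
    "('a::topological_space, 'e::euclidean_space) chart set \<Rightarrow> ('a \<Rightarrow> 'e \<Rightarrow> 'e \<Rightarrow> real) \<Rightarrow> bool" where
  "smooth_symmetric_form A g \<longleftrightarrow>
     (\<forall>p. bilinear (g p) \<and> (\<forall>u v. g p u v = g p v u)) \<and>
     (\<forall>c\<in>A. \<forall>u v. smooth_on (cimg c) (\<lambda>x. metric_in_chart A g c x u v))"

definition riemannian_metric ::
    "('a::topological_space, 'e::euclidean_space) chart set \<Rightarrow> ('a \<Rightarrow> 'e \<Rightarrow> 'e \<Rightarrow> real) \<Rightarrow> bool" where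
  "riemannian_metric A g \<longleftrightarrow> smooth_symmetric_form A g \<and> (\<forall>p v. v \<noteq> 0 \<longrightarrow> g p v v > 0)"

text \<open>Signature \<open>(-,+,\<dots>,+)\<close>: there is a basis orthonormal for \<open>b\<close> with exactly one timelike member.\<close>

definition lorentzian_form :: "('e::euclidean_space \<Rightarrow> 'e \<Rightarrow> real) \<Rightarrow> bool" where
  "lorentzian_form b \<longleftrightarrow>
     (\<exists>E. independent E \<and> span E = UNIV \<and>
        (\<exists>t\<in>E. \<forall>u\<in>E. \<forall>v\<in>E. b u v = (if u \<noteq> v then 0 else if u = t then -1 else 1)))"

definition lorentzian_metric ::
    "('a::topological_space, 'e::euclidean_space) chart set \<Rightarrow> ('a \<Rightarrow> 'e \<Rightarrow> 'e \<Rightarrow> real) \<Rightarrow> bool" where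
  "lorentzian_metric A g \<longleftrightarrow> smooth_symmetric_form A g \<and> (\<forall>p. lorentzian_form (g p))"

definition timelike_vector_field ::
    "('a::topological_space, 'e::euclidean_space) chart set \<Rightarrow> ('a \<Rightarrow> 'e \<Rightarrow> 'e \<Rightarrow> real) \<Rightarrow>
     ('a \<Rightarrow> 'e) \<Rightarrow> bool" where
  "timelike_vector_field A g X \<longleftrightarrow> smooth_vector_field A X \<and> (\<forall>p. g p (X p) (X p) < 0)"

text \<open>A spacetime, time-oriented by \<open>X\<close>.\<close>

definition spacetime ::
    "('a::{t2_space,second_countable_topology}, 'e::euclidean_space) chart set \<Rightarrow>
     ('a \<Rightarrow> 'e \<Rightarrow> 'e \<Rightarrow> real) \<Rightarrow> ('a \<Rightarrow> 'e) \<Rightarrow> bool" where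
  "spacetime A g X \<longleftrightarrow>
     connected_manifold A \<and> lorentzian_metric A g \<and> timelike_vector_field A g X"

text \<open>
  The coordinate formula
  \<open>(L\<^sub>X g)\<^sub>i\<^sub>j = X\<^sup>k \<partial>\<^sub>k g\<^sub>i\<^sub>j + g\<^sub>k\<^sub>j \<partial>\<^sub>i X\<^sup>k + g\<^sub>i\<^sub>k \<partial>\<^sub>j X\<^sup>k\<close>
  in the distinguished chart at \<open>p\<close>, in which \<open>u\<close>, \<open>v\<close> and \<open>X p\<close> are their own components.
\<close>

definition lie_derivative ::
    "('a, 'e::euclidean_space) chart set \<Rightarrow> ('a \<Rightarrow> 'e) \<Rightarrow> ('a \<Rightarrow> 'e \<Rightarrow> 'e \<Rightarrow> real) \<Rightarrow>
     'a \<Rightarrow> 'e \<Rightarrow> 'e \<Rightarrow> real" where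
  "lie_derivative A X g p u v =
     (let c = chart_at A p; x = cmap c p;
          DX = frechet_derivative (\<lambda>y. components A c (cinv c y) (X (cinv c y))) (at x)
      in frechet_derivative (\<lambda>y. metric_in_chart A g c y u v) (at x) (X p)
         + g p (DX u) v + g p u (DX v))"


section \<open>Levi-Civita connection\<close>

text \<open>
  The connection form of the Levi-Civita connection in the chart \<open>c\<close> at the point with
  coordinates \<open>x\<close>: the unique torsion-free (symmetric) and metric one, so that
  \<open>christoffel A g c x \<partial>\<^sub>i \<partial>\<^sub>j = \<Gamma>\<^sup>k\<^sub>i\<^sub>j \<partial>\<^sub>k\<close>.
\<close>

definition christoffel ::
    "('a, 'e::euclidean_space) chart set \<Rightarrow> ('a \<Rightarrow> 'e \<Rightarrow> 'e \<Rightarrow> real) \<Rightarrow> ('a, 'e) chart \<Rightarrow>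
     'e \<Rightarrow> 'e \<Rightarrow> 'e \<Rightarrow> 'e" where
  "christoffel A g c x =
     (THE \<Gamma>. bilinear \<Gamma> \<and> (\<forall>u v. \<Gamma> u v = \<Gamma> v u) \<and>
        (\<forall>u v w. frechet_derivative (\<lambda>y. metric_in_chart A g c y v w) (at x) u =
            metric_in_chart A g c x (\<Gamma> u v) w + metric_in_chart A g c x v (\<Gamma> u w)))"

text \<open>
  The pull-back of the Levi-Civita connection of \<open>(B, g)\<close> to vector fields \<open>Y\<close> along \<open>\<psi>\<close>,
  differentiated in the direction \<open>v\<close> at \<open>q\<close>:
  \<open>(\<nabla>\<^sub>v Y)\<^sup>k = v(Y\<^sup>k) + \<Gamma>\<^sup>k\<^sub>i\<^sub>j (d\<psi> v)\<^sup>i Y\<^sup>j\<close>, in the distinguished charts at \<open>q\<close> and \<open>\<psi> q\<close>.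
\<close>

definition covariant_derivative_along ::
    "('a, 'f::euclidean_space) chart set \<Rightarrow> ('b, 'e::euclidean_space) chart set \<Rightarrow>
     ('b \<Rightarrow> 'e \<Rightarrow> 'e \<Rightarrow> real) \<Rightarrow> ('a \<Rightarrow> 'b) \<Rightarrow> ('a \<Rightarrow> 'e) \<Rightarrow> 'a \<Rightarrow> 'f \<Rightarrow> 'e" where
  "covariant_derivative_along A B g \<psi> Y q v =
     (let c = chart_at A q; d = chart_at B (\<psi> q)
      in frechet_derivative (\<lambda>x. components B d (\<psi> (cinv c x)) (Y (cinv c x))) (at (cmap c q)) v
         + christoffel B g d (cmap d (\<psi> q)) (differential A B \<psi> q v) (Y q))"

definition levi_civita ::
    "('a, 'f::euclidean_space) chart set \<Rightarrow> ('a \<Rightarrow> 'f \<Rightarrow> 'f \<Rightarrow> real) \<Rightarrow>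
     ('a \<Rightarrow> 'f) \<Rightarrow> ('a \<Rightarrow> 'f) \<Rightarrow> 'a \<Rightarrow> 'f" where
  "levi_civita A g V W q = covariant_derivative_along A A g (\<lambda>p. p) W q (V q)"


section \<open>Spacelike hypersurfaces\<close>

definition immersion ::
    "('a::topological_space, 'f::euclidean_space) chart set \<Rightarrow>
     ('b::topological_space, 'e::euclidean_space) chart set \<Rightarrow> ('a \<Rightarrow> 'b) \<Rightarrow> bool" where
  "immersion A B \<psi> \<longleftrightarrow> smooth_map A B \<psi> \<and> (\<forall>q. inj (differential A B \<psi> q))"

definition pullback_metric ::
    "('a, 'f::euclidean_space) chart set \<Rightarrow> ('b, 'e::euclidean_space) chart set \<Rightarrow>
     ('b \<Rightarrow> 'e \<Rightarrow> 'e \<Rightarrow> real) \<Rightarrow> ('a \<Rightarrow> 'b) \<Rightarrow> 'a \<Rightarrow> 'f \<Rightarrow> 'f \<Rightarrow> real" where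
  "pullback_metric A B g \<psi> q u v = g (\<psi> q) (differential A B \<psi> q u) (differential A B \<psi> q v)"

definition spacelike_hypersurface ::
    "('a::{t2_space,second_countable_topology}, 'f::euclidean_space) chart set \<Rightarrow>
     ('b::{t2_space,second_countable_topology}, 'e::euclidean_space) chart set \<Rightarrow>
     ('b \<Rightarrow> 'e \<Rightarrow> 'e \<Rightarrow> real) \<Rightarrow> ('a \<Rightarrow> 'b) \<Rightarrow> bool" where
  "spacelike_hypersurface A B g \<psi> \<longleftrightarrow>
     connected_manifold A \<and> DIM('e) = DIM('f) + 1 \<and>
     immersion A B \<psi> \<and> riemannian_metric A (pullback_metric A B g \<psi>)"

definition future_unit_normal ::
    "('a::topological_space, 'f::euclidean_space) chart set \<Rightarrow>
     ('b::topological_space, 'e::euclidean_space) chart set \<Rightarrow>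
     ('b \<Rightarrow> 'e \<Rightarrow> 'e \<Rightarrow> real) \<Rightarrow> ('b \<Rightarrow> 'e) \<Rightarrow> ('a \<Rightarrow> 'b) \<Rightarrow> ('a \<Rightarrow> 'e) \<Rightarrow> bool" where
  "future_unit_normal A B g X \<psi> N \<longleftrightarrow>
     smooth_vector_field_along A B \<psi> N \<and>
     (\<forall>q. (\<forall>v. g (\<psi> q) (N q) (differential A B \<psi> q v) = 0) \<and>
          g (\<psi> q) (N q) (N q) = -1 \<and> g (\<psi> q) (N q) (X (\<psi> q)) < 0)"

definition second_fundamental_form ::
    "('a, 'f::euclidean_space) chart set \<Rightarrow> ('b, 'e::euclidean_space) chart set \<Rightarrow>
     ('b \<Rightarrow> 'e \<Rightarrow> 'e \<Rightarrow> real) \<Rightarrow> ('a \<Rightarrow> 'b) \<Rightarrow> ('a \<Rightarrow> 'f) \<Rightarrow> ('a \<Rightarrow> 'f) \<Rightarrow> 'a \<Rightarrow> 'e" where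
  "second_fundamental_form A B g \<psi> V W q =
     covariant_derivative_along A B g \<psi> (\<lambda>p. differential A B \<psi> p (W p)) q (V q)
     - differential A B \<psi> q (levi_civita A (pullback_metric A B g \<psi>) V W q)"

text \<open>
  The second fundamental form is tensorial: its value at \<open>q\<close> depends only on \<open>V q\<close> and \<open>W q\<close>.
  To evaluate it on tangent vectors, these are extended to arbitrary smooth vector fields.
\<close>

definition vector_field_extending ::
    "('a::topological_space, 'f::euclidean_space) chart set \<Rightarrow> 'a \<Rightarrow> 'f \<Rightarrow> 'a \<Rightarrow> 'f" where
  "vector_field_extending A q v = (SOME V. smooth_vector_field A V \<and> V q = v)"

definition orthonormal_basis :: "('f::euclidean_space \<Rightarrow> 'f \<Rightarrow> real) \<Rightarrow> 'f set \<Rightarrow> bool" where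
  "orthonormal_basis b E \<longleftrightarrow> independent E \<and> span E = UNIV \<and>
     (\<forall>u\<in>E. \<forall>v\<in>E. b u v = (if u = v then 1 else 0))"

text \<open>The trace of a bilinear map with respect to an inner product; independent of the choice of basis.\<close>

definition metric_trace ::
    "('f::euclidean_space \<Rightarrow> 'f \<Rightarrow> real) \<Rightarrow> ('f \<Rightarrow> 'f \<Rightarrow> 'e::real_vector) \<Rightarrow> 'e" where
  "metric_trace b T = (\<Sum>e\<in>(SOME E. orthonormal_basis b E). T e e)"

definition mean_curvature_vector ::
    "('a::topological_space, 'f::euclidean_space) chart set \<Rightarrow>
     ('b::topological_space, 'e::euclidean_space) chart set \<Rightarrow>
     ('b \<Rightarrow> 'e \<Rightarrow> 'e \<Rightarrow> real) \<Rightarrow> ('a \<Rightarrow> 'b) \<Rightarrow> 'a \<Rightarrow> 'e" where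
  "mean_curvature_vector A B g \<psi> q =
     (1 / real DIM('f)) *\<^sub>R
       metric_trace (pullback_metric A B g \<psi> q)
         (\<lambda>v w. second_fundamental_form A B g \<psi>
                  (vector_field_extending A q v) (vector_field_extending A q w) q)"

definition mean_curvature ::
    "('a::topological_space, 'f::euclidean_space) chart set \<Rightarrow>
     ('b::topological_space, 'e::euclidean_space) chart set \<Rightarrow>
     ('b \<Rightarrow> 'e \<Rightarrow> 'e \<Rightarrow> real) \<Rightarrow> ('a \<Rightarrow> 'b) \<Rightarrow> ('a \<Rightarrow> 'e) \<Rightarrow> 'a \<Rightarrow> real" where
  "mean_curvature A B g \<psi> N q = - g (\<psi> q) (mean_curvature_vector A B g \<psi> q) (N q)"

end

theory Submission
  imports Defs "HOL-Computational_Algebra.Polynomial"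
begin

text \<open>
  Decompose \<open>X \<circ> \<psi> = d\<psi> Y + \<phi> N\<close> into its tangential and its normal part. Restricting
  \<open>L\<^sub>X g = 2 \<eta> g\<close> to the hypersurface and tracing gives \<open>div Y = m (\<eta> - \<phi> H)\<close>. Since
  \<open>\<alpha>\<^sup>2 = \<phi>\<^sup>2 - |Y|\<^sup>2\<close>, we have \<open>\<phi> \<ge> \<alpha>\<close>, so \<open>H \<ge> \<eta> / \<alpha>\<close> forces
  \<open>div Y \<le> 0\<close>. On a compact manifold the divergence has integral \<open>0\<close> (orientability is not
  needed, one integrates against the Riemannian density), hence it vanishes identically. Then
  \<open>\<phi> H = \<eta>\<close>, which leaves only \<open>\<phi> = \<alpha>\<close>, that is, \<open>Y = 0\<close> and \<open>H = \<eta> / \<alpha>\<close>.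
\<close>

section \<open>Calculus of smooth maps\<close>

text \<open>No global integral and no coordinate-free divergence is formed. The divergence enters
  only as the coordinate quotient w^-1 d_i(w Y^i), the same in every chart, with w = sqrt(det g);
  Jacobi's formula for det g turns it into half the trace of L_Y g. The link with the hypothesis is
  a pull-back: on tangent vectors, L_X gbar splits into L_Y g plus phi L_N gbar, because
  orthogonality kills the term with d phi. Half of L_N gbar on tangent vectors is
  \<open>shape_form\<close>; the connection appears only when Weingarten's formula identifies it
  with the second fundamental form. The encoding shapes the rest: tangent vectors live in the
  distinguished charts \<open>chart_at\<close>, which jump from point to point, so an identity must
  be moved to a fixed chart before it can be differentiated; and whatever is chosen by
  \<open>SOME\<close> or \<open>THE\<close> (extensions, frames, Christoffel forms) needs an
  existence proof. The last step is rigid because eta > 0: in eta <= (phi / alpha) eta <= phi H =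
  eta the factor eta can be cancelled.\<close>

lemma times_differentiable_on_cong:
  fixes f g :: "'a::euclidean_space \<Rightarrow> 'b::real_normed_vector"
  assumes "open S" "\<And>x. x \<in> S \<Longrightarrow> f x = g x" "times_differentiable_on k S f"
  shows "times_differentiable_on k S g"
  using assms(2,3)
proof (induction k arbitrary: f g)
  case 0
  then show ?case by (metis continuous_on_cong times_differentiable_on.simps(1))
next
  case (Suc k)
  have D: "(g has_derivative frechet_derivative f (at x)) (at x)" if "x \<in> S" for x
    using Suc.prems that frechet_derivative_works
    by (metis assms(1) has_derivative_transform_within_open times_differentiable_on.simps(2))
  have "frechet_derivative f (at x) v = frechet_derivative g (at x) v" if "x \<in> S" for x v
    using frechet_derivative_at[OF D[OF that]] by simp
  then have "times_differentiable_on k S (\<lambda>x. frechet_derivative g (at x) v)" for v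
    using Suc.IH Suc.prems(2) by (metis (no_types, lifting) times_differentiable_on.simps(2))
  then show ?case using D by (auto simp: differentiable_def)
qed

lemma times_differentiable_on_SucI:
  fixes f :: "'a::euclidean_space \<Rightarrow> 'b::real_normed_vector"
  assumes "open S" "\<And>x. x \<in> S \<Longrightarrow> (f has_derivative f' x) (at x)"
    and "\<And>v. times_differentiable_on k S (\<lambda>x. f' x v)"
  shows "times_differentiable_on (Suc k) S f"
proof -
  have "f' x = frechet_derivative f (at x)" if "x \<in> S" for x
    by (rule frechet_derivative_at[OF assms(2)[OF that]])
  then have "times_differentiable_on k S (\<lambda>x. frechet_derivative f (at x) v)" for v
    by (intro times_differentiable_on_cong[OF assms(1) _ assms(3)[of v]]) simp
  then show ?thesis
    using assms(2) by (auto simp: differentiable_def)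
qed

lemma times_differentiable_on_SucD:
  assumes "times_differentiable_on (Suc k) S f"
  shows "x \<in> S \<Longrightarrow> (f has_derivative frechet_derivative f (at x)) (at x)"
    and "times_differentiable_on k S (\<lambda>x. frechet_derivative f (at x) v)"
  using assms by (auto simp: frechet_derivative_works)

lemma times_differentiable_on_Suc_imp:
  "times_differentiable_on (Suc k) S f \<Longrightarrow> times_differentiable_on k S f"
proof (induction k arbitrary: f)
  case 0
  then show ?case
    by (auto intro!: continuous_at_imp_continuous_on differentiable_imp_continuous_within)
next
  case (Suc k)
  then show ?case by (metis times_differentiable_on.simps(2))
qed

lemma times_differentiable_on_subset:
  "times_differentiable_on k S f \<Longrightarrow> T \<subseteq> S \<Longrightarrow> times_differentiable_on k T f"
  by (induction k arbitrary: f) (auto intro: continuous_on_subset)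

lemma times_differentiable_on_local:
  assumes "\<And>x. x \<in> S \<Longrightarrow> \<exists>U. open U \<and> x \<in> U \<and> times_differentiable_on k U f"
  shows "times_differentiable_on k S f"
  using assms
proof (induction k arbitrary: f)
  case 0
  have "isCont f x" if "x \<in> S" for x
    using 0[OF that] by (auto simp: continuous_on_eq_continuous_at)
  then show ?case by (auto intro: continuous_at_imp_continuous_on)
next
  case (Suc k)
  show ?case
    unfolding times_differentiable_on.simps
    by (intro conjI allI ballI Suc.IH) (use Suc.prems times_differentiable_on.simps(2) in metis)+
qed

lemma times_differentiable_on_const: "times_differentiable_on k S (\<lambda>x. c)"
  by (induction k arbitrary: c) (auto simp: frechet_derivative_const)

lemma times_differentiable_on_add:
  assumes "open S" "times_differentiable_on k S f" "times_differentiable_on k S g"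
  shows "times_differentiable_on k S (\<lambda>x. f x + g x)"
  using assms(2,3)
proof (induction k arbitrary: f g)
  case 0
  then show ?case by (auto intro: continuous_intros)
next
  case (Suc k)
  show ?case
    by (rule times_differentiable_on_SucI[OF assms(1)
          has_derivative_add[OF times_differentiable_on_SucD(1)[OF Suc.prems(1)]
            times_differentiable_on_SucD(1)[OF Suc.prems(2)]]])
      (use Suc in auto)
qed

lemma times_differentiable_on_sum:
  assumes "open S" "\<And>i. i \<in> I \<Longrightarrow> times_differentiable_on k S (f i)"
  shows "times_differentiable_on k S (\<lambda>x. \<Sum>i\<in>I. f i x)"
  using assms(2)
  by (induction I rule: infinite_finite_induct)
    (auto intro!: times_differentiable_on_const times_differentiable_on_add assms(1))

lemma times_differentiable_on_bounded_linear:
  assumes "open S" "bounded_linear L" "times_differentiable_on k S f"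
  shows "times_differentiable_on k S (\<lambda>x. L (f x))"
  using assms(3)
proof (induction k arbitrary: f)
  case 0
  then show ?case using assms(2) by (auto intro: bounded_linear.continuous_on)
next
  case (Suc k)
  show ?case
    by (rule times_differentiable_on_SucI[OF assms(1)
          bounded_linear.has_derivative[OF assms(2) times_differentiable_on_SucD(1)[OF Suc.prems]]])
      (use Suc in auto)
qed

text \<open>Both factors vary in the induction: the product rule pairs the derivative of one factor
  with the other factor itself, which counts as differentiable one time less.\<close>

lemma times_differentiable_on_bounded_bilinear:
  assumes "open S" "bounded_bilinear pr" "times_differentiable_on k S f" "times_differentiable_on k S g"
  shows "times_differentiable_on k S (\<lambda>x. pr (f x) (g x))"
  using assms(3,4)
proof (induction k arbitrary: f g)
  case 0
  then show ?case using assms(2) by (auto intro: bounded_bilinear.continuous_on)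
next
  case (Suc k)
  note D1 = times_differentiable_on_SucD[OF Suc.prems(1)] and D2 = times_differentiable_on_SucD[OF Suc.prems(2)]
  note L1 = times_differentiable_on_Suc_imp[OF Suc.prems(1)] and L2 = times_differentiable_on_Suc_imp[OF Suc.prems(2)]
  have "times_differentiable_on k S
      (\<lambda>x. pr (f x) (frechet_derivative g (at x) v) + pr (frechet_derivative f (at x) v) (g x))" for v
    by (rule times_differentiable_on_add[OF assms(1) Suc.IH[OF L1 D2(2)] Suc.IH[OF D1(2) L2]])
  moreover have "((\<lambda>x. pr (f x) (g x)) has_derivative
      (\<lambda>v. pr (f x) (frechet_derivative g (at x) v) + pr (frechet_derivative f (at x) v) (g x))) (at x)"
    if "x \<in> S" for x
    by (rule bounded_bilinear.FDERIV[OF assms(2) D1(1)[OF that] D2(1)[OF that]])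
  ultimately show ?case
    by (intro times_differentiable_on_SucI[OF assms(1)])
qed

lemma linear_sum_Basis:
  fixes f :: "'a::euclidean_space \<Rightarrow> 'b::real_vector"
  assumes "linear f"
  shows "f v = (\<Sum>b\<in>Basis. (v \<bullet> b) *\<^sub>R f b)"
  by (subst euclidean_representation[of v, symmetric])
    (simp only: linear_sum[OF assms] linear_cmul[OF assms] o_def)

text \<open>The chain rule yields Df(h x)(Dh x v), a linear map depending on \<open>x\<close>
  applied to a vector depending on \<open>x\<close>. Expanding that vector in \<open>Basis\<close>
  separates the two: what remains are products of coordinates of Dh with functions Df(h x) b, to
  which the induction hypothesis applies.\<close>

lemma times_differentiable_on_compose:
  fixes f :: "'b::euclidean_space \<Rightarrow> 'c::real_normed_vector" and h :: "'a::euclidean_space \<Rightarrow> 'b"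
  assumes "open S" "h ` S \<subseteq> R" "times_differentiable_on k R f" "times_differentiable_on k S h"
  shows "times_differentiable_on k S (\<lambda>x. f (h x))"
  using assms(3,4)
proof (induction k arbitrary: f)
  case 0
  then show ?case using assms(2) by (auto intro: continuous_on_compose2)
next
  case (Suc k)
  let ?f' = "\<lambda>y. frechet_derivative f (at y)"
  let ?h' = "\<lambda>x. frechet_derivative h (at x)"
  have f': "(f has_derivative ?f' (h x)) (at (h x))" if "x \<in> S" for x
    using times_differentiable_on_SucD(1)[OF Suc.prems(1)] that assms(2) by blast
  have D: "((\<lambda>x. f (h x)) has_derivative (\<lambda>v. ?f' (h x) (?h' x v))) (at x)" if "x \<in> S" for x
    using diff_chain_at[OF times_differentiable_on_SucD(1)[OF Suc.prems(2) that] f'[OF that]]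
    by (simp add: o_def)
  have D': "(\<Sum>b\<in>Basis. (?h' x v \<bullet> b) *\<^sub>R ?f' (h x) b) = ?f' (h x) (?h' x v)" if "x \<in> S" for x v
    using linear_sum_Basis[OF has_derivative_linear[OF f'[OF that]]] by metis
  have "times_differentiable_on k S (\<lambda>x. \<Sum>b\<in>Basis. (?h' x v \<bullet> b) *\<^sub>R ?f' (h x) b)" for v
    by (intro times_differentiable_on_sum assms(1) Suc.IH
        times_differentiable_on_bounded_bilinear[OF _ bounded_bilinear_scaleR]
        times_differentiable_on_bounded_linear[OF _ bounded_linear_inner_left]
        times_differentiable_on_SucD(2)[OF Suc.prems(1)] times_differentiable_on_SucD(2)[OF Suc.prems(2)]
        times_differentiable_on_Suc_imp[OF Suc.prems(2)])
  then have "times_differentiable_on k S (\<lambda>x. ?f' (h x) (?h' x v))" for v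
    by (rule times_differentiable_on_cong[OF assms(1) D', rotated])
  then show ?case
    by (rule times_differentiable_on_SucI[OF assms(1) D, rotated])
qed

text \<open>Bootstrapping: the derivative -f'/f^2 contains only f' and the inverse itself, whose
  differentiability of order \<open>k\<close> is the induction hypothesis. The square root below
  works in the same way, with derivative f'/(2 sqrt f).\<close>

lemma times_differentiable_on_inverse:
  fixes f :: "'a::euclidean_space \<Rightarrow> real"
  assumes "open S" "\<And>x. x \<in> S \<Longrightarrow> f x \<noteq> 0" "times_differentiable_on k S f"
  shows "times_differentiable_on k S (\<lambda>x. inverse (f x))"
  using assms(3)
proof (induction k)
  case 0
  then show ?case using assms(2) by (auto intro!: continuous_intros)
next
  case (Suc k)
  have "times_differentiable_on k S (\<lambda>x. inverse (f x))"
    using Suc times_differentiable_on_Suc_imp by blast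
  then have "times_differentiable_on k S
      (\<lambda>x. - (inverse (f x) * frechet_derivative f (at x) v * inverse (f x)))" for v
    by (intro times_differentiable_on_bounded_bilinear[OF _ bounded_bilinear_mult] assms(1)
      times_differentiable_on_bounded_linear[OF _ bounded_linear_minus[OF bounded_linear_ident]]
      times_differentiable_on_SucD(2)[OF Suc.prems])
  moreover have "((\<lambda>x. inverse (f x)) has_derivative
      (\<lambda>v. - (inverse (f x) * frechet_derivative f (at x) v * inverse (f x)))) (at x)"
    if "x \<in> S" for x
    by (rule Deriv.has_derivative_inverse[OF assms(2)[OF that] times_differentiable_on_SucD(1)[OF Suc.prems that]])
  ultimately show ?case
    by (intro times_differentiable_on_SucI[OF assms(1)])
qed

lemma times_differentiable_on_sqrt:
  fixes f :: "'a::euclidean_space \<Rightarrow> real"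
  assumes "open S" "\<And>x. x \<in> S \<Longrightarrow> f x > 0" "times_differentiable_on k S f"
  shows "times_differentiable_on k S (\<lambda>x. sqrt (f x))"
  using assms(3)
proof (induction k)
  case 0
  then show ?case by (auto intro!: continuous_intros)
next
  case (Suc k)
  have "times_differentiable_on k S (\<lambda>x. sqrt (f x))"
    using Suc times_differentiable_on_Suc_imp by blast
  then have "times_differentiable_on k S
      (\<lambda>x. frechet_derivative f (at x) v * (inverse (sqrt (f x)) * (1/2)))" for v
    using assms(2)
    by (intro times_differentiable_on_bounded_bilinear[OF _ bounded_bilinear_mult] assms(1)
      times_differentiable_on_inverse times_differentiable_on_const
      times_differentiable_on_SucD(2)[OF Suc.prems]) force+
  then show ?case
    by (intro times_differentiable_on_SucI[OF assms(1)
          DERIV_compose_FDERIV[OF DERIV_real_sqrt[OF assms(2)] times_differentiable_on_SucD(1)[OF Suc.prems]]])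
      (auto simp: inverse_eq_divide)
qed

lemma smooth_on_cong:
  "open S \<Longrightarrow> smooth_on S f \<Longrightarrow> (\<And>x. x \<in> S \<Longrightarrow> f x = g x) \<Longrightarrow> smooth_on S g"
  unfolding smooth_on_def using times_differentiable_on_cong by blast

lemma smooth_on_subset: "smooth_on S f \<Longrightarrow> T \<subseteq> S \<Longrightarrow> smooth_on T f"
  unfolding smooth_on_def using times_differentiable_on_subset by blast

lemma smooth_on_local:
  "(\<And>x. x \<in> S \<Longrightarrow> \<exists>U. open U \<and> x \<in> U \<and> smooth_on U f) \<Longrightarrow> smooth_on S f"
  unfolding smooth_on_def using times_differentiable_on_local by metis

lemma smooth_on_has_derivative:
  "smooth_on S f \<Longrightarrow> x \<in> S \<Longrightarrow> (f has_derivative frechet_derivative f (at x)) (at x)"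
  unfolding smooth_on_def using times_differentiable_on_SucD(1) by blast

lemma smooth_on_frechet_derivative:
  "smooth_on S f \<Longrightarrow> smooth_on S (\<lambda>x. frechet_derivative f (at x) v)"
  unfolding smooth_on_def using times_differentiable_on_SucD(2) by blast

lemma smooth_on_continuous_on: "smooth_on S f \<Longrightarrow> continuous_on S f"
  unfolding smooth_on_def using times_differentiable_on.simps(1) by blast

lemma smooth_on_isCont: "smooth_on S f \<Longrightarrow> x \<in> S \<Longrightarrow> isCont f x"
  by (meson has_derivative_continuous smooth_on_has_derivative)

lemma smooth_on_const: "smooth_on S (\<lambda>x. c)"
  by (simp add: smooth_on_def times_differentiable_on_const)

lemma smooth_on_ident: "smooth_on S (\<lambda>x. x)"
proof -
  have "times_differentiable_on k S (\<lambda>x. x)" for k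
    by (cases k) (auto simp: frechet_derivative_ident[unfolded id_def] times_differentiable_on_const)
  then show ?thesis by (simp add: smooth_on_def)
qed

lemma smooth_on_add: "open S \<Longrightarrow> smooth_on S f \<Longrightarrow> smooth_on S g \<Longrightarrow> smooth_on S (\<lambda>x. f x + g x)"
  by (simp add: smooth_on_def times_differentiable_on_add)

lemma smooth_on_sum: "open S \<Longrightarrow> (\<And>i. i \<in> I \<Longrightarrow> smooth_on S (f i)) \<Longrightarrow> smooth_on S (\<lambda>x. \<Sum>i\<in>I. f i x)"
  by (simp add: smooth_on_def times_differentiable_on_sum)

lemma smooth_on_bounded_linear:
  "open S \<Longrightarrow> bounded_linear L \<Longrightarrow> smooth_on S f \<Longrightarrow> smooth_on S (\<lambda>x. L (f x))"
  by (simp add: smooth_on_def times_differentiable_on_bounded_linear)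

lemma smooth_on_bounded_bilinear:
  "open S \<Longrightarrow> bounded_bilinear pr \<Longrightarrow> smooth_on S f \<Longrightarrow> smooth_on S g \<Longrightarrow> smooth_on S (\<lambda>x. pr (f x) (g x))"
  by (simp add: smooth_on_def times_differentiable_on_bounded_bilinear)

lemmas smooth_on_mult = smooth_on_bounded_bilinear[OF _ bounded_bilinear_mult]
lemmas smooth_on_scaleR = smooth_on_bounded_bilinear[OF _ bounded_bilinear_scaleR]
lemmas smooth_on_inner = smooth_on_bounded_bilinear[OF _ bounded_bilinear_inner]
lemmas smooth_on_uminus = smooth_on_bounded_linear[OF _ bounded_linear_minus[OF bounded_linear_ident]]

lemma smooth_on_diff:
  "open S \<Longrightarrow> smooth_on S f \<Longrightarrow> smooth_on S g \<Longrightarrow> smooth_on S (\<lambda>x. f x - g x)"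
  using smooth_on_add[OF _ _ smooth_on_uminus, of S f g] by simp

lemma smooth_on_prod:
  fixes f :: "'i \<Rightarrow> 'a::euclidean_space \<Rightarrow> real"
  shows "open S \<Longrightarrow> (\<And>i. i \<in> I \<Longrightarrow> smooth_on S (f i)) \<Longrightarrow> smooth_on S (\<lambda>x. \<Prod>i\<in>I. f i x)"
  by (induction I rule: infinite_finite_induct) (auto intro!: smooth_on_const smooth_on_mult)

lemma smooth_on_compose:
  "open S \<Longrightarrow> h ` S \<subseteq> R \<Longrightarrow> smooth_on R f \<Longrightarrow> smooth_on S h \<Longrightarrow> smooth_on S (\<lambda>x. f (h x))"
  unfolding smooth_on_def using times_differentiable_on_compose by blast

lemma smooth_on_inverse:
  "open S \<Longrightarrow> (\<And>x. x \<in> S \<Longrightarrow> f x \<noteq> 0) \<Longrightarrow> smooth_on S f \<Longrightarrow> smooth_on S (\<lambda>x. inverse (f x :: real))"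
  by (simp add: smooth_on_def times_differentiable_on_inverse)

lemma smooth_on_divide:
  "open S \<Longrightarrow> (\<And>x. x \<in> S \<Longrightarrow> g x \<noteq> 0) \<Longrightarrow> smooth_on S f \<Longrightarrow> smooth_on S g
    \<Longrightarrow> smooth_on S (\<lambda>x. f x / g x :: real)"
  unfolding divide_inverse by (intro smooth_on_mult smooth_on_inverse)

lemma smooth_on_sqrt:
  "open S \<Longrightarrow> (\<And>x. x \<in> S \<Longrightarrow> f x > 0) \<Longrightarrow> smooth_on S f \<Longrightarrow> smooth_on S (\<lambda>x. sqrt (f x))"
  by (simp add: smooth_on_def times_differentiable_on_sqrt)

lemma smooth_on_frechet_derivative_apply:
  fixes f :: "'a::euclidean_space \<Rightarrow> 'b::real_normed_vector"
  assumes "open S" "smooth_on S f" "smooth_on S Z"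
  shows "smooth_on S (\<lambda>x. frechet_derivative f (at x) (Z x))"
proof -
  have "smooth_on S (\<lambda>x. \<Sum>b\<in>Basis. (Z x \<bullet> b) *\<^sub>R frechet_derivative f (at x) b)"
    by (intro smooth_on_sum smooth_on_scaleR smooth_on_inner smooth_on_const
        smooth_on_frechet_derivative assms)
  then show ?thesis
    by (rule smooth_on_cong[OF assms(1)])
      (metis assms(2) has_derivative_linear linear_sum_Basis smooth_on_has_derivative)
qed

section \<open>Symmetry of second derivatives\<close>

text \<open>The mean value theorem is applied twice: in direction \<open>u\<close> to the increment
  of \<open>f\<close> under the shift by h v, then in direction \<open>v\<close> to the derivative
  along \<open>u\<close>. The left-hand side is symmetric in \<open>u\<close> and \<open>v\<close>,
  the right-hand side is a mixed second derivative.\<close>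

lemma DERIV_mvt_symmetric_difference:
  fixes f :: "'a::euclidean_space \<Rightarrow> real"
  assumes sm: "smooth_on S f" and "h > 0"
    and S: "\<And>s t. 0 \<le> s \<Longrightarrow> s \<le> h \<Longrightarrow> 0 \<le> t \<Longrightarrow> t \<le> h \<Longrightarrow> x + s *\<^sub>R u + t *\<^sub>R v \<in> S"
  obtains s t where "0 \<le> s" "s \<le> h" "0 \<le> t" "t \<le> h"
    "f (x + h *\<^sub>R u + h *\<^sub>R v) - f (x + h *\<^sub>R u) - f (x + h *\<^sub>R v) + f x
      = h * h * frechet_derivative (\<lambda>y. frechet_derivative f (at y) u) (at (x + s *\<^sub>R u + t *\<^sub>R v)) v"
proof -
  have line: "((\<lambda>s. F (y + s *\<^sub>R w)) has_real_derivative frechet_derivative F (at (y + s *\<^sub>R w)) w) (at s)"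
    if "smooth_on S F" "y + s *\<^sub>R w \<in> S" for F :: "'a \<Rightarrow> real" and y w s
  proof -
    have *: "((\<lambda>s. y + s *\<^sub>R w) has_derivative (\<lambda>t. t *\<^sub>R w)) (at s)"
      by (auto intro!: derivative_eq_intros)
    have "linear (frechet_derivative F (at (y + s *\<^sub>R w)))"
      using has_derivative_linear smooth_on_has_derivative that by blast
    then show ?thesis
      using diff_chain_at[OF * smooth_on_has_derivative[OF that]]
      by (simp add: has_field_derivative_def o_def linear_cmul mult.commute[of _ "frechet_derivative _ _ _"])
  qed
  let ?\<phi> = "\<lambda>s. f (x + h *\<^sub>R v + s *\<^sub>R u) - f (x + s *\<^sub>R u)"
  let ?Du = "\<lambda>y. frechet_derivative f (at y) u"
  have S1: "x + h *\<^sub>R v + s *\<^sub>R u \<in> S" "x + s *\<^sub>R u \<in> S" if "0 \<le> s" "s \<le> h" for s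
    using S[of s h] S[of s 0] that \<open>h > 0\<close> by (simp_all add: algebra_simps)
  obtain s where s: "0 < s" "s < h" "?\<phi> h - ?\<phi> 0 = (h - 0) * (?Du (x + h *\<^sub>R v + s *\<^sub>R u) - ?Du (x + s *\<^sub>R u))"
    using MVT2[of 0 h ?\<phi> "\<lambda>s. ?Du (x + h *\<^sub>R v + s *\<^sub>R u) - ?Du (x + s *\<^sub>R u)"] \<open>h > 0\<close>
      line[OF sm] S1 by (force intro: DERIV_diff)
  obtain t where t: "0 < t" "t < h"
    "?Du (x + s *\<^sub>R u + h *\<^sub>R v) - ?Du (x + s *\<^sub>R u + 0 *\<^sub>R v)
      = (h - 0) * frechet_derivative ?Du (at (x + s *\<^sub>R u + t *\<^sub>R v)) v"
    using MVT2[of 0 h "\<lambda>t. ?Du (x + s *\<^sub>R u + t *\<^sub>R v)"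
        "\<lambda>t. frechet_derivative ?Du (at (x + s *\<^sub>R u + t *\<^sub>R v)) v"] \<open>h > 0\<close>
      line[OF smooth_on_frechet_derivative[OF sm]] S[of s] s(1,2) by force
  show ?thesis
    using that[of s t] s t by (simp add: algebra_simps)
qed

text \<open>On a small parallelogram both mixed derivatives, at suitable points, equal the same
  second difference divided by h^2. By continuity their values at \<open>x\<close> cannot
  differ.\<close>

lemma frechet_derivative_symmetric_real:
  fixes f :: "'a::euclidean_space \<Rightarrow> real"
  assumes "open S" "smooth_on S f" "x \<in> S"
  shows "frechet_derivative (\<lambda>y. frechet_derivative f (at y) u) (at x) v
       = frechet_derivative (\<lambda>y. frechet_derivative f (at y) v) (at x) u"
proof (rule ccontr)
  define A where "A = (\<lambda>y. frechet_derivative (\<lambda>y. frechet_derivative f (at y) u) (at y) v)"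
  define B where "B = (\<lambda>y. frechet_derivative (\<lambda>y. frechet_derivative f (at y) v) (at y) u)"
  assume "\<not> ?thesis"
  then have ne: "\<bar>A x - B x\<bar> > 0" by (simp add: A_def B_def)
  have "isCont A x" "isCont B x"
    unfolding A_def B_def
    by (rule smooth_on_isCont[OF smooth_on_frechet_derivative[OF smooth_on_frechet_derivative[OF assms(2)]] assms(3)])+
  then obtain d1 d2 where d1: "d1 > 0" "\<And>y. dist y x < d1 \<Longrightarrow> dist (A y) (A x) < \<bar>A x - B x\<bar> / 2"
    and d2: "d2 > 0" "\<And>y. dist y x < d2 \<Longrightarrow> dist (B y) (B x) < \<bar>A x - B x\<bar> / 2"
    using ne unfolding continuous_at_eps_delta by (metis half_gt_zero)
  obtain d3 where d3: "d3 > 0" "\<And>y. dist y x < d3 \<Longrightarrow> y \<in> S"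
    using assms(1,3) by (auto simp: open_dist)
  \<comment> \<open>Scaled so that the whole parallelogram with sides h u and h v stays within the
    three radii; the summand 1 makes the estimate strict and the denominator nonzero.\<close>
  define h where "h = min d1 (min d2 d3) / (norm u + norm v + 1)"
  have pos: "norm u + norm v + 1 > 0" by (smt (verit) norm_ge_zero)
  have "h > 0" using d1 d2 d3 pos by (simp add: h_def)
  have near: "dist (x + s *\<^sub>R u + t *\<^sub>R v) x < min d1 (min d2 d3)"
    if "0 \<le> s" "s \<le> h" "0 \<le> t" "t \<le> h" for s t
  proof -
    have "dist (x + s *\<^sub>R u + t *\<^sub>R v) x \<le> s * norm u + t * norm v"
      using norm_triangle_ineq[of "s *\<^sub>R u" "t *\<^sub>R v"] that by (simp add: dist_norm algebra_simps)
    also have "\<dots> \<le> h * norm u + h * norm v"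
      using that by (intro add_mono mult_right_mono) auto
    also have "\<dots> < h * (norm u + norm v + 1)"
      using \<open>h > 0\<close> by (simp add: algebra_simps)
    also have "\<dots> = min d1 (min d2 d3)" using pos by (simp add: h_def)
    finally show ?thesis .
  qed
  obtain s t where st: "0 \<le> s" "s \<le> h" "0 \<le> t" "t \<le> h"
    "f (x + h *\<^sub>R u + h *\<^sub>R v) - f (x + h *\<^sub>R u) - f (x + h *\<^sub>R v) + f x = h * h * A (x + s *\<^sub>R u + t *\<^sub>R v)"
    using DERIV_mvt_symmetric_difference[OF assms(2) \<open>h > 0\<close>, of x u v] near d3 unfolding A_def
    by (metis min_less_iff_conj)
  have near': "dist (x + s *\<^sub>R v + t *\<^sub>R u) x < min d1 (min d2 d3)"
    if "0 \<le> s" "s \<le> h" "0 \<le> t" "t \<le> h" for s t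
    using near[of t s] that by (simp add: algebra_simps)
  obtain s' t' where st': "0 \<le> s'" "s' \<le> h" "0 \<le> t'" "t' \<le> h"
    "f (x + h *\<^sub>R v + h *\<^sub>R u) - f (x + h *\<^sub>R v) - f (x + h *\<^sub>R u) + f x = h * h * B (x + s' *\<^sub>R v + t' *\<^sub>R u)"
    using DERIV_mvt_symmetric_difference[OF assms(2) \<open>h > 0\<close>, of x v u] near' d3 unfolding B_def
    by (metis min_less_iff_conj)
  have "h * h * A (x + s *\<^sub>R u + t *\<^sub>R v) = h * h * B (x + s' *\<^sub>R v + t' *\<^sub>R u)"
    using st(5) st'(5) by (simp add: algebra_simps)
  then have "A (x + s *\<^sub>R u + t *\<^sub>R v) = B (x + s' *\<^sub>R v + t' *\<^sub>R u)" using \<open>h > 0\<close> by simp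
  moreover have "dist (A (x + s *\<^sub>R u + t *\<^sub>R v)) (A x) < \<bar>A x - B x\<bar> / 2"
    "dist (B (x + s' *\<^sub>R v + t' *\<^sub>R u)) (B x) < \<bar>A x - B x\<bar> / 2"
    using near[OF st(1-4)] near'[OF st'(1-4)] d1 d2 by auto
  ultimately show False by (simp add: dist_real_def) argo
qed

lemma frechet_derivative_symmetric:
  fixes f :: "'a::euclidean_space \<Rightarrow> 'b::euclidean_space"
  assumes "open S" "smooth_on S f" "x \<in> S"
  shows "frechet_derivative (\<lambda>y. frechet_derivative f (at y) u) (at x) v
       = frechet_derivative (\<lambda>y. frechet_derivative f (at y) v) (at x) u"
proof (rule euclidean_eqI)
  fix b :: 'b assume "b \<in> Basis"
  have sm: "smooth_on S (\<lambda>x. F x \<bullet> b)" if "smooth_on S F" for F :: "'a \<Rightarrow> 'b"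
    by (intro smooth_on_bounded_linear[OF _ bounded_linear_inner_left] assms(1) that)
  have comp: "frechet_derivative (\<lambda>y. F y \<bullet> b) (at y) w = frechet_derivative F (at y) w \<bullet> b"
    if "smooth_on S F" "y \<in> S" for F :: "'a \<Rightarrow> 'b" and y w
    using frechet_derivative_at[OF has_derivative_inner_left[OF smooth_on_has_derivative[OF that]]]
    by metis
  have D2: "frechet_derivative (\<lambda>y. frechet_derivative (\<lambda>y. f y \<bullet> b) (at y) w) (at x) z
      = frechet_derivative (\<lambda>y. frechet_derivative f (at y) w) (at x) z \<bullet> b" for w z
  proof -
    have "frechet_derivative (\<lambda>y. frechet_derivative f (at y) w \<bullet> b) (at x)
      = frechet_derivative (\<lambda>y. frechet_derivative (\<lambda>y. f y \<bullet> b) (at y) w) (at x)"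
      using comp[OF assms(2)]
      by (intro frechet_derivative_transform_within_open[OF _ assms(1,3)])
        (auto intro!: differentiableI smooth_on_has_derivative[OF sm[OF smooth_on_frechet_derivative[OF assms(2)]] assms(3)])
    then show ?thesis
      using comp[OF smooth_on_frechet_derivative[OF assms(2)] assms(3)] by metis
  qed
  show "frechet_derivative (\<lambda>y. frechet_derivative f (at y) u) (at x) v \<bullet> b
       = frechet_derivative (\<lambda>y. frechet_derivative f (at y) v) (at x) u \<bullet> b"
    using frechet_derivative_symmetric_real[OF assms(1) sm[OF assms(2)] assms(3), of u v] by (simp only: D2)
qed

section \<open>Bump functions\<close>

text \<open>For \<open>p = 1\<close> this is the classical flat function exp(-1/t). The polynomial
  parameter makes the family closed under differentiation, so that smoothness follows by
  induction.\<close>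

definition flat_function :: "real poly \<Rightarrow> real \<Rightarrow> real" where
  "flat_function p t = (if t > 0 then poly p (1 / t) * exp (- (1 / t)) else 0)"

lemma poly_exp_tendsto_0: "((\<lambda>s. poly p s * exp (- s)) \<longlongrightarrow> (0::real)) at_top"
proof -
  have "((\<lambda>s::real. \<Sum>i\<le>degree p. coeff p i * (s ^ i / exp s)) \<longlongrightarrow> (\<Sum>i\<le>degree p. coeff p i * 0)) at_top"
    by (intro tendsto_intros tendsto_power_div_exp_0)
  then show ?thesis
    by (simp add: poly_altdef exp_minus divide_inverse sum_distrib_right mult.assoc)
qed

lemma flat_function_tendsto_0: "(flat_function p \<longlongrightarrow> 0) (at 0)"
proof -
  have "((\<lambda>t. poly p (1 / t) * exp (- (1 / t))) \<longlongrightarrow> (0::real)) (at_right 0)"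
    using filterlim_compose[OF poly_exp_tendsto_0 filterlim_inverse_at_top_right, of p]
    by (simp add: divide_inverse)
  then have "(flat_function p \<longlongrightarrow> 0) (at_right 0)"
    by (rule Lim_transform_eventually)
      (auto simp: flat_function_def eventually_at_filter)
  moreover have "(flat_function p \<longlongrightarrow> 0) (at_left 0)"
    by (rule Lim_transform_eventually[of "\<lambda>_. 0"])
      (auto simp: flat_function_def eventually_at_filter)
  ultimately show ?thesis
    by (simp add: filterlim_split_at_real)
qed

text \<open>With s = 1/t, the derivative of p(s) exp(-s) with respect to t is s^2 (p(s) - p'(s))
  exp(-s), since ds/dt = -s^2; \<open>monom 1 2\<close> is the factor s^2.\<close>

lemma flat_function_DERIV:
  "(flat_function p has_real_derivative flat_function (monom 1 2 * (p - pderiv p)) t) (at t)"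
proof (cases "t = 0")
  case True
  \<comment> \<open>The difference quotient at 0 is again a member of the family: division by h =
    1/s multiplies the polynomial by s.\<close>
  have "((\<lambda>h. flat_function (monom 1 1 * p) h) \<longlongrightarrow> 0) (at 0)"
    by (rule flat_function_tendsto_0)
  then have "((\<lambda>h. (flat_function p (0 + h) - flat_function p 0) / h) \<longlongrightarrow> 0) (at 0)"
    by (rule Lim_transform_eventually)
      (auto simp: flat_function_def eventually_at_filter poly_monom)
  then show ?thesis using True by (simp add: DERIV_def flat_function_def)
next
  case False
  show ?thesis
  proof (cases "t > 0")
    case True
    have "((\<lambda>t. poly p (1 / t) * exp (- (1 / t))) has_real_derivative
        flat_function (monom 1 2 * (p - pderiv p)) t) (at t)"
      using True
      by (auto intro!: derivative_eq_intros poly_DERIV[THEN DERIV_chain2]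
          simp: flat_function_def poly_monom field_simps power2_eq_square)
    then show ?thesis
      by (rule has_field_derivative_transform_within[where d=t])
        (use True in \<open>auto simp: flat_function_def dist_real_def\<close>)
  next
    case f: False
    have "((\<lambda>t. 0) has_real_derivative flat_function (monom 1 2 * (p - pderiv p)) t) (at t)"
      using f by (auto simp: flat_function_def)
    then show ?thesis
      by (rule has_field_derivative_transform_within[where d="-t"])
        (use False f in \<open>auto simp: flat_function_def dist_real_def\<close>)
  qed
qed

lemma smooth_on_flat_function: "smooth_on UNIV (flat_function p)"
proof -
  have "times_differentiable_on k UNIV (flat_function p)" for k
  proof (induction k arbitrary: p)
    case 0
    then show ?case using flat_function_DERIV
      by (auto intro!: continuous_at_imp_continuous_on DERIV_isCont)
  next
    case (Suc k)
    show ?case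
      by (rule times_differentiable_on_SucI[where f' = "\<lambda>x v. flat_function (monom 1 2 * (p - pderiv p)) x * v"])
       (use flat_function_DERIV[of p] in \<open>auto simp: has_field_derivative_def
         intro!: Suc.IH times_differentiable_on_const times_differentiable_on_bounded_bilinear[OF _ bounded_bilinear_mult]\<close>)
  qed
  then show ?thesis by (simp add: smooth_on_def)
qed

text \<open>The squared distance is used because it is smooth at the centre as well.\<close>

definition bump :: "'a::euclidean_space \<Rightarrow> real \<Rightarrow> 'a \<Rightarrow> real" where
  "bump a r x = flat_function 1 (r\<^sup>2 - (x - a) \<bullet> (x - a))"

lemma smooth_on_bump: "smooth_on UNIV (bump a r)"
  unfolding bump_def
  by (rule smooth_on_compose[OF open_UNIV subset_UNIV smooth_on_flat_function])
    (auto intro!: smooth_on_diff smooth_on_inner smooth_on_const smooth_on_ident)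

lemma bump_nonneg: "bump a r x \<ge> 0"
  by (simp add: bump_def flat_function_def)

lemma bump_pos_iff:
  assumes "r > 0"
  shows "bump a r x > 0 \<longleftrightarrow> x \<in> ball a r"
proof -
  have "(norm (x - a))\<^sup>2 < r\<^sup>2 \<longleftrightarrow> norm (x - a) < r"
    using assms by (meson less_imp_le norm_ge_zero power2_less_imp_less power_strict_mono zero_less_numeral)
  then show ?thesis
    by (simp add: bump_def flat_function_def dist_norm norm_minus_commute power2_norm_eq_inner[symmetric])
qed

lemma bump_eq_0: "r > 0 \<Longrightarrow> x \<notin> ball a r \<Longrightarrow> bump a r x = 0"
  using bump_pos_iff[of r a x] bump_nonneg[of a r x] by linarith

section \<open>Coordinates and Gram determinants\<close>

text \<open>
  The library states Cramer's rule and the change of variables formula for \<open>real ^ 'n\<close> only.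
  The following index type makes them available for the model space \<open>'f\<close> of a manifold.
\<close>

typedef (overloaded) ('f::euclidean_space) coord = "{..<DIM('f)}"
  morphisms coord_index Coord
  using DIM_positive by blast

text \<open>The change of variables theorem asks for a finite well-ordered index type; the order
  itself has no geometric meaning.\<close>

instantiation coord :: (euclidean_space) linorder
begin

definition less_eq_coord :: "'a coord \<Rightarrow> 'a coord \<Rightarrow> bool" where
  "less_eq_coord i j \<longleftrightarrow> coord_index i \<le> coord_index j"

definition less_coord :: "'a coord \<Rightarrow> 'a coord \<Rightarrow> bool" where
  "less_coord i j \<longleftrightarrow> coord_index i < coord_index j"

instance
  by standard (auto simp: less_eq_coord_def less_coord_def coord_index_inject)

end

instance coord :: (euclidean_space) wellorder
proof
  fix P :: "'a coord \<Rightarrow> bool" and a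
  assume *: "\<And>x. (\<And>y. y < x \<Longrightarrow> P y) \<Longrightarrow> P x"
  show "P a"
    by (rule measure_induct_rule[where f=coord_index]) (rule *, simp add: less_coord_def)
qed

instance coord :: (euclidean_space) finite
proof
  have "finite (Coord ` {..<DIM('a)})" by blast
  then show "finite (UNIV :: 'a coord set)"
    by (metis type_definition.Abs_image type_definition_coord)
qed

lemma card_coord: "CARD('f::euclidean_space coord) = DIM('f)"
  using type_definition.card[OF type_definition_coord] by simp

definition coord_basis :: "'f::euclidean_space coord \<Rightarrow> 'f" where
  "coord_basis = (SOME h. bij_betw h UNIV Basis)"

lemma bij_betw_coord_basis: "bij_betw (coord_basis :: 'f::euclidean_space coord \<Rightarrow> 'f) UNIV Basis"
proof -
  have "\<exists>h. bij_betw h (UNIV :: 'f coord set) (Basis :: 'f set)"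
    by (rule finite_same_card_bij) (simp_all add: card_coord)
  then show ?thesis unfolding coord_basis_def by (rule someI_ex)
qed

lemma sum_coord_basis: "(\<Sum>i\<in>UNIV. h (coord_basis i)) = (\<Sum>b\<in>Basis. h b)"
  using sum.reindex_bij_betw[OF bij_betw_coord_basis] .

lemma coord_basis_in [simp]: "coord_basis i \<in> Basis"
  using bij_betw_coord_basis by (auto simp: bij_betw_def)

lemma inner_coord_basis: "coord_basis i \<bullet> coord_basis j = (if i = j then 1 else 0)"
  using bij_betw_coord_basis by (auto simp: inner_Basis bij_betw_def inj_def)

definition of_coords :: "real ^ 'f::euclidean_space coord \<Rightarrow> 'f" where
  "of_coords x = (\<Sum>i\<in>UNIV. x $ i *\<^sub>R coord_basis i)"

definition to_coords :: "'f::euclidean_space \<Rightarrow> real ^ 'f coord" where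
  "to_coords v = (\<chi> i. v \<bullet> coord_basis i)"

lemma linear_of_coords: "linear of_coords"
  by (auto simp: of_coords_def linear_iff scaleR_add_left sum.distrib scaleR_sum_right)

lemma linear_to_coords: "linear to_coords"
  by (auto simp: to_coords_def linear_iff vec_eq_iff inner_add_left)

lemma bounded_linear_of_coords: "bounded_linear of_coords"
  by (simp add: linear_conv_bounded_linear[symmetric] linear_of_coords)

lemma bounded_linear_to_coords: "bounded_linear to_coords"
  by (simp add: linear_conv_bounded_linear[symmetric] linear_to_coords)

lemma of_coords_to_coords [simp]: "of_coords (to_coords v) = v"
  by (simp add: of_coords_def to_coords_def sum_coord_basis[of "\<lambda>b. (v \<bullet> b) *\<^sub>R b"] euclidean_representation)

lemma to_coords_of_coords [simp]: "to_coords (of_coords x) = x"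
  by (simp add: of_coords_def to_coords_def vec_eq_iff inner_sum_left inner_coord_basis if_distrib cong: if_cong)

lemma of_coords_axis: "of_coords (axis j 1) = coord_basis j"
  by (simp add: of_coords_def axis_def if_distrib[of "\<lambda>x. x *\<^sub>R _"] cong: if_cong)

definition coord_matrix :: "('f::euclidean_space \<Rightarrow> 'f) \<Rightarrow> real ^ 'f coord ^ 'f coord" where
  "coord_matrix L = (\<chi> i j. L (coord_basis j) \<bullet> coord_basis i)"

lemma coord_matrix_eq: "coord_matrix L = matrix (\<lambda>x. to_coords (L (of_coords x)))"
  by (simp add: coord_matrix_def matrix_def to_coords_def of_coords_axis vec_eq_iff)

definition gram :: "('f::euclidean_space \<Rightarrow> 'f \<Rightarrow> real) \<Rightarrow> real ^ 'f coord ^ 'f coord" where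
  "gram b = (\<chi> i j. b (coord_basis i) (coord_basis j))"

lemma bilinear_sum_Basis:
  fixes b :: "'f::euclidean_space \<Rightarrow> 'g::euclidean_space \<Rightarrow> 'h::real_vector"
  assumes "bilinear b"
  shows "b u v = (\<Sum>i\<in>Basis. \<Sum>j\<in>Basis. ((u \<bullet> i) * (v \<bullet> j)) *\<^sub>R b i j)"
proof -
  have "linear (\<lambda>u. b u v)" "\<And>u. linear (b u)"
    using assms by (auto simp: bilinear_def)
  then have "b u v = (\<Sum>i\<in>Basis. (u \<bullet> i) *\<^sub>R b i v)" "b i v = (\<Sum>j\<in>Basis. (v \<bullet> j) *\<^sub>R b i j)" for i
    using linear_sum_Basis[of "\<lambda>u. b u v" u] linear_sum_Basis[of "b i" v] by blast+
  then show ?thesis by (simp add: scaleR_sum_right)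
qed

text \<open>In matrices the pulled-back form is L^T G L. The square on det L is the reason why the
  root of the Gram determinant transforms by |det L|, that is, as a density.\<close>

lemma det_gram_pullback:
  assumes "bilinear b" "linear L"
  shows "det (gram (\<lambda>u v. b (L u) (L v))) = (det (coord_matrix L))\<^sup>2 * det (gram b)"
proof -
  have "gram (\<lambda>u v. b (L u) (L v)) = transpose (coord_matrix L) ** gram b ** coord_matrix L"
  proof -
    have "b (L (coord_basis i)) (L (coord_basis j)) =
      (\<Sum>k\<in>Basis. (\<Sum>l\<in>Basis. (L (coord_basis i) \<bullet> l) * b l k) * (L (coord_basis j) \<bullet> k))" for i j
      unfolding bilinear_sum_Basis[OF assms(1), of "L (coord_basis i)"] sum_distrib_right
      by (subst sum.swap) (simp add: mult_ac)
    then show ?thesis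
      by (simp add: gram_def matrix_matrix_mult_def transpose_def coord_matrix_def vec_eq_iff
        sum_coord_basis[of "\<lambda>l. (L (coord_basis _) \<bullet> l) * b l (coord_basis _)"]
        sum_coord_basis[of "\<lambda>k. (\<Sum>l\<in>Basis. (L (coord_basis _) \<bullet> l) * b l k) * (L (coord_basis _) \<bullet> k)"])
  qed
  then show ?thesis by (simp add: det_mul power2_eq_square)
qed

section \<open>Orthonormal bases of an inner product\<close>

lemma orthonormal_independent:
  fixes b :: "'f::euclidean_space \<Rightarrow> 'f \<Rightarrow> real"
  assumes "bilinear b" "finite E" "\<And>u v. u \<in> E \<Longrightarrow> v \<in> E \<Longrightarrow> b u v = (if u = v then 1 else 0)"
  shows "independent E"
proof
  assume "dependent E"
  then obtain a c where ac: "(\<Sum>v\<in>E. c v *\<^sub>R v) = 0" "a \<in> E" "c a \<noteq> (0::real)"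
    using dependent_finite[OF assms(2)] by blast
  have l: "linear (\<lambda>v. b v a)" using assms(1) by (simp add: bilinear_def)
  have "b (\<Sum>v\<in>E. c v *\<^sub>R v) a = (\<Sum>v\<in>E. c v * b v a)"
    by (simp add: linear_sum[OF l] linear_cmul[OF l])
  also have "\<dots> = (\<Sum>v\<in>E. if v = a then c v else 0)"
    using assms(3) ac(2) by (intro sum.cong) auto
  also have "\<dots> = c a" using ac(2) assms(2) by simp
  finally show False using ac linear_0[OF l] by simp
qed

text \<open>Gram-Schmidt for the form \<open>b\<close>: fewer than \<open>DIM('f)\<close> vectors do
  not span, so some \<open>x\<close> lies outside their span; subtracting its projection leaves a
  nonzero vector, which positivity allows to be normalised.\<close>

lemma orthonormal_basis_exists:
  fixes b :: "'f::euclidean_space \<Rightarrow> 'f \<Rightarrow> real"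
  assumes bil: "bilinear b" and sym: "\<And>u v. b u v = b v u" and pos: "\<And>v. v \<noteq> 0 \<Longrightarrow> b v v > 0"
  shows "\<exists>E. orthonormal_basis b E"
proof -
  have "\<exists>E. finite E \<and> card E = k \<and> (\<forall>u\<in>E. \<forall>v\<in>E. b u v = (if u = v then 1 else 0))"
    if "k \<le> DIM('f)" for k
    using that
  proof (induction k)
    case 0
    then show ?case by (intro exI[of _ "{}"]) auto
  next
    case (Suc k)
    then obtain E where E: "finite E" "card E = k" "\<And>u v. u \<in> E \<Longrightarrow> v \<in> E \<Longrightarrow> b u v = (if u = v then 1 else 0)"
      by auto
    have "span E \<noteq> UNIV"
    proof
      assume "span E = UNIV"
      then have "DIM('f) \<le> card E"
        using dim_le_card[of UNIV E] E(1) by simp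
      then show False using Suc.prems E(2) by simp
    qed
    then obtain x where x: "x \<notin> span E" by auto
    define y where "y = x - (\<Sum>e\<in>E. b x e *\<^sub>R e)"
    have l: "linear (\<lambda>v. b v a)" "linear (b a)" for a using bil by (simp_all add: bilinear_def)
    have "y \<notin> span E"
    proof
      assume "y \<in> span E"
      moreover have "(\<Sum>e\<in>E. b x e *\<^sub>R e) \<in> span E"
        by (intro span_sum span_mul span_base)
      ultimately have "y + (\<Sum>e\<in>E. b x e *\<^sub>R e) \<in> span E" by (rule span_add)
      then show False using x by (simp add: y_def)
    qed
    then have "y \<noteq> 0" using span_0 by auto
    have yE: "b y a = 0" if "a \<in> E" for a
    proof -
      have "b y a = b x a - (\<Sum>e\<in>E. b x e * b e a)"
        by (simp add: y_def linear_diff[OF l(1)] linear_sum[OF l(1)] linear_cmul[OF l(1)])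
      also have "(\<Sum>e\<in>E. b x e * b e a) = (\<Sum>e\<in>E. if e = a then b x e else 0)"
        using E(3) that by (intro sum.cong) auto
      also have "\<dots> = b x a" using that E(1) by simp
      finally show ?thesis by simp
    qed
    define z where "z = (1 / sqrt (b y y)) *\<^sub>R y"
    have zz: "b z z = 1"
      using pos[OF \<open>y \<noteq> 0\<close>] linear_cmul[OF l(1)] linear_cmul[OF l(2)]
      by (simp add: z_def)
    have zE: "b z a = 0" "b a z = 0" if "a \<in> E" for a
      using yE[OF that] linear_cmul[OF l(1)] sym by (auto simp: z_def)
    have "z \<notin> E" using zz zE by force
    then show ?case
      using E zz zE by (intro exI[of _ "insert z E"]) auto
  qed
  then obtain E where E: "finite E" "card E = DIM('f)" "\<forall>u\<in>E. \<forall>v\<in>E. b u v = (if u = v then 1 else 0)"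
    by blast
  then have ind: "independent E" using orthonormal_independent[OF bil] by blast
  moreover have "span E = UNIV"
    using card_ge_dim_independent[of E UNIV] ind E(2) by (auto simp: dim_UNIV)
  ultimately show ?thesis using E(3) by (auto simp: orthonormal_basis_def)
qed

lemma orthonormal_basis_expand:
  fixes b :: "'f::euclidean_space \<Rightarrow> 'f \<Rightarrow> real"
  assumes "bilinear b" "orthonormal_basis b E"
  shows "finite E" and "(\<Sum>e\<in>E. b v e *\<^sub>R e) = v" and "card E = DIM('f)"
proof -
  show fin: "finite E" using assms(2) finiteI_independent by (auto simp: orthonormal_basis_def)
  show "card E = DIM('f)"
    using assms(2) dim_eq_card[of E UNIV] by (simp add: orthonormal_basis_def)
  have "v \<in> span E" using assms(2) by (simp add: orthonormal_basis_def)
  then obtain c where c: "v = (\<Sum>e\<in>E. c e *\<^sub>R e)"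
    unfolding span_finite[OF fin] by auto
  have "b v a = c a" if "a \<in> E" for a
  proof -
    have l: "linear (\<lambda>v. b v a)" using assms(1) by (simp add: bilinear_def)
    have "b v a = (\<Sum>e\<in>E. c e * b e a)"
      unfolding c by (simp add: linear_sum[OF l] linear_cmul[OF l])
    also have "\<dots> = (\<Sum>e\<in>E. if e = a then c e else 0)"
      using assms(2) that by (intro sum.cong) (auto simp: orthonormal_basis_def)
    finally show ?thesis using that fin by simp
  qed
  then show "(\<Sum>e\<in>E. b v e *\<^sub>R e) = v" using c by simp
qed

text \<open>Each \<open>D i\<close> is expanded in \<open>E\<close>, and after exchanging the sums
  the coordinates of \<open>e\<close> reassemble to \<open>e\<close>. This converts the Euclidean
  trace in a coordinate divergence into a trace with respect to the metric.\<close>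

lemma trace_orthonormal_basis:
  fixes b :: "'f::euclidean_space \<Rightarrow> 'f \<Rightarrow> real"
  assumes "bilinear b" "orthonormal_basis b E" "linear D"
  shows "(\<Sum>i\<in>Basis. D i \<bullet> i) = (\<Sum>e\<in>E. b (D e) e)"
proof -
  have l: "linear (\<lambda>v. b (D v) e)" for e
    using linear_compose[OF assms(3), of "\<lambda>v. b v e"] assms(1) by (simp add: bilinear_def o_def)
  have "(\<Sum>i\<in>Basis. D i \<bullet> i) = (\<Sum>i\<in>Basis. (\<Sum>e\<in>E. b (D i) e *\<^sub>R e) \<bullet> i)"
    by (simp add: orthonormal_basis_expand(2)[OF assms(1,2)])
  also have "\<dots> = (\<Sum>e\<in>E. \<Sum>i\<in>Basis. (e \<bullet> i) *\<^sub>R b (D i) e)"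
    by (subst sum.swap) (simp add: inner_sum_left mult.commute)
  also have "\<dots> = (\<Sum>e\<in>E. b (D e) e)"
    by (simp only: linear_sum_Basis[OF l, symmetric])
  finally show ?thesis .
qed

text \<open>Writing \<open>E\<close> as the image of the coordinate basis under a linear map makes
  pulling back by that map turn the Gram matrix into the identity.\<close>

lemma orthonormal_basis_enum:
  fixes b :: "'f::euclidean_space \<Rightarrow> 'f \<Rightarrow> real"
  assumes "bilinear b" "orthonormal_basis b E"
  obtains L :: "'f \<Rightarrow> 'f" where "linear L" "bij_betw (\<lambda>i. L (coord_basis i)) UNIV E"
proof -
  have "\<exists>h. bij_betw h (UNIV :: 'f coord set) E"
    by (rule finite_same_card_bij) (simp_all add: card_coord orthonormal_basis_expand[OF assms])
  then obtain h where h: "bij_betw h (UNIV :: 'f coord set) E" ..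
  define L where "L = (\<lambda>v. \<Sum>i\<in>UNIV. (v \<bullet> coord_basis i) *\<^sub>R h i)"
  have "linear L"
    by (auto simp: L_def linear_iff inner_add_left scaleR_add_left sum.distrib scaleR_sum_right)
  moreover have "L (coord_basis i) = h i" for i
    by (simp add: L_def inner_coord_basis if_distrib[of "\<lambda>x. x *\<^sub>R _"] cong: if_cong)
  ultimately show thesis by (intro that[of L]) (simp_all add: h)
qed

lemma gram_orthonormal:
  fixes b :: "'f::euclidean_space \<Rightarrow> 'f \<Rightarrow> real" and L :: "'f \<Rightarrow> 'f"
  assumes "orthonormal_basis b E" "bij_betw (\<lambda>i. L (coord_basis i)) UNIV E"
  shows "gram (\<lambda>u v. b (L u) (L v)) = mat 1"
proof -
  have "L (coord_basis i) \<in> E" "L (coord_basis i) = L (coord_basis j) \<longleftrightarrow> i = j" for i j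
    using assms(2) by (auto simp: bij_betw_def inj_def)
  then show ?thesis
    using assms(1) by (auto simp: gram_def mat_def vec_eq_iff orthonormal_basis_def)
qed

text \<open>Pulled back to an orthonormal basis the Gram determinant is 1, and by
  \<open>det_gram_pullback\<close> it has changed only by a square.\<close>

lemma det_gram_pos:
  fixes b :: "'f::euclidean_space \<Rightarrow> 'f \<Rightarrow> real"
  assumes bil: "bilinear b" and sym: "\<And>u v. b u v = b v u" and pos: "\<And>v. v \<noteq> 0 \<Longrightarrow> b v v > 0"
  shows "det (gram b) > 0"
proof -
  obtain E where E: "orthonormal_basis b E" using orthonormal_basis_exists[OF assms] by blast
  obtain L :: "'f \<Rightarrow> 'f" where L: "linear L" "bij_betw (\<lambda>i. L (coord_basis i)) UNIV E"
    using orthonormal_basis_enum[OF bil E] by blast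
  have "(det (coord_matrix L))\<^sup>2 * det (gram b) = 1"
    using det_gram_pullback[OF bil L(1)] gram_orthonormal[OF E L(2)] by simp
  then show ?thesis
    by (metis zero_less_mult_pos zero_less_one zero_less_power2 mult_zero_left power_zero_numeral zero_neq_one)
qed

section \<open>Jacobi's formula and smoothness of determinants\<close>

text \<open>A permutation other than the identity moves at least two points. In its summand the
  product rule differentiates one factor, and another off-diagonal factor, which is 0 at the
  identity matrix, survives; only the trace is left.\<close>

lemma det_has_derivative_at_one:
  fixes A :: "'x::real_normed_vector \<Rightarrow> real ^ 'n ^ 'n"
  assumes A: "\<And>i j. ((\<lambda>x. A x $ i $ j) has_derivative A' i j) (at x)" and A1: "A x = mat 1"
  shows "((\<lambda>x. det (A x)) has_derivative (\<lambda>h. \<Sum>i\<in>UNIV. A' i i h)) (at x)"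
proof -
  let ?P = "{p. p permutes (UNIV :: 'n set)}"
  let ?T = "\<lambda>p h. \<Sum>i\<in>UNIV. A' i (p i) h * (\<Prod>j\<in>UNIV - {i}. A x $ j $ p j)"
  have "((\<lambda>x. \<Sum>p\<in>?P. of_int (sign p) * (\<Prod>i\<in>UNIV. A x $ i $ p i)) has_derivative
      (\<lambda>h. \<Sum>p\<in>?P. of_int (sign p) * ?T p h)) (at x)"
    by (intro has_derivative_sum has_derivative_mult_right has_derivative_prod A)
  moreover have "(\<Sum>p\<in>?P. of_int (sign p) * ?T p h) = (\<Sum>i\<in>UNIV. A' i i h)" for h
  proof -
    have "?T p h = 0" if "p \<in> ?P" "p \<noteq> id" for p
    proof -
      have "inj p" using permutes_inj that(1) by blast
      have "(\<Prod>j\<in>UNIV - {i}. A x $ j $ p j) = 0" for i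
      proof -
        obtain k where k: "p k \<noteq> k" using \<open>p \<noteq> id\<close> by (auto simp: fun_eq_iff)
        \<comment> \<open>If the moved point \<open>k\<close> is the excluded index
          \<open>i\<close>, then \<open>p k\<close> serves instead: it differs from
          \<open>k\<close>, and it is moved too because \<open>p\<close> is injective.\<close>
        obtain j where "j \<noteq> i" "p j \<noteq> j"
        proof (cases "k = i")
          case True
          have "p (p k) \<noteq> p k"
            using k \<open>inj p\<close> by (auto simp: inj_def)
          then show ?thesis using that[of "p k"] k True by auto
        qed (use that k in auto)
        then have "A x $ j $ p j = 0" using A1 by (simp add: mat_def) 
        then show ?thesis using \<open>j \<noteq> i\<close> by (intro prod_zero) auto
      qed
      then show ?thesis by (simp only: mult_zero_right sum.neutral_const)
    qed
    then have "(\<Sum>p\<in>?P. of_int (sign p) * ?T p h) = (\<Sum>p\<in>{id}. of_int (sign p) * ?T p h)"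
      by (intro sum.mono_neutral_right) (auto simp: permutes_id)
    also have "\<dots> = (\<Sum>i\<in>UNIV. A' i i h)"
      using A1 by (simp add: sign_id mat_def)
    finally show ?thesis .
  qed
  ultimately show ?thesis by (simp add: det_def)
qed

text \<open>Jacobi's formula is reduced to the identity matrix: pull back by the constant map
  \<open>L\<close> that carries the coordinate basis to \<open>E\<close>, differentiate there, and
  undo the constant factor (det L)^2 = 1 / det (gram (b x)).\<close>

lemma det_gram_has_derivative:
  fixes b :: "'x::real_normed_vector \<Rightarrow> 'f::euclidean_space \<Rightarrow> 'f \<Rightarrow> real"
  assumes S: "open S" "x \<in> S" and bil: "\<And>y. y \<in> S \<Longrightarrow> bilinear (b y)"
    and b': "\<And>u v. ((\<lambda>y. b y u v) has_derivative b' u v) (at x)"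
    and E: "orthonormal_basis (b x) E"
  shows "((\<lambda>y. det (gram (b y))) has_derivative (\<lambda>h. det (gram (b x)) * (\<Sum>e\<in>E. b' e e h))) (at x)"
proof -
  obtain L :: "'f \<Rightarrow> 'f" where L: "linear L" "bij_betw (\<lambda>i. L (coord_basis i)) UNIV E"
    using orthonormal_basis_enum[OF bil[OF S(2)] E] by blast
  let ?d = "(det (coord_matrix L))\<^sup>2"
  have pull: "det (gram (\<lambda>u v. b y (L u) (L v))) = ?d * det (gram (b y))" if "y \<in> S" for y
    by (rule det_gram_pullback[OF bil[OF that] L(1)])
  have one: "?d * det (gram (b x)) = 1"
    using pull[OF S(2)] gram_orthonormal[OF E L(2)] by simp
  have "((\<lambda>y. det (gram (\<lambda>u v. b y (L u) (L v)))) has_derivative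
      (\<lambda>h. \<Sum>i\<in>UNIV. b' (L (coord_basis i)) (L (coord_basis i)) h)) (at x)"
    by (rule det_has_derivative_at_one) (use b' gram_orthonormal[OF E L(2)] in \<open>auto simp: gram_def\<close>)
  then have "((\<lambda>y. det (gram (\<lambda>u v. b y (L u) (L v))) * det (gram (b x))) has_derivative
      (\<lambda>h. (\<Sum>e\<in>E. b' e e h) * det (gram (b x)))) (at x)"
    unfolding sum.reindex_bij_betw[OF L(2), of "\<lambda>e. b' e e _"]
    by (rule has_derivative_mult_left)
  moreover have "det (gram (\<lambda>u v. b y (L u) (L v))) * det (gram (b x)) = det (gram (b y))" if "y \<in> S" for y
    using pull[OF that] one by (simp add: algebra_simps)
  ultimately have "((\<lambda>y. det (gram (b y))) has_derivative
      (\<lambda>h. (\<Sum>e\<in>E. b' e e h) * det (gram (b x)))) (at x)"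
    by (rule has_derivative_transform_within_open[OF _ S])
  then show ?thesis by (simp only: mult.commute[of "det _"])
qed

lemma smooth_on_det:
  fixes A :: "'x::euclidean_space \<Rightarrow> real ^ 'n ^ 'n"
  assumes "open S" "\<And>i j. smooth_on S (\<lambda>x. A x $ i $ j)"
  shows "smooth_on S (\<lambda>x. det (A x))"
  unfolding det_def
  by (intro smooth_on_sum smooth_on_mult smooth_on_prod smooth_on_const assms)

lemma smooth_on_det_gram:
  assumes "open S" "\<And>u v. smooth_on S (\<lambda>x. b x u v)"
  shows "smooth_on S (\<lambda>x. det (gram (b x)))"
  by (intro smooth_on_det) (simp_all add: assms gram_def)

text \<open>Cramer's rule expresses the solution by determinants, whence its smoothness.\<close>

lemma smooth_on_riesz:
  fixes b :: "'x::euclidean_space \<Rightarrow> 'f::euclidean_space \<Rightarrow> 'f \<Rightarrow> real" and Y :: "'x \<Rightarrow> 'f"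
  assumes S: "open S" and bil: "\<And>x. x \<in> S \<Longrightarrow> bilinear (b x)" and det: "\<And>x. x \<in> S \<Longrightarrow> det (gram (b x)) \<noteq> 0"
    and b: "\<And>u v. smooth_on S (\<lambda>x. b x u v)" and \<beta>: "\<And>v. smooth_on S (\<lambda>x. \<beta> x v)"
    and Y: "\<And>x v. x \<in> S \<Longrightarrow> b x v (Y x) = \<beta> x v"
  shows "smooth_on S Y"
proof -
  let ?C = "\<lambda>k x. (\<chi> i j. if j = k then \<beta> x (coord_basis i) else gram (b x) $ i $ j) :: real ^ 'f coord ^ 'f coord"
  have "to_coords (Y x) = (\<chi> k. det (?C k x) / det (gram (b x)))" if x: "x \<in> S" for x
  proof -
    have "gram (b x) *v to_coords (Y x) = (\<chi> i. \<beta> x (coord_basis i))"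
    proof -
      have l: "linear (b x u)" for u using bil[OF x] by (simp add: bilinear_def)
      have "(\<Sum>j\<in>Basis. b x (coord_basis i) j * (Y x \<bullet> j)) = \<beta> x (coord_basis i)" for i
        using linear_sum_Basis[OF l, of "coord_basis i" "Y x"] Y[OF x, of "coord_basis i"]
        by (simp add: mult.commute)
      then show ?thesis
        by (simp add: gram_def matrix_vector_mult_def to_coords_def vec_eq_iff
          sum_coord_basis[of "\<lambda>j. b x (coord_basis _) j * (Y x \<bullet> j)"])
    qed
    then show ?thesis using cramer[OF det[OF x]] by (simp cong: if_cong)
  qed
  then have Y_eq: "(\<Sum>k\<in>UNIV. (det (?C k x) / det (gram (b x))) *\<^sub>R coord_basis k) = Y x" if "x \<in> S" for x
    using of_coords_to_coords[of "Y x"] that by (simp add: of_coords_def)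
  have "smooth_on S (\<lambda>x. ?C k x $ i $ j)" for i j k
    by (cases "j = k") (simp_all add: gram_def b \<beta>)
  then have "smooth_on S (\<lambda>x. \<Sum>k\<in>UNIV. (det (?C k x) / det (gram (b x))) *\<^sub>R (coord_basis k :: 'f))"
    by (intro smooth_on_sum smooth_on_scaleR smooth_on_const smooth_on_divide smooth_on_det_gram smooth_on_det S b det)
  then show ?thesis by (rule smooth_on_cong[OF S _ Y_eq])
qed

section \<open>Nondegenerate forms\<close>

text \<open>\<open>T\<close> represents \<open>b\<close> through the Euclidean inner product.
  Nondegeneracy says that \<open>T\<close> is injective, hence surjective in finite
  dimension.\<close>

lemma riesz_nondegenerate:
  fixes b :: "'f::euclidean_space \<Rightarrow> 'f \<Rightarrow> real"
  assumes bil: "bilinear b" and nd: "\<And>v. (\<And>w. b v w = 0) \<Longrightarrow> v = 0" and "linear l"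
  shows "\<exists>v. \<forall>w. b v w = l w"
proof -
  define T where "T = (\<lambda>v. \<Sum>i\<in>Basis. b v i *\<^sub>R i :: 'f)"
  have L: "linear (\<lambda>v. b v a)" "linear (b a)" for a using bil by (simp_all add: bilinear_def)
  have T: "T v \<bullet> w = b v w" for v w
    using linear_sum_Basis[OF L(2), of v w] by (simp add: T_def inner_sum_left inner_commute[of w] mult.commute)
  have "linear T"
    using linear_add[OF L(1)] linear_cmul[OF L(1)]
    by (auto simp: T_def linear_iff scaleR_add_left sum.distrib scaleR_sum_right)
  moreover have "inj T"
    using \<open>linear T\<close> nd T by (metis inner_zero_left linear_injective_0)
  ultimately have "surj T" by (rule linear_inj_imp_surj)
  then obtain v where v: "T v = (\<Sum>i\<in>Basis. l i *\<^sub>R i)" by (metis surjD)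
  have "b v w = l w" for w
    using linear_sum_Basis[OF assms(3), of w]
    by (simp add: T[symmetric] v inner_sum_left inner_commute[of w] mult.commute)
  then show ?thesis by blast
qed

lemma lorentzian_form_nondegenerate:
  fixes b :: "'f::euclidean_space \<Rightarrow> 'f \<Rightarrow> real"
  assumes "lorentzian_form b" "bilinear b" "\<And>w. b v w = 0"
  shows "v = 0"
proof -
  obtain E t where E: "independent E" "span E = UNIV" "t \<in> E"
    "\<And>u v. u \<in> E \<Longrightarrow> v \<in> E \<Longrightarrow> b u v = (if u \<noteq> v then 0 else if u = t then -1 else 1)"
    using assms(1) by (auto simp: lorentzian_form_def)
  have fin: "finite E" using E(1) by (rule finiteI_independent)
  have "v \<in> span E" using E(2) by simp
  then obtain c where c: "v = (\<Sum>e\<in>E. c e *\<^sub>R e)"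
    unfolding span_finite[OF fin] by auto
  have "c a = 0" if "a \<in> E" for a
  proof -
    have l: "linear (\<lambda>v. b v a)" using assms(2) by (simp add: bilinear_def)
    have "b v a = (\<Sum>e\<in>E. c e * b e a)"
      unfolding c by (simp add: linear_sum[OF l] linear_cmul[OF l])
    also have "\<dots> = (\<Sum>e\<in>E. if e = a then c e * b a a else 0)"
      using E(4) that by (intro sum.cong) auto
    also have "\<dots> = c a * b a a" using that fin by simp
    finally show ?thesis using assms(3)[of a] E(4)[OF that that] by (simp split: if_splits)
  qed
  then show ?thesis using c by simp
qed

text \<open>Koszul's formula at one point: \<open>D u v w\<close> stands for the derivative of
  g(v,w) along \<open>u\<close>, and constant coordinate fields commute, so no brackets occur.
  \<open>K\<close> is the Christoffel symbol of the first kind, whose index is raised by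
  \<open>riesz_nondegenerate\<close>; uniqueness combines the metric equation in its three cyclic
  versions.\<close>

lemma levi_civita_form_unique:
  fixes b :: "'f::euclidean_space \<Rightarrow> 'f \<Rightarrow> real"
  assumes bil: "bilinear b" and sym: "\<And>u v. b u v = b v u" and nd: "\<And>v. (\<And>w. b v w = 0) \<Longrightarrow> v = 0"
    and D1: "\<And>v w. linear (\<lambda>u. D u v w)" and D2: "\<And>u w. linear (\<lambda>v. D u v w)"
    and D3: "\<And>u v w. D u v w = D u w v"
  shows "\<exists>!\<Gamma>. bilinear \<Gamma> \<and> (\<forall>u v. \<Gamma> u v = \<Gamma> v u) \<and> (\<forall>u v w. D u v w = b (\<Gamma> u v) w + b v (\<Gamma> u w))"
proof -
  have L: "linear (\<lambda>v. b v a)" "linear (b a)" for a using bil by (simp_all add: bilinear_def)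
  note b_simps = linear_add[OF L(1)] linear_add[OF L(2)] linear_diff[OF L(1)] linear_diff[OF L(2)]
    linear_cmul[OF L(1)] linear_cmul[OF L(2)]
  note D_simps = linear_add[OF D1] linear_add[OF D2] linear_cmul[OF D1] linear_cmul[OF D2]
  have eqI: "v = w" if "\<And>z. b v z = b w z" for v w
    using nd[of "v - w"] that b_simps by simp
  define K where "K = (\<lambda>u v w. (D u v w + D v u w - D w u v) / 2)"
  have "\<exists>z. \<forall>w. b z w = K u v w" for u v
  proof (rule riesz_nondegenerate[OF bil nd])
    have "linear (D a c)" for a c
      using D2[of a c] by (simp add: D3[of a _ c])
    then show "linear (K u v)"
      using D_simps by (auto simp: K_def linear_iff algebra_simps add_divide_distrib diff_divide_distrib)
  qed
  then obtain \<Gamma> where \<Gamma>: "\<And>u v w. b (\<Gamma> u v) w = K u v w" by metis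
  have sym\<Gamma>: "\<Gamma> u v = \<Gamma> v u" for u v
    by (rule eqI) (simp add: \<Gamma> K_def D3[of _ u v])
  have D3': "D a (x + y) c = D a x c + D a y c" "D a c (x + y) = D a c x + D a c y"
    "D a (r *\<^sub>R x) c = r * D a x c" "D a c (r *\<^sub>R x) = r * D a c x"
    "D (x + y) a c = D x a c + D y a c" "D (r *\<^sub>R x) a c = r * D x a c" for a x y c r
    by (simp_all add: D_simps D3[of a c])
  have "linear (\<Gamma> u)" for u
    by (rule linearI; rule eqI) (simp_all add: b_simps \<Gamma> K_def D3' algebra_simps add_divide_distrib diff_divide_distrib)
  then have "bilinear \<Gamma>" using sym\<Gamma> by (simp add: bilinear_def)
  moreover have "D u v w = b (\<Gamma> u v) w + b v (\<Gamma> u w)" for u v w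
    using D3[of u v w] D3[of v u w] D3[of w u v]
    by (simp add: \<Gamma> sym[of v] K_def field_simps)
  moreover have "\<Gamma>' = \<Gamma>" if \<Gamma>': "\<forall>u v. \<Gamma>' u v = \<Gamma>' v u" "\<forall>u v w. D u v w = b (\<Gamma>' u v) w + b v (\<Gamma>' u w)" for \<Gamma>'
  proof (intro ext eqI)
    fix u v w
    have "D u v w = b (\<Gamma>' u v) w + b v (\<Gamma>' u w)" "D v u w = b (\<Gamma>' u v) w + b u (\<Gamma>' v w)"
      "D w u v = b (\<Gamma>' u w) v + b u (\<Gamma>' v w)"
      using \<Gamma>' by metis+
    then show "b (\<Gamma>' u v) w = b (\<Gamma> u v) w"
      using sym[of v] by (simp add: \<Gamma> K_def)
  qed
  ultimately show ?thesis using sym\<Gamma> by (intro ex1I[of _ \<Gamma>]) auto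
qed

section \<open>Manifolds\<close>

abbreviation transition :: "('a, 'e::euclidean_space) chart \<Rightarrow> ('a, 'e) chart \<Rightarrow> 'e \<Rightarrow> 'e \<Rightarrow> 'e" where
  "transition c d x \<equiv> frechet_derivative (cmap d \<circ> cinv c) (at x)"

locale manifold =
  fixes A :: "('a::{t2_space,second_countable_topology}, 'e::euclidean_space) chart set"
  assumes connected_manifold: "connected_manifold A"
begin

lemma chart:
  assumes "c \<in> A"
  shows "open (cdom c)" "open (cimg c)" "continuous_on (cdom c) (cmap c)" "continuous_on (cimg c) (cinv c)"
    and "p \<in> cdom c \<Longrightarrow> cmap c p \<in> cimg c" "p \<in> cdom c \<Longrightarrow> cinv c (cmap c p) = p"
    and "x \<in> cimg c \<Longrightarrow> cinv c x \<in> cdom c" "x \<in> cimg c \<Longrightarrow> cmap c (cinv c x) = x"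
  using assms connected_manifold
  by (auto simp: connected_manifold_def is_chart_def homeomorphism_def cimg_def)

lemma chart_at: "chart_at A p \<in> A" "p \<in> cdom (chart_at A p)"
proof -
  have "\<exists>c. c \<in> A \<and> p \<in> cdom c"
    using connected_manifold by (auto simp: connected_manifold_def)
  from someI_ex[OF this] show "chart_at A p \<in> A" "p \<in> cdom (chart_at A p)"
    by (simp_all add: chart_at_def)
qed

lemma chart_image_iff:
  assumes "c \<in> A"
  shows "x \<in> cmap c ` (cdom c \<inter> V) \<longleftrightarrow> x \<in> cimg c \<and> cinv c x \<in> V"
proof
  assume "x \<in> cmap c ` (cdom c \<inter> V)"
  then show "x \<in> cimg c \<and> cinv c x \<in> V" using chart(5,6)[OF assms] by auto
next
  assume "x \<in> cimg c \<and> cinv c x \<in> V"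
  then show "x \<in> cmap c ` (cdom c \<inter> V)"
    using chart(7,8)[OF assms, of x] by (intro image_eqI[of _ _ "cinv c x"]) auto
qed

lemma open_chart_image:
  assumes "c \<in> A" "open V"
  shows "open (cmap c ` (cdom c \<inter> V))"
proof -
  have "cmap c ` (cdom c \<inter> V) = cimg c \<inter> cinv c -` V"
    using chart_image_iff[OF assms(1)] by auto
  then show ?thesis
    using continuous_open_preimage[OF chart(4)[OF assms(1)] chart(2)[OF assms(1)] assms(2)] by simp
qed

section \<open>Transition maps and components of tangent vectors\<close>

lemma smooth_on_transition:
  "c \<in> A \<Longrightarrow> d \<in> A \<Longrightarrow> smooth_on (cmap c ` (cdom c \<inter> cdom d)) (cmap d \<circ> cinv c)"
  using connected_manifold by (auto simp: connected_manifold_def)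

lemma open_overlap: "c \<in> A \<Longrightarrow> d \<in> A \<Longrightarrow> open (cmap c ` (cdom c \<inter> cdom d))"
  by (intro open_chart_image chart)

lemma trans_has_derivative:
  assumes "c \<in> A" "d \<in> A" "p \<in> cdom c" "p \<in> cdom d"
  shows "((cmap d \<circ> cinv c) has_derivative transition c d (cmap c p)) (at (cmap c p))"
  by (rule smooth_on_has_derivative[OF smooth_on_transition[OF assms(1,2)]]) (use assms in auto)

lemma linear_trans:
  "c \<in> A \<Longrightarrow> d \<in> A \<Longrightarrow> p \<in> cdom c \<Longrightarrow> p \<in> cdom d \<Longrightarrow> linear (transition c d (cmap c p))"
  by (rule has_derivative_linear[OF trans_has_derivative])

text \<open>The cocycle rule behind every change of chart below. The two maps are compared on the
  open image of \<open>cdom c \<inter> cdom d\<close>, where the inverse charts cancel; this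
  determines the derivative at \<open>p\<close>.\<close>

lemma trans_compose:
  assumes "c \<in> A" "d \<in> A" "e \<in> A" "p \<in> cdom c" "p \<in> cdom d" "p \<in> cdom e"
  shows "transition d e (cmap d p) (transition c d (cmap c p) v) = transition c e (cmap c p) v"
proof -
  have "((cmap e \<circ> cinv d) has_derivative transition d e (cmap d p)) (at ((cmap d \<circ> cinv c) (cmap c p)))"
    using trans_has_derivative[OF assms(2,3,5,6)] chart(6)[OF assms(1,4)] by simp
  from diff_chain_at[OF trans_has_derivative[OF assms(1,2,4,5)] this]
  have D: "((cmap e \<circ> cinv d \<circ> (cmap d \<circ> cinv c)) has_derivative transition d e (cmap d p) \<circ> transition c d (cmap c p)) (at (cmap c p))" .
  have eq: "(cmap e \<circ> cinv d \<circ> (cmap d \<circ> cinv c)) x = (cmap e \<circ> cinv c) x"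
    if "x \<in> cmap c ` (cdom c \<inter> cdom d)" for x
    using that chart(6)[OF assms(1)] chart(6)[OF assms(2)] by auto
  have "cmap c p \<in> cmap c ` (cdom c \<inter> cdom d)" using assms(4,5) by blast
  then have "((cmap e \<circ> cinv c) has_derivative transition d e (cmap d p) \<circ> transition c d (cmap c p)) (at (cmap c p))"
    by (rule has_derivative_transform_within_open[OF D open_overlap[OF assms(1,2)] _ eq])
  from has_derivative_unique[OF this trans_has_derivative[OF assms(1,3,4,6)]]
  show ?thesis by (simp add: fun_eq_iff)
qed

lemma trans_self:
  assumes "c \<in> A" "p \<in> cdom c"
  shows "transition c c (cmap c p) v = v"
proof -
  have "((\<lambda>x. x) has_derivative (\<lambda>x. x)) (at (cmap c p))" by simp
  then have "((cmap c \<circ> cinv c) has_derivative (\<lambda>x. x)) (at (cmap c p))"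
    by (rule has_derivative_transform_within_open[OF _ chart(2)[OF assms(1)]])
      (use chart(5,8)[OF assms(1)] assms in auto)
  from has_derivative_unique[OF this trans_has_derivative[OF assms(1,1,2,2)]]
  show ?thesis by metis
qed

lemma trans_inverse:
  assumes "c \<in> A" "d \<in> A" "p \<in> cdom c" "p \<in> cdom d"
  shows "transition d c (cmap d p) (transition c d (cmap c p) v) = v"
  using trans_compose[of c d c] trans_self assms by simp

lemma components_eq: "components A c p v = transition (chart_at A p) c (cmap (chart_at A p) p) v"
  by (simp add: components_def)

lemma tangent_vector_eq: "tangent_vector A c p u = transition c (chart_at A p) (cmap c p) u"
  by (simp add: tangent_vector_def)

lemma components_tangent_vector:
  "c \<in> A \<Longrightarrow> p \<in> cdom c \<Longrightarrow> components A c p (tangent_vector A c p u) = u"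
  by (simp add: components_eq tangent_vector_eq trans_inverse chart_at)

lemma tangent_vector_components:
  "c \<in> A \<Longrightarrow> p \<in> cdom c \<Longrightarrow> tangent_vector A c p (components A c p u) = u"
  by (simp add: components_eq tangent_vector_eq trans_inverse chart_at)

lemma components_change:
  "c \<in> A \<Longrightarrow> d \<in> A \<Longrightarrow> p \<in> cdom c \<Longrightarrow> p \<in> cdom d \<Longrightarrow>
    transition c d (cmap c p) (components A c p v) = components A d p v"
  by (simp add: components_eq trans_compose chart_at)

lemma components_tangent_vector_change:
  "c \<in> A \<Longrightarrow> d \<in> A \<Longrightarrow> p \<in> cdom c \<Longrightarrow> p \<in> cdom d \<Longrightarrow>
    components A d p (tangent_vector A c p u) = transition c d (cmap c p) u"
  by (simp add: components_eq tangent_vector_eq trans_compose chart_at)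

lemma components_chart_at: "components A (chart_at A p) p v = v"
  by (simp add: components_eq trans_self chart_at)

lemma tangent_vector_chart_at: "tangent_vector A (chart_at A p) p v = v"
  by (simp add: tangent_vector_eq trans_self chart_at)

lemma linear_components: "c \<in> A \<Longrightarrow> p \<in> cdom c \<Longrightarrow> linear (components A c p)"
  using linear_trans[OF chart_at(1) _ chart_at(2)] by (simp add: components_eq[abs_def])

lemma linear_tangent_vector: "c \<in> A \<Longrightarrow> p \<in> cdom c \<Longrightarrow> linear (tangent_vector A c p)"
  using linear_trans[OF _ chart_at(1) _ chart_at(2)] by (simp add: tangent_vector_eq[abs_def])

lemma metric_in_chart_components:
  "c \<in> A \<Longrightarrow> p \<in> cdom c \<Longrightarrow>
    metric_in_chart A g c (cmap c p) (components A c p u) (components A c p v) = g p u v"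
  by (simp add: metric_in_chart_def chart tangent_vector_components)

lemma metric_in_chart_cmap:
  "c \<in> A \<Longrightarrow> p \<in> cdom c \<Longrightarrow>
    metric_in_chart A g c (cmap c p) u v = g p (tangent_vector A c p u) (tangent_vector A c p v)"
  by (simp add: metric_in_chart_def chart)

lemma metric_in_chart_change:
  "c \<in> A \<Longrightarrow> d \<in> A \<Longrightarrow> p \<in> cdom c \<Longrightarrow> p \<in> cdom d \<Longrightarrow>
    metric_in_chart A g d (cmap d p) (transition c d (cmap c p) u) (transition c d (cmap c p) v)
      = metric_in_chart A g c (cmap c p) u v"
  using metric_in_chart_components[of d p g "tangent_vector A c p u" "tangent_vector A c p v"]
  by (simp add: components_tangent_vector_change metric_in_chart_cmap)

lemma bilinear_metric_in_chart:
  assumes "smooth_symmetric_form A g" "c \<in> A" "x \<in> cimg c"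
  shows "bilinear (metric_in_chart A g c x)"
proof -
  have "bilinear (g (cinv c x))" using assms(1) by (simp add: smooth_symmetric_form_def)
  moreover have "linear (tangent_vector A c (cinv c x))"
    using linear_tangent_vector[OF assms(2) chart(7)[OF assms(2,3)]] .
  ultimately show ?thesis
    unfolding bilinear_def metric_in_chart_def
    using linear_compose[of "tangent_vector A c (cinv c x)"] by (auto simp: o_def)
qed

lemma symmetric_metric_in_chart:
  "smooth_symmetric_form A g \<Longrightarrow> metric_in_chart A g c x u v = metric_in_chart A g c x v u"
  by (simp add: metric_in_chart_def smooth_symmetric_form_def)

lemma smooth_on_metric_in_chart:
  "smooth_symmetric_form A g \<Longrightarrow> c \<in> A \<Longrightarrow> smooth_on (cimg c) (\<lambda>x. metric_in_chart A g c x u v)"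
  by (simp add: smooth_symmetric_form_def)

lemma continuous_on_UNIV_chartwise:
  assumes "\<And>c. c \<in> A \<Longrightarrow> continuous_on (cimg c) (\<lambda>x. f (cinv c x))"
  shows "continuous_on UNIV f"
proof (rule continuous_at_imp_continuous_on, clarify)
  fix p
  let ?c = "chart_at A p"
  note c = chart_at[of p]
  have "continuous_on (cdom ?c) (\<lambda>q. f (cinv ?c (cmap ?c q)))"
    by (rule continuous_on_compose2[OF assms[OF c(1)] chart(3)[OF c(1)]]) (use chart(5)[OF c(1)] in auto)
  then have "continuous_on (cdom ?c) f"
    by (rule continuous_on_eq) (use chart(6)[OF c(1)] in auto)
  then show "isCont f p" using c chart(1) by (simp add: continuous_on_eq_continuous_at)
qed

lemma smooth_function_continuous_on: "smooth_function A f \<Longrightarrow> continuous_on UNIV f"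
  by (rule continuous_on_UNIV_chartwise)
    (auto simp: smooth_function_def o_def dest: smooth_on_continuous_on)

section \<open>Cut-off functions and extension of tangent vectors\<close>

lemma compact_chart_preimage:
  "c \<in> A \<Longrightarrow> L \<subseteq> cimg c \<Longrightarrow> compact L \<Longrightarrow> compact (cinv c ` L)"
  using chart(4) by (meson compact_continuous_image continuous_on_subset)

lemma compact_chart_image:
  "c \<in> A \<Longrightarrow> K \<subseteq> cdom c \<Longrightarrow> compact K \<Longrightarrow> compact (cmap c ` K)"
  using chart(3) by (meson compact_continuous_image continuous_on_subset)

definition chart_bump :: "('a, 'e) chart \<Rightarrow> 'e \<Rightarrow> real \<Rightarrow> 'a \<Rightarrow> real" where
  "chart_bump c a r p = (if p \<in> cdom c then bump a r (cmap c p) else 0)"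

lemma chart_bump_eq_0:
  assumes "c \<in> A" "r > 0" "p \<notin> cinv c ` cball a r"
  shows "chart_bump c a r p = 0"
proof (cases "p \<in> cdom c")
  case True
  then have "cmap c p \<notin> cball a r" using assms chart(6) by (metis image_eqI)
  then show ?thesis using assms(2) by (simp add: chart_bump_def bump_eq_0)
qed (simp add: chart_bump_def)

text \<open>The domain of \<open>c\<close> and the complement of the preimage of the closed ball
  cover the manifold. That complement is open because compact sets are closed in a Hausdorff space;
  this is what lets cut-off objects be extended by 0.\<close>

lemma smooth_on_overlap_cases:
  assumes "c \<in> A" "d \<in> A" "cball a r \<subseteq> cimg c"
    and "smooth_on (cmap d ` (cdom d \<inter> cdom c)) f" "smooth_on (cmap d ` (cdom d \<inter> - (cinv c ` cball a r))) f"
  shows "smooth_on (cimg d) f"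
proof (rule smooth_on_local)
  fix x assume x: "x \<in> cimg d"
  have "closed (cinv c ` cball a r)"
    using compact_chart_preimage[OF assms(1,3)] by (simp add: compact_imp_closed)
  then have op: "open (- (cinv c ` cball a r))" by blast
  show "\<exists>U. open U \<and> x \<in> U \<and> smooth_on U f"
  proof (cases "cinv d x \<in> cdom c")
    case True
    then show ?thesis
      using x assms open_overlap by (intro exI[of _ "cmap d ` (cdom d \<inter> cdom c)"]) (simp add: chart_image_iff)
  next
    case False
    then have "cinv d x \<in> - (cinv c ` cball a r)"
      using chart(7)[OF assms(1)] assms(3) by auto
    then show ?thesis
      using x assms(2,5) open_chart_image[OF assms(2) op]
      by (intro exI[of _ "cmap d ` (cdom d \<inter> - (cinv c ` cball a r))"]) (simp add: chart_image_iff)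
  qed
qed

lemma smooth_on_chart_bump_overlap:
  assumes "c \<in> A" "d \<in> A"
  shows "smooth_on (cmap d ` (cdom d \<inter> cdom c)) (\<lambda>x. chart_bump c a r (cinv d x))"
proof -
  have "smooth_on (cmap d ` (cdom d \<inter> cdom c)) (\<lambda>x. bump a r ((cmap c \<circ> cinv d) x))"
    by (rule smooth_on_compose[OF open_overlap[OF assms(2,1)] subset_UNIV smooth_on_bump smooth_on_transition[OF assms(2,1)]])
  then show ?thesis
    by (rule smooth_on_cong[OF open_overlap[OF assms(2,1)]]) (use chart_image_iff[OF assms(2)] in \<open>auto simp: chart_bump_def\<close>)
qed

lemma smooth_function_chart_bump:
  assumes "c \<in> A" "r > 0" "cball a r \<subseteq> cimg c"
  shows "smooth_function A (chart_bump c a r)"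
  unfolding smooth_function_def o_def
proof
  fix d assume d: "d \<in> A"
  have "closed (cinv c ` cball a r)"
    using compact_chart_preimage[OF assms(1,3)] by (simp add: compact_imp_closed)
  then have "open (cmap d ` (cdom d \<inter> - (cinv c ` cball a r)))"
    by (intro open_chart_image[OF d]) blast
  then have "smooth_on (cmap d ` (cdom d \<inter> - (cinv c ` cball a r))) (\<lambda>x. chart_bump c a r (cinv d x))"
    by (rule smooth_on_cong[OF _ smooth_on_const[of _ 0]])
      (use chart_image_iff[OF d] chart_bump_eq_0[OF assms(1,2)] in auto)
  then show "smooth_on (cimg d) (\<lambda>x. chart_bump c a r (cinv d x))"
    by (rule smooth_on_overlap_cases[OF assms(1) d assms(3) smooth_on_chart_bump_overlap[OF assms(1) d]])
qed

lemma chart_ball: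
  obtains r where "r > 0" "cball (cmap (chart_at A p) p) r \<subseteq> cimg (chart_at A p)"
  using chart(2,5) chart_at by (meson open_contains_cball)

lemma chart_bump_pos:
  assumes "r > 0"
  shows "chart_bump (chart_at A p) (cmap (chart_at A p) p) r p > 0"
  using assms chart_at(2)[of p] by (simp add: chart_bump_def bump_pos_iff)

text \<open>The \<open>SOME\<close> in the definition needs a witness: the field with constant
  components \<open>v\<close> in the chart at \<open>q\<close>, multiplied by a cut-off function
  equal to 1 at \<open>q\<close>.\<close>

lemma vector_field_extending:
  "smooth_vector_field A (vector_field_extending A q v)" "vector_field_extending A q v q = v"
proof -
  define c a where "c = chart_at A q" and "a = cmap c q"
  obtain r where r: "r > 0" "cball a r \<subseteq> cimg c"
    using chart_ball[of q] by (auto simp: c_def a_def)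
  have c: "c \<in> A" "q \<in> cdom c" using chart_at by (auto simp: c_def)
  \<comment> \<open>Outside \<open>cdom c\<close> the value of \<open>tangent_vector A c p v\<close>
    is meaningless, but there the bump is 0.\<close>
  define V where "V = (\<lambda>p. (chart_bump c a r p / chart_bump c a r q) *\<^sub>R tangent_vector A c p v)"
  have "smooth_vector_field A V"
    unfolding smooth_vector_field_def
  proof
    fix d assume d: "d \<in> A"
    have comp: "components A d (cinv d x) (V (cinv d x))
        = (chart_bump c a r (cinv d x) / chart_bump c a r q) *\<^sub>R components A d (cinv d x) (tangent_vector A c (cinv d x) v)"
      if "x \<in> cimg d" for x
      using linear_components[OF d chart(7)[OF d that]] by (simp add: V_def linear_cmul)
    note op = open_overlap[OF d c(1)]
    have "closed (cinv c ` cball a r)"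
      using compact_chart_preimage[OF c(1) r(2)] by (simp add: compact_imp_closed)
    then have op2: "open (cmap d ` (cdom d \<inter> - (cinv c ` cball a r)))"
      by (intro open_chart_image[OF d]) blast
    show "smooth_on (cimg d) (\<lambda>x. components A d (cinv d x) (V (cinv d x)))"
    proof (rule smooth_on_overlap_cases[OF c(1) d r(2)])
      have "smooth_on (cmap d ` (cdom d \<inter> cdom c)) (\<lambda>x. frechet_derivative (cmap d \<circ> cinv c) (at ((cmap c \<circ> cinv d) x)) v)"
        by (rule smooth_on_compose[OF op _ smooth_on_frechet_derivative[OF smooth_on_transition[OF c(1) d]] smooth_on_transition[OF d c(1)]])
          (use chart(6)[OF d] in auto)
      then have "smooth_on (cmap d ` (cdom d \<inter> cdom c)) (\<lambda>x. (chart_bump c a r (cinv d x) / chart_bump c a r q) *\<^sub>R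
           frechet_derivative (cmap d \<circ> cinv c) (at ((cmap c \<circ> cinv d) x)) v)"
        unfolding divide_inverse
        by (intro smooth_on_scaleR op smooth_on_mult smooth_on_const smooth_on_chart_bump_overlap c d)
      then show "smooth_on (cmap d ` (cdom d \<inter> cdom c)) (\<lambda>x. components A d (cinv d x) (V (cinv d x)))"
      proof (rule smooth_on_cong[OF op])
        fix x assume "x \<in> cmap d ` (cdom d \<inter> cdom c)"
        then have x: "x \<in> cimg d" "cinv d x \<in> cdom c" using chart_image_iff[OF d] by auto
        show "(chart_bump c a r (cinv d x) / chart_bump c a r q) *\<^sub>R
           frechet_derivative (cmap d \<circ> cinv c) (at ((cmap c \<circ> cinv d) x)) v = components A d (cinv d x) (V (cinv d x))"
          using components_tangent_vector_change[OF c(1) d x(2) chart(7)[OF d x(1)]] by (simp add: comp[OF x(1)])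
      qed
      show "smooth_on (cmap d ` (cdom d \<inter> - (cinv c ` cball a r))) (\<lambda>x. components A d (cinv d x) (V (cinv d x)))"
        by (rule smooth_on_cong[OF op2 smooth_on_const[of _ 0]])
          (use chart_image_iff[OF d] chart_bump_eq_0[OF c(1) r(1)] comp in auto)
    qed
  qed
  moreover have "V q = v"
    using chart_bump_pos[OF r(1), of q] tangent_vector_chart_at[of q v] by (simp add: V_def c_def a_def)
  ultimately have "\<exists>V. smooth_vector_field A V \<and> V q = v" by blast
  from someI_ex[OF this] show "smooth_vector_field A (vector_field_extending A q v)" "vector_field_extending A q v q = v"
    by (simp_all add: vector_field_extending_def)
qed

lemma smooth_vector_field_components:
  "smooth_vector_field A Y \<Longrightarrow> c \<in> A \<Longrightarrow> smooth_on (cimg c) (\<lambda>x. components A c (cinv c x) (Y (cinv c x)))"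
  by (simp add: smooth_vector_field_def)

definition field_derivative :: "('a \<Rightarrow> 'e) \<Rightarrow> ('a \<Rightarrow> real) \<Rightarrow> 'a \<Rightarrow> real" where
  "field_derivative Y f p =
     frechet_derivative (f \<circ> cinv (chart_at A p)) (at (cmap (chart_at A p) p)) (Y p)"

text \<open>The definition uses a chart that changes with \<open>p\<close>; for continuity and for
  the product rule the derivative is needed in one fixed chart.\<close>

lemma field_derivative_chart:
  assumes "smooth_function A f" "c \<in> A" "p \<in> cdom c"
  shows "field_derivative Y f p = frechet_derivative (f \<circ> cinv c) (at (cmap c p)) (components A c p (Y p))"
proof -
  let ?d = "chart_at A p"
  note d = chart_at[of p]
  have f: "(f \<circ> cinv e has_derivative frechet_derivative (f \<circ> cinv e) (at (cmap e p))) (at (cmap e p))"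
    if "e \<in> A" "p \<in> cdom e" for e
    using assms(1) that chart(5)[OF that] by (intro smooth_on_has_derivative) (auto simp: smooth_function_def)
  have "(f \<circ> cinv c has_derivative frechet_derivative (f \<circ> cinv c) (at (cmap c p))) (at ((cmap c \<circ> cinv ?d) (cmap ?d p)))"
    using f[OF assms(2,3)] chart(6)[OF d] by simp
  from diff_chain_at[OF trans_has_derivative[OF d(1) assms(2) d(2) assms(3)] this]
  have "(f \<circ> cinv c \<circ> (cmap c \<circ> cinv ?d) has_derivative
      frechet_derivative (f \<circ> cinv c) (at (cmap c p)) \<circ> transition ?d c (cmap ?d p)) (at (cmap ?d p))" .
  then have "(f \<circ> cinv ?d has_derivative
      frechet_derivative (f \<circ> cinv c) (at (cmap c p)) \<circ> transition ?d c (cmap ?d p)) (at (cmap ?d p))"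
    by (rule has_derivative_transform_within_open[OF _ open_overlap[OF d(1) assms(2)]])
      (use d assms chart(6)[OF assms(2)] chart(6)[OF d(1)] in auto)
  from has_derivative_unique[OF this f[OF d]]
  show ?thesis by (simp add: field_derivative_def components_eq fun_eq_iff)
qed

end

section \<open>Integration of compactly supported functions\<close>

lemma integral_compact_support:
  fixes F :: "'n::euclidean_space \<Rightarrow> real"
  assumes "\<And>x. x \<notin> L \<Longrightarrow> F x = 0" "L \<subseteq> S"
  shows "integral S F = integral UNIV F"
proof -
  have "(\<lambda>x. if x \<in> S then F x else 0) = F" using assms by (auto simp: fun_eq_iff)
  then show ?thesis using integral_restrict_UNIV[of S F] by simp
qed

lemma absolutely_integrable_compact_support:
  fixes F :: "'n::euclidean_space \<Rightarrow> real"
  assumes "continuous_on UNIV F" "compact L" "\<And>x. x \<notin> L \<Longrightarrow> F x = 0" "L \<subseteq> S"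
  shows "F absolutely_integrable_on S"
proof -
  obtain a where a: "L \<subseteq> cbox (-a) a"
    using assms(2) compact_imp_bounded bounded_subset_cbox_symmetric by metis
  have "F absolutely_integrable_on cbox (-a) a"
    using assms(1) by (intro absolutely_integrable_continuous) (rule continuous_on_subset, auto)
  moreover have "(\<lambda>x. if x \<in> cbox (-a) a then F x else 0) = F" "(\<lambda>x. if x \<in> S then F x else 0) = F"
    using assms(3,4) a by (auto simp: fun_eq_iff)
  ultimately show ?thesis by (metis absolutely_integrable_restrict_UNIV)
qed

lemma integrable_compact_support:
  fixes F :: "'n::euclidean_space \<Rightarrow> real"
  assumes "continuous_on UNIV F" "compact L" "\<And>x. x \<notin> L \<Longrightarrow> F x = 0"
  shows "F integrable_on UNIV"
  using absolutely_integrable_compact_support[OF assms subset_UNIV] by (simp add: absolutely_integrable_on_def)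

lemma frechet_derivative_eq_0_outside:
  assumes "closed L" "\<And>x. x \<notin> L \<Longrightarrow> F x = 0" "x \<notin> L"
  shows "frechet_derivative F (at x) v = 0"
proof -
  have "((\<lambda>x. 0) has_derivative (\<lambda>v. 0)) (at x)" by simp
  then have "(F has_derivative (\<lambda>v. 0)) (at x)"
    by (rule has_derivative_transform_within_open[of _ _ _ _ "- L"]) (use assms in auto)
  from frechet_derivative_at[OF this] show ?thesis by metis
qed

text \<open>
  The difference \<open>F (x + v) - F x\<close> is the integral of the derivative over the segment, and it
  integrates to \<open>0\<close> because the integral is invariant under translations.
\<close>

lemma integral_directional_derivative_eq_0:
  fixes F :: "'n::euclidean_space \<Rightarrow> real"
  assumes F: "smooth_on UNIV F" and L: "compact L" and F0: "\<And>x. x \<notin> L \<Longrightarrow> F x = 0"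
  shows "integral UNIV (\<lambda>x. frechet_derivative F (at x) v) = 0"
proof -
  let ?D = "\<lambda>x. frechet_derivative F (at x) v"
  have D0: "?D x = 0" if "x \<notin> L" for x
    by (rule frechet_derivative_eq_0_outside[OF compact_imp_closed[OF L] F0 that])
  have Dc: "continuous_on UNIV ?D"
    by (rule smooth_on_continuous_on[OF smooth_on_frechet_derivative[OF F]])
  \<comment> \<open>One box has to contain all translates of \<open>L\<close> by -t v with 0 <= t <=
    1. Then, for every such t, the integral over the box of a shifted function is its full integral,
    and the order of integration can be exchanged on a product of boxes.\<close>
  have "compact ((\<lambda>p. fst p - snd p *\<^sub>R v) ` (L \<times> {0..1::real}))"
    by (intro compact_continuous_image compact_Times L) (auto intro!: continuous_intros)
  then obtain a where a: "(\<lambda>p. fst p - snd p *\<^sub>R v) ` (L \<times> {0..1::real}) \<subseteq> cbox (-a) a"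
    using compact_imp_bounded bounded_subset_cbox_symmetric by metis
  have shift: "integral (cbox (-a) a) (\<lambda>x. G (x + t *\<^sub>R v)) = integral UNIV G"
    if t: "t \<in> {0..1}" and G: "\<And>x. x \<notin> L \<Longrightarrow> G x = 0" for t and G :: "'n \<Rightarrow> real"
  proof -
    have "L \<subseteq> cbox (-a + t *\<^sub>R v) (a + t *\<^sub>R v)"
    proof
      fix x assume "x \<in> L"
      then have "x - t *\<^sub>R v \<in> cbox (-a) a" using a t by force
      then show "x \<in> cbox (-a + t *\<^sub>R v) (a + t *\<^sub>R v)"
        by (auto simp: mem_box inner_diff_left inner_add_left algebra_simps)
    qed
    then have "integral (cbox (-a + t *\<^sub>R v) (a + t *\<^sub>R v)) G = integral UNIV G"
      by (intro integral_compact_support[OF G])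
    then show ?thesis
      using integral_shift_cbox_plus[of "-a" a G "t *\<^sub>R v"] by (simp add: o_def add.commute)
  qed
  have ftc: "integral (cbox 0 1) (\<lambda>t. ?D (x + t *\<^sub>R v)) = F (x + v) - F x" for x
  proof -
    have "((\<lambda>t. F (x + t *\<^sub>R v)) has_vector_derivative ?D (x + t *\<^sub>R v)) (at t within {0..1})" for t
    proof -
      have 1: "((\<lambda>t. x + t *\<^sub>R v) has_derivative (\<lambda>h. h *\<^sub>R v)) (at t)"
        by (auto intro!: derivative_eq_intros)
      have 2: "(F has_derivative frechet_derivative F (at (x + t *\<^sub>R v))) (at (x + t *\<^sub>R v))"
        by (rule smooth_on_has_derivative[OF F UNIV_I])
      show ?thesis
        using diff_chain_at[OF 1 2] linear_cmul[OF has_derivative_linear[OF 2]]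
        by (auto simp: has_vector_derivative_def o_def intro: has_derivative_at_withinI)
    qed
    from fundamental_theorem_of_calculus[OF _ this]
    show ?thesis by (simp add: integral_unique)
  qed
  have "integral (cbox (-a) a) (\<lambda>x. integral (cbox 0 1) (\<lambda>t. ?D (x + t *\<^sub>R v)))
      = integral (cbox 0 (1::real)) (\<lambda>t. integral (cbox (-a) a) (\<lambda>x. ?D (x + t *\<^sub>R v)))"
    by (rule integral_swap_continuous)
      (auto simp: case_prod_beta intro!: continuous_intros continuous_on_compose2[OF Dc])
  also have "\<dots> = integral {0..1::real} (\<lambda>t. integral UNIV ?D)"
    unfolding cbox_interval by (rule Henstock_Kurzweil_Integration.integral_cong) (rule shift[OF _ D0])
  also have "\<dots> = integral UNIV ?D" by simp
  finally have "integral UNIV ?D = integral (cbox (-a) a) (\<lambda>x. F (x + v) - F x)"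
    by (simp only: ftc)
  also have "\<dots> = integral (cbox (-a) a) (\<lambda>x. F (x + v)) - integral (cbox (-a) a) F"
    by (intro integral_diff integrable_continuous)
      (auto intro!: continuous_intros continuous_on_compose2[OF smooth_on_continuous_on[OF F]])
  also have "\<dots> = 0"
    using shift[OF _ F0, of 1] shift[OF _ F0, of 0] by simp
  finally show ?thesis .
qed

lemma integral_divergence_eq_0:
  fixes F :: "'n::euclidean_space \<Rightarrow> 'n"
  assumes F: "smooth_on UNIV F" and L: "compact L" and F0: "\<And>x. x \<notin> L \<Longrightarrow> F x = 0"
  shows "integral UNIV (\<lambda>x. \<Sum>b\<in>Basis. frechet_derivative F (at x) b \<bullet> b) = 0"
proof -
  have sm: "smooth_on UNIV (\<lambda>x. F x \<bullet> b)" for b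
    by (intro smooth_on_bounded_linear[OF open_UNIV bounded_linear_inner_left] F)
  have eq: "frechet_derivative F (at x) v \<bullet> b = frechet_derivative (\<lambda>x. F x \<bullet> b) (at x) v" for x b v
    using frechet_derivative_at[OF has_derivative_inner_left[OF smooth_on_has_derivative[OF F UNIV_I]]] by metis
  have F0': "F x \<bullet> b = 0" if "x \<notin> L" for x b using F0[OF that] by simp
  have "(\<lambda>x. frechet_derivative (\<lambda>x. F x \<bullet> b) (at x) b) integrable_on UNIV" for b
    by (rule integrable_compact_support[OF smooth_on_continuous_on[OF smooth_on_frechet_derivative[OF sm]] L
          frechet_derivative_eq_0_outside[OF compact_imp_closed[OF L] F0']])
  then show ?thesis
    unfolding eq by (simp add: integral_sum integral_directional_derivative_eq_0[OF sm L F0'])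
qed

lemma smooth_on_extend_by_0:
  assumes U: "open U" "smooth_on U F" and L: "closed L" "L \<subseteq> U" "\<And>x. x \<in> U \<Longrightarrow> x \<notin> L \<Longrightarrow> F x = 0"
  shows "smooth_on UNIV (\<lambda>x. if x \<in> U then F x else 0)"
proof (rule smooth_on_local)
  fix x
  show "\<exists>V. open V \<and> x \<in> V \<and> smooth_on V (\<lambda>x. if x \<in> U then F x else 0)"
  proof (cases "x \<in> U")
    case True
    then show ?thesis using smooth_on_cong[OF U] U(1) by (intro exI[of _ U]) auto
  next
    case False
    have "smooth_on (- L) (\<lambda>x. if x \<in> U then F x else 0)"
      by (rule smooth_on_cong[OF _ smooth_on_const[of _ 0]]) (use L in auto)
    then show ?thesis using False L by (intro exI[of _ "- L"]) auto
  qed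
qed

lemma continuous_on_extend_by_0:
  fixes F :: "'n::topological_space \<Rightarrow> 'b::real_normed_vector"
  assumes U: "open U" "continuous_on U F" and L: "closed L" "L \<subseteq> U" "\<And>x. x \<in> U \<Longrightarrow> x \<notin> L \<Longrightarrow> F x = 0"
  shows "continuous_on UNIV (\<lambda>x. if x \<in> U then F x else 0)"
proof -
  have "continuous_on U (\<lambda>x. if x \<in> U then F x else 0)"
    by (rule continuous_on_eq[OF U(2)]) auto
  moreover have "continuous_on (- L) (\<lambda>x. if x \<in> U then F x else 0)"
    by (rule continuous_on_eq[OF continuous_on_const[of _ 0]]) (use L in auto)
  ultimately have "continuous_on (U \<union> - L) (\<lambda>x. if x \<in> U then F x else 0)"
    using U(1) L(1) by (intro continuous_on_open_Un) auto
  moreover have "U \<union> - L = UNIV" using L(2) by blast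
  ultimately show ?thesis by simp
qed

section \<open>The divergence theorem on a compact manifold\<close>

context manifold
begin

section \<open>Densities and integrals in a single chart\<close>

text \<open>The transformation law under which \<open>w\<close> times a function has the same
  integral in every chart. The absolute value admits transition maps that reverse
  orientation.\<close>

definition density :: "(('a, 'e) chart \<Rightarrow> 'e \<Rightarrow> real) \<Rightarrow> bool" where
  "density w \<longleftrightarrow> (\<forall>c\<in>A. smooth_on (cimg c) (w c) \<and> (\<forall>x\<in>cimg c. w c x > 0)) \<and>
     (\<forall>c\<in>A. \<forall>d\<in>A. \<forall>p\<in>cdom c \<inter> cdom d.
        w c (cmap c p) = \<bar>det (coord_matrix (transition c d (cmap c p)))\<bar> * w d (cmap d p))"

definition chart_integrand :: "(('a, 'e) chart \<Rightarrow> 'e \<Rightarrow> real) \<Rightarrow> ('a, 'e) chart \<Rightarrow> ('a \<Rightarrow> real) \<Rightarrow> 'e \<Rightarrow> real" where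
  "chart_integrand w c h x = (if x \<in> cimg c then w c x * h (cinv c x) else 0)"

definition chart_integral :: "(('a, 'e) chart \<Rightarrow> 'e \<Rightarrow> real) \<Rightarrow> ('a, 'e) chart \<Rightarrow> ('a \<Rightarrow> real) \<Rightarrow> real" where
  "chart_integral w c h = integral UNIV (\<lambda>z. chart_integrand w c h (of_coords z))"

definition supported :: "('a \<Rightarrow> real) \<Rightarrow> 'a set \<Rightarrow> bool" where
  "supported h K \<longleftrightarrow> compact K \<and> continuous_on UNIV h \<and> (\<forall>p. p \<notin> K \<longrightarrow> h p = 0)"

lemma supported_mult: "supported h K \<Longrightarrow> continuous_on UNIV f \<Longrightarrow> supported (\<lambda>p. f p * h p) K"
  by (auto simp: supported_def intro!: continuous_intros)

lemma supported_mult': "supported f K \<Longrightarrow> continuous_on UNIV h \<Longrightarrow> supported (\<lambda>p. f p * h p) K"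
  by (auto simp: supported_def intro!: continuous_intros)

lemma supported_Int: "supported h K \<Longrightarrow> supported f L \<Longrightarrow> supported (\<lambda>p. f p * h p) (K \<inter> L)"
  by (auto simp: supported_def compact_Int intro!: continuous_intros)

lemma chart_integrand_continuous:
  assumes "density w" "c \<in> A" "supported h K" "K \<subseteq> cdom c"
  shows "continuous_on UNIV (chart_integrand w c h)" "x \<notin> cmap c ` K \<Longrightarrow> chart_integrand w c h x = 0"
proof -
  have K: "compact K" "continuous_on UNIV h" "\<And>p. p \<notin> K \<Longrightarrow> h p = 0"
    using assms(3) by (auto simp: supported_def)
  have L: "compact (cmap c ` K)" by (rule compact_chart_image[OF assms(2,4) K(1)])
  have zero: "w c x * h (cinv c x) = 0" if "x \<in> cimg c" "x \<notin> cmap c ` K" for x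
    using K(3)[of "cinv c x"] that chart(8)[OF assms(2), of x] by (metis image_eqI mult_zero_right)
  then show "x \<notin> cmap c ` K \<Longrightarrow> chart_integrand w c h x = 0"
    by (auto simp: chart_integrand_def)
  have "continuous_on (cimg c) (w c)"
    using assms(1,2) smooth_on_continuous_on by (auto simp: density_def)
  then have "continuous_on (cimg c) (\<lambda>x. w c x * h (cinv c x))"
    by (intro continuous_intros continuous_on_compose2[OF K(2) chart(4)[OF assms(2)]]) auto
  then show "continuous_on UNIV (chart_integrand w c h)"
    unfolding chart_integrand_def
    by (rule continuous_on_extend_by_0[OF chart(2)[OF assms(2)] _ compact_imp_closed[OF L] _ zero])
      (use assms(4) chart(5)[OF assms(2)] in auto)
qed

lemma chart_integrand_coords:
  assumes "density w" "c \<in> A" "supported h K" "K \<subseteq> cdom c"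
  shows "continuous_on UNIV (\<lambda>z. chart_integrand w c h (of_coords z))"
    and "compact (to_coords ` cmap c ` K)"
    and "z \<notin> to_coords ` cmap c ` K \<Longrightarrow> chart_integrand w c h (of_coords z) = 0"
proof -
  show "continuous_on UNIV (\<lambda>z. chart_integrand w c h (of_coords z))"
    by (rule continuous_on_compose2[OF chart_integrand_continuous(1)[OF assms]])
      (auto intro: linear_continuous_on bounded_linear_of_coords)
  show "compact (to_coords ` cmap c ` K)"
    using assms(3)
    by (intro compact_continuous_image[OF linear_continuous_on[OF bounded_linear_to_coords]] compact_chart_image[OF assms(2,4)])
      (simp add: supported_def)
  show "chart_integrand w c h (of_coords z) = 0" if "z \<notin> to_coords ` cmap c ` K"
    using that by (intro chart_integrand_continuous(2)[OF assms]) (metis image_eqI to_coords_of_coords)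
qed

lemma chart_integral_add:
  assumes "density w" "c \<in> A" "K \<subseteq> cdom c" "\<And>i. i \<in> I \<Longrightarrow> supported (h i) K"
  shows "chart_integral w c (\<lambda>p. \<Sum>i\<in>I. h i p) = (\<Sum>i\<in>I. chart_integral w c (h i))"
proof (cases "finite I")
  case True
  have "chart_integrand w c (\<lambda>p. \<Sum>i\<in>I. h i p) x = (\<Sum>i\<in>I. chart_integrand w c (h i) x)" for x
    by (simp add: chart_integrand_def sum_distrib_left)
  moreover have "(\<lambda>z. chart_integrand w c (h i) (of_coords z)) integrable_on UNIV" if "i \<in> I" for i
    by (rule integrable_compact_support[OF chart_integrand_coords[OF assms(1,2) assms(4)[OF that] assms(3)]])
  ultimately show ?thesis
    using True by (simp add: chart_integral_def integral_sum)
qed (simp add: chart_integral_def chart_integrand_def cong: if_cong)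

text \<open>On the coordinate image of \<open>K\<close> the transition map is injective and
  differentiable, so the change of variables formula applies to this compact set; the Jacobian is
  absorbed by the law of \<open>density\<close>. Functions supported in two charts thus have an
  unambiguous integral.\<close>

lemma chart_integral_change:
  assumes w: "density w" and c: "c \<in> A" and d: "d \<in> A" and h: "supported h K" and K: "K \<subseteq> cdom c" "K \<subseteq> cdom d"
  shows "chart_integral w c h = chart_integral w d h"
proof -
  let ?S = "to_coords ` cmap c ` K"
  let ?g = "\<lambda>z. to_coords ((cmap d \<circ> cinv c) (of_coords z))"
  let ?g' = "\<lambda>z x. to_coords (transition c d (of_coords z) (of_coords x))"
  let ?f = "\<lambda>e z. chart_integrand w e h (of_coords z)"
  have gS: "?g ` ?S = to_coords ` cmap d ` K"
    using chart(6)[OF c] K by (auto simp: image_comp intro!: image_cong)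
  have inj: "inj_on ?g ?S"
  proof (rule inj_onI, clarify)
    fix p q assume pq: "p \<in> K" "q \<in> K" "?g (to_coords (cmap c p)) = ?g (to_coords (cmap c q))"
    then have "cmap d p = cmap d q"
      using chart(6)[OF c subsetD[OF K(1)]] by (auto dest!: arg_cong[of _ _ of_coords])
    then show "to_coords (cmap c p) = to_coords (cmap c q)"
      using chart(6)[OF d] K(2) pq by (metis subsetD)
  qed
  have der: "(?g has_derivative ?g' z) (at z within ?S)" if "z \<in> ?S" for z
  proof -
    obtain p where p: "p \<in> K" "z = to_coords (cmap c p)" using \<open>z \<in> ?S\<close> by auto
    have 1: "(of_coords has_derivative of_coords) (at z)"
      by (rule bounded_linear_imp_has_derivative[OF bounded_linear_of_coords])
    have 2: "((cmap d \<circ> cinv c) has_derivative transition c d (of_coords z)) (at (of_coords z))"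
      using trans_has_derivative[OF c d] p K by auto
    from bounded_linear.has_derivative[OF bounded_linear_to_coords diff_chain_at[OF 1 2]]
    have "(?g has_derivative ?g' z) (at z)" by (simp add: o_def)
    then show ?thesis by (rule has_derivative_at_withinI)
  qed
  note I = chart_integrand_coords[OF w d h K(2)]
  have S: "compact ?S" by (rule chart_integrand_coords(2)[OF w c h K(1)])
  \<comment> \<open>The change of variables theorem speaks of vector-valued integrands, hence the
    detour through \<open>real ^ 1\<close>.\<close>
  have "(\<lambda>z. vec (?f d z) :: real ^ 1) absolutely_integrable_on ?g ` ?S
      \<and> integral (?g ` ?S) (\<lambda>z. vec (?f d z) :: real ^ 1) = vec (chart_integral w d h)"
    unfolding gS chart_integral_def
    using absolutely_integrable_compact_support[OF I(1,2) _ subset_refl] I(3)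
      integral_compact_support[of "to_coords ` cmap d ` K" "?f d", OF I(3) subset_refl]
    by (auto simp: absolutely_integrable_on_1_iff integral_on_1_eq)
  then have "integral ?S (\<lambda>z. \<bar>det (matrix (?g' z))\<bar> *\<^sub>R (vec (?f d (?g z)) :: real ^ 1)) = vec (chart_integral w d h)"
    using has_absolute_integral_change_of_variables_compact[OF S der inj, of "\<lambda>z. vec (?f d z) :: real ^ 1" "vec (chart_integral w d h)"]
    by blast
  then have "integral ?S (\<lambda>z. \<bar>det (matrix (?g' z))\<bar> * ?f d (?g z)) = chart_integral w d h"
    by (simp add: integral_on_1_eq vec_eq_iff)
  moreover have "\<bar>det (matrix (?g' z))\<bar> * ?f d (?g z) = ?f c z" if "z \<in> ?S" for z
  proof -
    obtain p where p: "p \<in> K" "z = to_coords (cmap c p)" using \<open>z \<in> ?S\<close> by auto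
    then have p': "p \<in> cdom c" "p \<in> cdom d" using K by auto
    have "w c (cmap c p) = \<bar>det (coord_matrix (transition c d (cmap c p)))\<bar> * w d (cmap d p)"
      using w c d p' unfolding density_def by blast
    then show ?thesis
      using chart(5,6)[OF c p'(1)] chart(5,6)[OF d p'(2)]
      by (simp add: p(2) chart_integrand_def coord_matrix_eq[symmetric])
  qed
  then have "integral ?S (\<lambda>z. \<bar>det (matrix (?g' z))\<bar> * ?f d (?g z)) = integral ?S (?f c)"
    by (rule Henstock_Kurzweil_Integration.integral_cong)
  ultimately have "integral ?S (?f c) = chart_integral w d h" by simp
  then show ?thesis
    using integral_compact_support[of ?S "?f c" ?S] chart_integrand_coords(3)[OF w c h K(1)]
    by (simp add: chart_integral_def)
qed

text \<open>Here \<open>dv\<close> plays the divergence of \<open>Y\<close> with respect to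
  \<open>w\<close>. The field f w Y has compact support in the chart, and by the product rule its
  Euclidean divergence is w (f dv + Y f), which integrates to 0.\<close>

lemma chart_integral_divergence_eq_0:
  assumes w: "density w" and Y: "smooth_vector_field A Y" and c: "c \<in> A"
    and f: "smooth_function A f" "compact K" "K \<subseteq> cdom c" "\<And>p. p \<notin> K \<Longrightarrow> f p = 0"
    and dv: "\<And>p. p \<in> cdom c \<Longrightarrow> w c (cmap c p) * dv p =
      (\<Sum>b\<in>Basis. frechet_derivative (\<lambda>x. w c x *\<^sub>R components A c (cinv c x) (Y (cinv c x))) (at (cmap c p)) b \<bullet> b)"
  shows "chart_integral w c (\<lambda>p. f p * dv p + field_derivative Y f p) = 0"
proof -
  let ?Y = "\<lambda>x. components A c (cinv c x) (Y (cinv c x))"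
  let ?f = "f \<circ> cinv c"
  let ?W = "\<lambda>x. w c x *\<^sub>R ?Y x"
  let ?F = "\<lambda>x. if x \<in> cimg c then ?f x *\<^sub>R ?W x else 0"
  let ?G = "\<lambda>z. to_coords (?F (of_coords z))"
  have op: "open (cimg c)" by (rule chart(2)[OF c])
  have smf: "smooth_on (cimg c) ?f" using f(1) c by (simp add: smooth_function_def)
  have smW: "smooth_on (cimg c) ?W"
    using w c by (intro smooth_on_scaleR op smooth_vector_field_components[OF Y c]) (simp add: density_def)
  have L: "compact (cmap c ` K)" "cmap c ` K \<subseteq> cimg c"
    using compact_chart_image[OF c f(3,2)] chart(5)[OF c] f(3) by auto
  have f0: "?f x = 0" if "x \<in> cimg c" "x \<notin> cmap c ` K" for x
    using f(4)[of "cinv c x"] that chart(8)[OF c, of x] by (metis comp_apply image_eqI)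
  have smF: "smooth_on UNIV ?F"
    by (rule smooth_on_extend_by_0[OF op smooth_on_scaleR[OF op smf smW] compact_imp_closed[OF L(1)] L(2)])
      (use f0 in auto)
  have smG: "smooth_on UNIV ?G"
    by (intro smooth_on_bounded_linear[OF _ bounded_linear_to_coords] open_UNIV
        smooth_on_compose[OF _ subset_UNIV smF] smooth_on_bounded_linear[OF _ bounded_linear_of_coords] smooth_on_ident)
  have G0: "?G z = 0" if "z \<notin> to_coords ` cmap c ` K" for z
  proof -
    have "of_coords z \<notin> cmap c ` K" using that by (metis image_eqI to_coords_of_coords)
    then show ?thesis using f0[of "of_coords z"] linear_0[OF linear_to_coords] by auto
  qed
  have LK: "compact (to_coords ` cmap c ` K)"
    by (intro compact_continuous_image linear_continuous_on bounded_linear_to_coords L)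
  have div_F: "(\<Sum>b\<in>Basis. frechet_derivative ?G (at z) b \<bullet> b) = (\<Sum>b\<in>Basis. frechet_derivative ?F (at (of_coords z)) b \<bullet> b)" for z
  proof -
    have 1: "(of_coords has_derivative of_coords) (at z)"
      by (rule bounded_linear_imp_has_derivative[OF bounded_linear_of_coords])
    from bounded_linear.has_derivative[OF bounded_linear_to_coords diff_chain_at[OF 1 smooth_on_has_derivative[OF smF UNIV_I]]]
    have "frechet_derivative ?G (at z) = (\<lambda>v. to_coords (frechet_derivative ?F (at (of_coords z)) (of_coords v)))"
      by (intro frechet_derivative_at[symmetric]) (simp add: o_def)
    then have "(\<Sum>b\<in>Basis. frechet_derivative ?G (at z) b \<bullet> b)
        = (\<Sum>i\<in>UNIV. frechet_derivative ?F (at (of_coords z)) (coord_basis i) \<bullet> coord_basis i)"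
      by (simp add: Basis_vec_def sum.UNION_disjoint axis_eq_axis inner_axis' of_coords_axis to_coords_def
        UNION_singleton_eq_range sum.reindex inj_on_def inner_axis)
    then show ?thesis
      using sum_coord_basis[of "\<lambda>b. frechet_derivative ?F (at (of_coords z)) b \<bullet> b"] by simp
  qed
  have "(\<Sum>b\<in>Basis. frechet_derivative ?F (at x) b \<bullet> b) = chart_integrand w c (\<lambda>p. f p * dv p + field_derivative Y f p) x" for x
  proof (cases "x \<in> cimg c")
    case True
    define p where "p = cinv c x"
    have p: "p \<in> cdom c" "x = cmap c p" using True chart(7,8)[OF c] by (auto simp: p_def)
    let ?Df = "frechet_derivative ?f (at x)" and ?DW = "frechet_derivative ?W (at x)"
    have "((\<lambda>x. ?f x *\<^sub>R ?W x) has_derivative (\<lambda>v. ?f x *\<^sub>R ?DW v + ?Df v *\<^sub>R ?W x)) (at x)"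
      by (rule has_derivative_scaleR[OF smooth_on_has_derivative[OF smf True] smooth_on_has_derivative[OF smW True]])
    then have "(?F has_derivative (\<lambda>v. ?f x *\<^sub>R ?DW v + ?Df v *\<^sub>R ?W x)) (at x)"
      by (rule has_derivative_transform_within_open[OF _ op True]) simp
    then have "frechet_derivative ?F (at x) = (\<lambda>v. ?f x *\<^sub>R ?DW v + ?Df v *\<^sub>R ?W x)"
      by (rule frechet_derivative_at[symmetric])
    then have "(\<Sum>b\<in>Basis. frechet_derivative ?F (at x) b \<bullet> b)
        = ?f x * (\<Sum>b\<in>Basis. ?DW b \<bullet> b) + w c x * (\<Sum>b\<in>Basis. (?Y x \<bullet> b) *\<^sub>R ?Df b)"
      by (simp add: inner_add_left sum.distrib sum_distrib_left mult_ac)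
    also have "(\<Sum>b\<in>Basis. (?Y x \<bullet> b) *\<^sub>R ?Df b) = ?Df (?Y x)"
      using linear_sum_Basis[OF has_derivative_linear[OF smooth_on_has_derivative[OF smf True]]] by metis
    also have "\<dots> = field_derivative Y f p"
      using field_derivative_chart[OF f(1) c p(1)] by (simp add: p(2)[symmetric] p_def[symmetric])
    also have "(\<Sum>b\<in>Basis. ?DW b \<bullet> b) = w c x * dv p" using dv[OF p(1)] by (simp add: p(2))
    finally show ?thesis
      using True by (simp add: chart_integrand_def p_def[symmetric] algebra_simps)
  next
    case False
    then have "x \<notin> cmap c ` K" using L(2) by auto
    moreover have "?F y = 0" if "y \<notin> cmap c ` K" for y using f0[of y] that by auto
    ultimately have "frechet_derivative ?F (at x) b = 0" for b
      by (intro frechet_derivative_eq_0_outside[OF compact_imp_closed[OF L(1)]])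
    then show ?thesis using False by (simp add: chart_integrand_def)
  qed
  then show ?thesis
    using integral_divergence_eq_0[OF smG LK G0] by (simp add: div_F chart_integral_def)
qed

section \<open>Partitions of unity and the global argument\<close>

definition partition_of_unity ::
    "'i set \<Rightarrow> ('i \<Rightarrow> ('a, 'e) chart) \<Rightarrow> ('i \<Rightarrow> 'a set) \<Rightarrow> ('i \<Rightarrow> 'a \<Rightarrow> real) \<Rightarrow> bool" where
  "partition_of_unity F c K f \<longleftrightarrow> finite F \<and>
     (\<forall>k\<in>F. c k \<in> A \<and> compact (K k) \<and> K k \<subseteq> cdom (c k) \<and> smooth_function A (f k) \<and>
        (\<forall>p. f k p \<ge> 0) \<and> (\<forall>p. p \<notin> K k \<longrightarrow> f k p = 0)) \<and>
     (\<forall>p. (\<Sum>k\<in>F. f k p) = 1)"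

text \<open>By compactness finitely many chart bumps have positivity sets covering the manifold;
  their sum is positive everywhere, so each may be divided by it.\<close>

lemma partition_of_unity_exists:
  assumes "compact (UNIV :: 'a set)"
  obtains F :: "'a set" and c K f where "partition_of_unity F c K f"
proof -
  define c where "c = chart_at A"
  have "\<forall>q. \<exists>r. r > 0 \<and> cball (cmap (c q) q) r \<subseteq> cimg (c q)"
    using chart_ball c_def by metis
  then obtain r where r: "\<And>q. r q > 0" "\<And>q. cball (cmap (c q) q) (r q) \<subseteq> cimg (c q)" by metis
  have c: "c q \<in> A" "q \<in> cdom (c q)" for q using chart_at by (auto simp: c_def)
  define \<rho> where "\<rho> = (\<lambda>q. chart_bump (c q) (cmap (c q) q) (r q))"
  have sm: "smooth_function A (\<rho> q)" for q
    unfolding \<rho>_def by (rule smooth_function_chart_bump[OF c(1) r])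
  have \<rho>: "\<rho> q p \<ge> 0" "\<rho> q q > 0" for p q
    using chart_bump_pos[OF r(1), of q] by (auto simp: \<rho>_def chart_bump_def bump_nonneg c_def)
  have "open {p. \<rho> q p > 0}" for q
    using open_Collect_less[OF continuous_on_const smooth_function_continuous_on[OF sm]] .
  moreover have "UNIV \<subseteq> (\<Union>q\<in>UNIV. {p. \<rho> q p > 0})" using \<rho>(2) by blast
  ultimately obtain F where F: "finite F" "UNIV \<subseteq> (\<Union>q\<in>F. {p. \<rho> q p > 0})"
    using compactE_image[OF assms, of UNIV "\<lambda>q. {p. \<rho> q p > 0}"] by metis
  define R where "R = (\<lambda>p. \<Sum>k\<in>F. \<rho> k p)"
  have R: "R p > 0" for p
  proof -
    obtain q where "q \<in> F" "\<rho> q p > 0" using F(2) by auto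
    then show ?thesis unfolding R_def using F(1) \<rho>(1) by (intro sum_pos2)
  qed
  define f where "f = (\<lambda>k p. \<rho> k p / R p)"
  define K where "K = (\<lambda>q. cinv (c q) ` cball (cmap (c q) q) (r q))"
  show thesis
  proof (rule that[of F c K f], unfold partition_of_unity_def, intro conjI ballI allI impI)
    show "smooth_function A (f k)" if "k \<in> F" for k
      unfolding smooth_function_def
    proof
      fix d assume d: "d \<in> A"
      then have s: "smooth_on (cimg d) (\<lambda>x. \<rho> k (cinv d x))" for k
        using sm[of k] by (simp add: smooth_function_def o_def)
      show "smooth_on (cimg d) (f k \<circ> cinv d)"
        unfolding o_def f_def R_def
        by (intro smooth_on_divide smooth_on_sum chart(2)[OF d] s) (use R in \<open>auto simp: R_def less_imp_neq[THEN not_sym]\<close>)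
    qed
    show "(\<Sum>k\<in>F. f k p) = 1" for p
      using R[of p] by (simp add: f_def R_def sum_divide_distrib[symmetric])
    show "f k p = 0" if "p \<notin> K k" for k p
      using chart_bump_eq_0[OF c(1) r(1)] that by (simp add: f_def \<rho>_def K_def)
    show "f k p \<ge> 0" for k p using \<rho>(1) R[of p] by (simp add: f_def)
    show "compact (K k)" for k unfolding K_def by (rule compact_chart_preimage[OF c(1) r(2)]) simp
    show "K k \<subseteq> cdom (c k)" for k unfolding K_def using chart(7)[OF c(1)] r(2) by blast
  qed (use F c in auto)
qed

text \<open>The functions \<open>g k\<close>, namely f_k dv + Y f_k, add up to \<open>dv\<close>,
  since the f_k add up to 1 and the derivatives Y f_k to 0. The products of f_j with g_k replace a
  global integral: summed over j they give the vanishing integral of g_k, summed over k the integral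
  of f_j dv. The latter are all nonpositive with sum 0, so each f_j dv vanishes, being continuous
  and of one sign.\<close>

theorem divergence_nonpos_imp_0:
  assumes cpt: "compact (UNIV :: 'a set)" and w: "density w" and Y: "smooth_vector_field A Y"
    and dv: "\<And>c p. c \<in> A \<Longrightarrow> p \<in> cdom c \<Longrightarrow> w c (cmap c p) * dv p =
      (\<Sum>b\<in>Basis. frechet_derivative (\<lambda>x. w c x *\<^sub>R components A c (cinv c x) (Y (cinv c x))) (at (cmap c p)) b \<bullet> b)"
    and nonpos: "\<And>p. dv p \<le> 0"
  shows "dv p = 0"
proof -
  obtain F :: "'a set" and c K f where "partition_of_unity F c K f"
    using partition_of_unity_exists[OF cpt] by blast
  then have F: "finite F" "\<And>k. k \<in> F \<Longrightarrow> c k \<in> A"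
    "\<And>k. k \<in> F \<Longrightarrow> compact (K k)" "\<And>k. k \<in> F \<Longrightarrow> K k \<subseteq> cdom (c k)"
    "\<And>k. k \<in> F \<Longrightarrow> smooth_function A (f k)" "\<And>k p. k \<in> F \<Longrightarrow> f k p \<ge> 0"
    "\<And>k p. k \<in> F \<Longrightarrow> p \<notin> K k \<Longrightarrow> f k p = 0" "\<And>p. (\<Sum>k\<in>F. f k p) = 1"
    by (simp_all add: partition_of_unity_def)
  \<comment> \<open>Continuity of \<open>dv\<close> is read off from its coordinate formula after
    division by the positive \<open>w c\<close>.\<close>
  have dv_cont: "continuous_on UNIV dv"
  proof (rule continuous_on_UNIV_chartwise)
    fix c assume c: "c \<in> A"
    let ?W = "\<lambda>x. w c x *\<^sub>R components A c (cinv c x) (Y (cinv c x))"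
    have smW: "smooth_on (cimg c) ?W"
      using w c by (intro smooth_on_scaleR chart(2) smooth_vector_field_components[OF Y c]) (simp_all add: density_def)
    have wc: "smooth_on (cimg c) (w c)" "\<And>x. x \<in> cimg c \<Longrightarrow> w c x > 0" using w c by (auto simp: density_def)
    have "continuous_on (cimg c) (\<lambda>x. (\<Sum>b\<in>Basis. frechet_derivative ?W (at x) b \<bullet> b) / w c x)"
      by (intro continuous_intros smooth_on_continuous_on[OF smooth_on_frechet_derivative[OF smW]] smooth_on_continuous_on[OF wc(1)])
        (use wc(2) in force)
    moreover have "(\<Sum>b\<in>Basis. frechet_derivative ?W (at x) b \<bullet> b) / w c x = dv (cinv c x)" if "x \<in> cimg c" for x
      using dv[OF c chart(7)[OF c that]] wc(2)[OF that] chart(8)[OF c that] by (simp add: field_simps)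
    ultimately show "continuous_on (cimg c) (\<lambda>x. dv (cinv c x))" by (simp cong: continuous_on_cong)
  qed
  have fc: "continuous_on UNIV (f k)" if "k \<in> F" for k
    by (rule smooth_function_continuous_on[OF F(5)[OF that]])
  have supp: "supported (f k) (K k)" if "k \<in> F" for k
    using F(3,7) fc that by (simp add: supported_def)
  have Yf_cont: "continuous_on UNIV (field_derivative Y (f k))" if "k \<in> F" for k
  proof (rule continuous_on_UNIV_chartwise)
    fix c assume c: "c \<in> A"
    have "smooth_on (cimg c) (\<lambda>x. frechet_derivative (f k \<circ> cinv c) (at x) (components A c (cinv c x) (Y (cinv c x))))"
      using F(5)[OF that] c by (intro smooth_on_frechet_derivative_apply chart(2) smooth_vector_field_components[OF Y])
        (auto simp: smooth_function_def)
    from smooth_on_continuous_on[OF this]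
    show "continuous_on (cimg c) (\<lambda>x. field_derivative Y (f k) (cinv c x))"
      by (rule continuous_on_eq) (simp add: field_derivative_chart[OF F(5)[OF that] c] chart[OF c])
  qed
  have Yf_0: "field_derivative Y (f k) p = 0" if "k \<in> F" "p \<notin> K k" for k p
  proof -
    let ?c = "chart_at A p" 
    have cp: "?c \<in> A" "p \<in> cdom ?c" using chart_at by auto
    have op: "open (cmap ?c ` (cdom ?c \<inter> - K k))"
      using F(3)[OF that(1)] compact_imp_closed by (intro open_chart_image[OF cp(1)]) auto
    have "((\<lambda>x. 0) has_derivative (\<lambda>v. 0)) (at (cmap ?c p))" by simp
    then have "(f k \<circ> cinv ?c has_derivative (\<lambda>v. 0)) (at (cmap ?c p))"
      by (rule has_derivative_transform_within_open[OF _ op])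
        (use that cp F(7)[OF that(1)] chart_image_iff[OF cp(1)] chart(5,6)[OF cp] in simp_all)
    from frechet_derivative_at[OF this] show ?thesis by (metis field_derivative_def)
  qed
  have Yf_sum: "(\<Sum>k\<in>F. field_derivative Y (f k) p) = 0" for p
  proof -
    let ?c = "chart_at A p"
    have cp: "?c \<in> A" "p \<in> cdom ?c" using chart_at by auto
    have "((\<lambda>x. \<Sum>k\<in>F. (f k \<circ> cinv ?c) x) has_derivative
       (\<lambda>v. \<Sum>k\<in>F. frechet_derivative (f k \<circ> cinv ?c) (at (cmap ?c p)) v)) (at (cmap ?c p))"
      using F(5) cp chart(5)[OF cp] by (intro has_derivative_sum smooth_on_has_derivative[of "cimg ?c"]) (simp_all add: smooth_function_def o_def)
    then have "((\<lambda>x. 1 :: real) has_derivative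
       (\<lambda>v. \<Sum>k\<in>F. frechet_derivative (f k \<circ> cinv ?c) (at (cmap ?c p)) v)) (at (cmap ?c p))"
      by (simp add: F(8))
    from has_derivative_unique[OF this has_derivative_const]
    show ?thesis by (simp add: field_derivative_def fun_eq_iff)
  qed
  define g where "g = (\<lambda>k p. f k p * dv p + field_derivative Y (f k) p)"
  have g: "supported (g k) (K k)" if "k \<in> F" for k
    using that F(3,7) Yf_0 by (auto simp: supported_def g_def intro!: continuous_intros fc dv_cont Yf_cont)
  have g_cont: "continuous_on UNIV (g k)" if "k \<in> F" for k using g[OF that] by (simp add: supported_def)
  have g_sum: "(\<Sum>k\<in>F. f j p * g k p) = f j p * dv p" for j p
    using F(8)[of p] Yf_sum[of p]
    by (simp add: g_def sum.distrib sum_distrib_left[symmetric] sum_distrib_right[symmetric])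
  text \<open>Each \<open>g k\<close> has integral \<open>0\<close>, and it may be integrated in the \<open>j\<close>-th chart after localising by \<open>f j\<close>.\<close>
  have "(\<Sum>j\<in>F. chart_integral w (c j) (\<lambda>p. f j p * g k p)) = 0" if k: "k \<in> F" for k
  proof -
    have "chart_integral w (c j) (\<lambda>p. f j p * g k p) = chart_integral w (c k) (\<lambda>p. f j p * g k p)" if j: "j \<in> F" for j
      using F(4)[OF j] F(4)[OF k]
      by (intro chart_integral_change[OF w F(2)[OF j] F(2)[OF k] supported_Int[OF g[OF k] supp[OF j]]]) auto
    then have "(\<Sum>j\<in>F. chart_integral w (c j) (\<lambda>p. f j p * g k p)) = (\<Sum>j\<in>F. chart_integral w (c k) (\<lambda>p. f j p * g k p))"
      by simp
    also have "\<dots> = chart_integral w (c k) (\<lambda>p. \<Sum>j\<in>F. f j p * g k p)"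
      by (rule chart_integral_add[OF w F(2)[OF k] F(4)[OF k] supported_mult[OF g[OF k] fc], symmetric])
    also have "(\<lambda>p. \<Sum>j\<in>F. f j p * g k p) = g k"
      by (simp add: sum_distrib_right[symmetric] F(8))
    also have "chart_integral w (c k) (g k) = 0"
      unfolding g_def
      by (rule chart_integral_divergence_eq_0[OF w Y F(2)[OF k] F(5)[OF k] F(3)[OF k] F(4)[OF k] F(7)[OF k] dv[OF F(2)[OF k]]])
    finally show ?thesis .
  qed
  then have "(\<Sum>k\<in>F. \<Sum>j\<in>F. chart_integral w (c j) (\<lambda>p. f j p * g k p)) = 0" by simp
  \<comment> \<open>In this order the inner sum stays in the single chart \<open>c j\<close>, where
    it can be moved under the integral.\<close>
  then have "(\<Sum>j\<in>F. \<Sum>k\<in>F. chart_integral w (c j) (\<lambda>p. f j p * g k p)) = 0" by (subst sum.swap)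
  moreover have "(\<Sum>k\<in>F. chart_integral w (c j) (\<lambda>p. f j p * g k p)) = chart_integral w (c j) (\<lambda>p. f j p * dv p)"
    if j: "j \<in> F" for j
  proof -
    have "chart_integral w (c j) (\<lambda>p. \<Sum>k\<in>F. f j p * g k p) = (\<Sum>k\<in>F. chart_integral w (c j) (\<lambda>p. f j p * g k p))"
      by (rule chart_integral_add[OF w F(2)[OF j] F(4)[OF j]]) (rule supported_mult'[OF supp[OF j] g_cont])
    then show ?thesis by (simp add: g_sum)
  qed
  ultimately have sum0: "(\<Sum>j\<in>F. chart_integral w (c j) (\<lambda>p. f j p * dv p)) = 0" by simp
  have fdv: "f j q * dv q = 0" if j: "j \<in> F" for j q
  proof (cases "q \<in> K j")
    case True
    let ?I = "\<lambda>j z. - chart_integrand w (c j) (\<lambda>p. f j p * dv p) (of_coords z)"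
    have I0: "?I j z \<ge> 0" if "j \<in> F" for j z
    proof (cases "of_coords z \<in> cimg (c j)")
      case True
      then have "w (c j) (of_coords z) > 0" using w F(2)[OF that] by (simp add: density_def)
      moreover have "f j (cinv (c j) (of_coords z)) * dv (cinv (c j) (of_coords z)) \<le> 0"
        using F(6)[OF that] nonpos by (simp add: mult_nonneg_nonpos)
      ultimately show ?thesis by (simp add: chart_integrand_def mult_nonneg_nonpos)
    qed (simp add: chart_integrand_def)
    note IC = chart_integrand_coords[OF w F(2) supported_mult'[OF supp dv_cont] F(4)]
    have nn: "chart_integral w (c j) (\<lambda>p. f j p * dv p) \<le> 0" if "j \<in> F" for j
    proof -
      have "integral UNIV (?I j) \<ge> 0"
        by (rule Henstock_Kurzweil_Integration.integral_nonneg[OF integrable_neg[OF integrable_compact_support[OF IC[OF that that that]]]])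
          (use I0[OF that] in auto)
      then show ?thesis by (simp add: chart_integral_def)
    qed
    have "chart_integral w (c j) (\<lambda>p. f j p * dv p) = 0"
      using sum_nonneg_eq_0_iff[OF F(1), of "\<lambda>j. - chart_integral w (c j) (\<lambda>p. f j p * dv p)"] nn sum0 j
      by (simp add: sum_negf)
    then have int0: "integral UNIV (?I j) = 0" by (simp add: chart_integral_def)
    let ?L = "to_coords ` cmap (c j) ` K j"
    \<comment> \<open>An open box is taken because the criterion for a vanishing integral needs a
      nonempty interior; the image of \<open>q\<close> provides a point in it.\<close>
    obtain a where a: "?L \<subseteq> box (-a) a"
      using compact_imp_bounded[OF IC(2)[OF j j j]] bounded_subset_box_symmetric by metis
    then have a': "?L \<subseteq> cbox (-a) a" using box_subset_cbox by blast
    have z: "to_coords (cmap (c j) q) \<in> ?L" using True by blast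
    have cI: "continuous_on UNIV (?I j)" by (intro continuous_intros IC(1)[OF j j j])
    have "integral (cbox (-a) a) (?I j) = 0"
      using int0 integral_compact_support[OF _ a', of "?I j"] IC(3)[OF j j j] by simp
    then have "?I j (to_coords (cmap (c j) q)) = 0"
      using integral_cbox_eq_0_iff[OF continuous_on_subset[OF cI subset_UNIV] _ I0[OF j], of "-a" a] z a a'
      by (metis empty_iff subsetD)
    then show ?thesis
      using w F(2)[OF j] chart(5,6)[OF F(2)[OF j]] F(4)[OF j] True
      by (auto simp: chart_integrand_def density_def dest!: bspec)
  qed (use F(7) j in simp)
  have "dv p = (\<Sum>k\<in>F. f k p * dv p)" by (simp add: sum_distrib_right[symmetric] F(8))
  then show ?thesis using fdv by simp
qed

end

section \<open>Forms along a map\<close>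

text \<open>
  In the lemmas of this section \<open>P\<close> is a coordinate expression of the immersion, \<open>G\<close> of the
  ambient metric, \<open>N\<close> of the normal field, and \<open>X \<circ> P = DP Y + \<phi> N\<close> is the decomposition of the
  conformal field into its tangential and its normal part.
\<close>

lemma frechet_derivative_form_linear:
  fixes G :: "'e::euclidean_space \<Rightarrow> 'e \<Rightarrow> 'e \<Rightarrow> real"
  assumes W: "open W" "y \<in> W" and bil: "\<And>y. y \<in> W \<Longrightarrow> bilinear (G y)"
    and sm: "\<And>a b. smooth_on W (\<lambda>y. G y a b)"
  shows "linear (\<lambda>k. frechet_derivative (\<lambda>y. G y a b) (at y) k)"
    and "bilinear (\<lambda>a b. frechet_derivative (\<lambda>y. G y a b) (at y) k)"
proof -
  have D: "((\<lambda>y. G y a b) has_derivative frechet_derivative (\<lambda>y. G y a b) (at y)) (at y)" for a b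
    by (rule smooth_on_has_derivative[OF sm W(2)])
  show "linear (\<lambda>k. frechet_derivative (\<lambda>y. G y a b) (at y) k)"
    using has_derivative_linear[OF D] .
  have L: "linear (\<lambda>a. G y a b)" "linear (G y a)" if "y \<in> W" for y a b
    using bil[OF that] by (simp_all add: bilinear_def)
  have tr: "frechet_derivative F (at y) = F'"
    if "(F1 has_derivative F') (at y)" "\<And>y. y \<in> W \<Longrightarrow> F1 y = F y" for F F1 :: "'e \<Rightarrow> real" and F'
    using frechet_derivative_at[OF has_derivative_transform_within_open[OF that(1) W that(2)]] by simp
  have 1: "frechet_derivative (\<lambda>y. G y (a + a') b) (at y) =
      (\<lambda>k. frechet_derivative (\<lambda>y. G y a b) (at y) k + frechet_derivative (\<lambda>y. G y a' b) (at y) k)" for a a' b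
    by (rule tr[OF has_derivative_add[OF D D]]) (simp add: linear_add[OF L(1)])
  have 2: "frechet_derivative (\<lambda>y. G y b (a + a')) (at y) =
      (\<lambda>k. frechet_derivative (\<lambda>y. G y b a) (at y) k + frechet_derivative (\<lambda>y. G y b a') (at y) k)" for a a' b
    by (rule tr[OF has_derivative_add[OF D D]]) (simp add: linear_add[OF L(2)])
  have 3: "frechet_derivative (\<lambda>y. G y (r *\<^sub>R a) b) (at y) = (\<lambda>k. r * frechet_derivative (\<lambda>y. G y a b) (at y) k)" for r a b
    by (rule tr[OF has_derivative_mult_right[OF D]]) (simp add: linear_cmul[OF L(1)])
  have 4: "frechet_derivative (\<lambda>y. G y b (r *\<^sub>R a)) (at y) = (\<lambda>k. r * frechet_derivative (\<lambda>y. G y b a) (at y) k)" for r a b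
    by (rule tr[OF has_derivative_mult_right[OF D]]) (simp add: linear_cmul[OF L(2)])
  show "bilinear (\<lambda>a b. frechet_derivative (\<lambda>y. G y a b) (at y) k)"
    unfolding bilinear_def linear_iff by (simp add: 1 2 3 4)
qed

lemma smooth_on_form:
  fixes G :: "'e::euclidean_space \<Rightarrow> 'e \<Rightarrow> 'e \<Rightarrow> real" and P :: "'f::euclidean_space \<Rightarrow> 'e"
  assumes V: "open V" "smooth_on V P" "smooth_on V a" "smooth_on V b" "P ` V \<subseteq> W"
    and bil: "\<And>y. y \<in> W \<Longrightarrow> bilinear (G y)" and sm: "\<And>a b. smooth_on W (\<lambda>y. G y a b)"
  shows "smooth_on V (\<lambda>x. G (P x) (a x) (b x))"
proof -
  have "smooth_on V (\<lambda>x. \<Sum>i\<in>Basis. \<Sum>j\<in>Basis. ((a x \<bullet> i) * (b x \<bullet> j)) *\<^sub>R G (P x) i j)"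
    by (intro smooth_on_sum smooth_on_scaleR smooth_on_mult smooth_on_inner smooth_on_const V smooth_on_compose[OF V(1,5) sm V(2)])
  then show ?thesis
    by (rule smooth_on_cong[OF V(1)]) (use V(5) bilinear_sum_Basis[OF bil, symmetric] in blast)
qed

text \<open>Product rule for the three places where \<open>y\<close> enters: the base point and both
  arguments. Expansion in \<open>Basis\<close> reduces it to products of real functions, and
  bilinearity of the derivative of \<open>G\<close> in its arguments puts the sums together
  again.\<close>

lemma has_derivative_form:
  fixes G :: "'e::euclidean_space \<Rightarrow> 'e \<Rightarrow> 'e \<Rightarrow> real" and P :: "'f::euclidean_space \<Rightarrow> 'e"
  assumes V: "open V" "x \<in> V" "P ` V \<subseteq> W" and W: "open W"
    and bil: "\<And>y. y \<in> W \<Longrightarrow> bilinear (G y)" and sm: "\<And>a b. smooth_on W (\<lambda>y. G y a b)"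
    and P: "(P has_derivative P') (at x)" and a: "(a has_derivative a') (at x)" and b: "(b has_derivative b') (at x)"
  shows "((\<lambda>y. G (P y) (a y) (b y)) has_derivative
    (\<lambda>h. frechet_derivative (\<lambda>y. G y (a x) (b x)) (at (P x)) (P' h) + G (P x) (a' h) (b x) + G (P x) (a x) (b' h))) (at x)"
proof -
  let ?dG = "\<lambda>a b. frechet_derivative (\<lambda>y. G y a b) (at (P x))"
  have PW: "P x \<in> W" using V by blast
  have D: "((\<lambda>y. G (P y) i j) has_derivative (\<lambda>h. ?dG i j (P' h))) (at x)" for i j
    using diff_chain_at[OF P smooth_on_has_derivative[OF sm PW]] by (simp add: o_def)
  have "((\<lambda>y. \<Sum>i\<in>Basis. \<Sum>j\<in>Basis. (a y \<bullet> i) * (b y \<bullet> j) * G (P y) i j) has_derivative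
      (\<lambda>h. \<Sum>i\<in>Basis. \<Sum>j\<in>Basis. (a x \<bullet> i) * (b x \<bullet> j) * ?dG i j (P' h)
         + ((a x \<bullet> i) * (b' h \<bullet> j) + (a' h \<bullet> i) * (b x \<bullet> j)) * G (P x) i j)) (at x)"
    by (intro has_derivative_sum has_derivative_mult has_derivative_inner_left a b D)
  moreover have "(\<Sum>i\<in>Basis. \<Sum>j\<in>Basis. (a x \<bullet> i) * (b x \<bullet> j) * ?dG i j (P' h)
         + ((a x \<bullet> i) * (b' h \<bullet> j) + (a' h \<bullet> i) * (b x \<bullet> j)) * G (P x) i j)
      = ?dG (a x) (b x) (P' h) + G (P x) (a' h) (b x) + G (P x) (a x) (b' h)" for h
  proof -
    have "?dG (a x) (b x) (P' h) = (\<Sum>i\<in>Basis. \<Sum>j\<in>Basis. ((a x \<bullet> i) * (b x \<bullet> j)) *\<^sub>R ?dG i j (P' h))"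
      using bilinear_sum_Basis[OF frechet_derivative_form_linear(2)[OF W PW bil sm], of "a x" "b x"] by simp
    then show ?thesis
      unfolding bilinear_sum_Basis[OF bil[OF PW], of "a' h" "b x"] bilinear_sum_Basis[OF bil[OF PW], of "a x" "b' h"]
      by (simp add: sum.distrib algebra_simps)
  qed
  ultimately have "((\<lambda>y. \<Sum>i\<in>Basis. \<Sum>j\<in>Basis. (a y \<bullet> i) * (b y \<bullet> j) * G (P y) i j) has_derivative
      (\<lambda>h. ?dG (a x) (b x) (P' h) + G (P x) (a' h) (b x) + G (P x) (a x) (b' h))) (at x)"
    by simp
  then show ?thesis
    by (rule has_derivative_transform_within_open[OF _ V(1,2)])
      (use V(3) bilinear_sum_Basis[OF bil] in \<open>simp add: image_subset_iff\<close>)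
qed

text \<open>Symmetry of the second derivative is used to place \<open>h\<close> inside and
  \<open>Y x\<close> outside. In this form the term is the derivative of DP h along
  \<open>Y x\<close>, the same one that occurs when the pulled-back metric is differentiated along
  \<open>Y\<close>.\<close>

lemma has_derivative_frechet_derivative_apply:
  fixes P :: "'f::euclidean_space \<Rightarrow> 'e::euclidean_space"
  assumes V: "open V" "x \<in> V" "smooth_on V P" and Y: "(Y has_derivative Y') (at x)"
  shows "((\<lambda>y. frechet_derivative P (at y) (Y y)) has_derivative
    (\<lambda>h. frechet_derivative (\<lambda>y. frechet_derivative P (at y) h) (at x) (Y x) + frechet_derivative P (at x) (Y' h))) (at x)"
proof -
  let ?P' = "\<lambda>y. frechet_derivative P (at y)"
  let ?D2 = "\<lambda>u. frechet_derivative (\<lambda>y. ?P' y u) (at x)"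
  have D2: "((\<lambda>y. ?P' y u) has_derivative ?D2 u) (at x)" for u
    by (rule smooth_on_has_derivative[OF smooth_on_frechet_derivative[OF V(3)] V(2)])
  have P': "linear (?P' y)" if "y \<in> V" for y
    using has_derivative_linear[OF smooth_on_has_derivative[OF V(3) that]] .
  have "((\<lambda>y. \<Sum>b\<in>Basis. (Y y \<bullet> b) *\<^sub>R ?P' y b) has_derivative
      (\<lambda>h. \<Sum>b\<in>Basis. (Y x \<bullet> b) *\<^sub>R ?D2 b h + (Y' h \<bullet> b) *\<^sub>R ?P' x b)) (at x)"
    by (intro has_derivative_sum has_derivative_scaleR has_derivative_inner_left Y D2)
  moreover have "(\<Sum>b\<in>Basis. (Y x \<bullet> b) *\<^sub>R ?D2 b h + (Y' h \<bullet> b) *\<^sub>R ?P' x b) = ?D2 h (Y x) + ?P' x (Y' h)" for h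
  proof -
    have "(\<Sum>b\<in>Basis. (Y x \<bullet> b) *\<^sub>R ?D2 b h) = (\<Sum>b\<in>Basis. (Y x \<bullet> b) *\<^sub>R ?D2 h b)"
      using frechet_derivative_symmetric[OF V(1,3,2)] by (intro sum.cong) auto
    also have "\<dots> = ?D2 h (Y x)"
      by (rule linear_sum_Basis[OF has_derivative_linear[OF D2], symmetric])
    finally show ?thesis
      using linear_sum_Basis[OF P'[OF V(2)], of "Y' h"] by (simp add: sum.distrib)
  qed
  ultimately have "((\<lambda>y. \<Sum>b\<in>Basis. (Y y \<bullet> b) *\<^sub>R ?P' y b) has_derivative (\<lambda>h. ?D2 h (Y x) + ?P' x (Y' h))) (at x)"
    by simp
  then show ?thesis
    by (rule has_derivative_transform_within_open[OF _ V(1,2)]) (rule linear_sum_Basis[OF P', symmetric])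
qed

text \<open>Half of the coordinate Lie derivative of \<open>G\<close> along \<open>N\<close>,
  evaluated on DP u; only the derivative of \<open>N\<close> along the hypersurface enters. It
  equals -G(II(u,u), N), by Weingarten's formula below.\<close>

definition shape_form :: "('e::euclidean_space \<Rightarrow> 'e \<Rightarrow> 'e \<Rightarrow> real) \<Rightarrow> ('f::euclidean_space \<Rightarrow> 'e) \<Rightarrow> ('f \<Rightarrow> 'e) \<Rightarrow> 'f \<Rightarrow> 'f \<Rightarrow> real" where
  "shape_form G P N x u =
     G (P x) (frechet_derivative N (at x) u) (frechet_derivative P (at x) u)
     + frechet_derivative (\<lambda>y. G y (frechet_derivative P (at x) u) (frechet_derivative P (at x) u)) (at (P x)) (N x) / 2"

lemma lie_derivative_tangential_part:
  fixes G :: "'e::euclidean_space \<Rightarrow> 'e \<Rightarrow> 'e \<Rightarrow> real" and P :: "'f::euclidean_space \<Rightarrow> 'e"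
  assumes V: "open V" "x \<in> V" "P ` V \<subseteq> W" "smooth_on V P" and W: "open W"
    and bil: "\<And>y. y \<in> W \<Longrightarrow> bilinear (G y)" and sm: "\<And>a b. smooth_on W (\<lambda>y. G y a b)"
    and sym: "\<And>y a b. G y a b = G y b a"
    and X: "smooth_on W X" and Y: "smooth_on V Y" and \<phi>: "smooth_on V \<phi>" and N: "smooth_on V N"
    and decomp: "\<And>y. y \<in> V \<Longrightarrow> X (P y) = frechet_derivative P (at y) (Y y) + \<phi> y *\<^sub>R N y"
    and orth: "\<And>y u. y \<in> V \<Longrightarrow> G (P y) (N y) (frechet_derivative P (at y) u) = 0"
    and lie: "\<And>a. frechet_derivative (\<lambda>y. G y a a) (at (P x)) (X (P x))
        + 2 * G (P x) (frechet_derivative X (at (P x)) a) a = 2 * \<eta> * G (P x) a a"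
  shows "frechet_derivative (\<lambda>y. G (P y) (frechet_derivative P (at y) u) (frechet_derivative P (at y) u)) (at x) (Y x)
      + 2 * G (P x) (frechet_derivative P (at x) (frechet_derivative Y (at x) u)) (frechet_derivative P (at x) u)
    = 2 * \<eta> * G (P x) (frechet_derivative P (at x) u) (frechet_derivative P (at x) u) - 2 * \<phi> x * shape_form G P N x u"
proof -
  let ?P' = "\<lambda>y. frechet_derivative P (at y)"
  let ?D2 = "\<lambda>u. frechet_derivative (\<lambda>y. ?P' y u) (at x)"
  define a where "a = ?P' x u"
  let ?dG = "frechet_derivative (\<lambda>y. G y a a) (at (P x))"
  let ?X' = "frechet_derivative X (at (P x))" and ?Y' = "frechet_derivative Y (at x)"
    and ?N' = "frechet_derivative N (at x)" and ?\<phi>' = "frechet_derivative \<phi> (at x)"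
  have PW: "P x \<in> W" using V by blast
  have L: "linear (\<lambda>v. G (P x) v a)" using bil[OF PW] by (simp add: bilinear_def)
  have dGlin: "linear ?dG" using frechet_derivative_form_linear(1)[OF W PW bil sm] .
  note P_der = smooth_on_has_derivative[OF V(4,2)]
  note Pu_der = smooth_on_has_derivative[OF smooth_on_frechet_derivative[OF V(4)] V(2), of u]
  have 1: "frechet_derivative (\<lambda>y. G (P y) (?P' y u) (?P' y u)) (at x) (Y x)
      = ?dG (?P' x (Y x)) + 2 * G (P x) (?D2 u (Y x)) a"
    using frechet_derivative_at[OF has_derivative_form[OF V(1-3) W bil sm P_der Pu_der Pu_der], symmetric]
    by (simp add: a_def sym[of "P x" "?P' x u" "?D2 u (Y x)"])
  have XP: "((\<lambda>y. X (P y)) has_derivative (\<lambda>h. ?X' (?P' x h))) (at x)"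
    using diff_chain_at[OF P_der smooth_on_has_derivative[OF X PW]] by (simp add: o_def)
  have "((\<lambda>y. ?P' y (Y y) + \<phi> y *\<^sub>R N y) has_derivative
      (\<lambda>h. (?D2 h (Y x) + ?P' x (?Y' h)) + (\<phi> x *\<^sub>R ?N' h + ?\<phi>' h *\<^sub>R N x))) (at x)"
    by (rule has_derivative_add[OF has_derivative_frechet_derivative_apply[OF V(1,2,4) smooth_on_has_derivative[OF Y V(2)]]
       has_derivative_scaleR[OF smooth_on_has_derivative[OF \<phi> V(2)] smooth_on_has_derivative[OF N V(2)]]])
  then have "((\<lambda>y. X (P y)) has_derivative
      (\<lambda>h. (?D2 h (Y x) + ?P' x (?Y' h)) + (\<phi> x *\<^sub>R ?N' h + ?\<phi>' h *\<^sub>R N x))) (at x)"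
    by (rule has_derivative_transform_within_open[OF _ V(1,2)]) (rule decomp[symmetric])
  from has_derivative_unique[OF this XP]
  have "?X' a = (?D2 u (Y x) + ?P' x (?Y' u)) + (\<phi> x *\<^sub>R ?N' u + ?\<phi>' u *\<^sub>R N x)"
    unfolding a_def by metis
  \<comment> \<open>The derivative of \<open>\<phi>\<close> multiplies \<open>N\<close>, which is
    orthogonal to \<open>a\<close>, and disappears.\<close>
  then have 2: "G (P x) (?X' a) a = G (P x) (?D2 u (Y x)) a + G (P x) (?P' x (?Y' u)) a + \<phi> x * G (P x) (?N' u) a"
    using orth[OF V(2), of u] by (simp add: linear_add[OF L] linear_cmul[OF L] a_def[symmetric])
  have 3: "?dG (X (P x)) = ?dG (?P' x (Y x)) + \<phi> x * ?dG (N x)"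
    unfolding decomp[OF V(2)] by (simp add: linear_add[OF dGlin] linear_cmul[OF dGlin])
  show ?thesis
    using lie[of a] unfolding 1 shape_form_def a_def[symmetric] by (simp add: 2 3 algebra_simps)
qed

text \<open>Weingarten's formula, obtained by differentiating the orthogonality of \<open>N\<close> and \<open>DP W\<close>.\<close>

lemma shape_form_weingarten:
  fixes G :: "'e::euclidean_space \<Rightarrow> 'e \<Rightarrow> 'e \<Rightarrow> real" and P :: "'f::euclidean_space \<Rightarrow> 'e"
  assumes V: "open V" "x \<in> V" "P ` V \<subseteq> W" "smooth_on V P" and W: "open W"
    and bil: "\<And>y. y \<in> W \<Longrightarrow> bilinear (G y)" and sm: "\<And>a b. smooth_on W (\<lambda>y. G y a b)"
    and sym: "\<And>y a b. G y a b = G y b a" and N: "smooth_on V N" and Z: "smooth_on V Z" "Z x = u"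
    and orth: "\<And>y u. y \<in> V \<Longrightarrow> G (P y) (N y) (frechet_derivative P (at y) u) = 0"
    and \<Gamma>: "\<And>u v. \<Gamma> u v = \<Gamma> v u"
      "\<And>u v w. frechet_derivative (\<lambda>y. G y v w) (at (P x)) u = G (P x) (\<Gamma> u v) w + G (P x) v (\<Gamma> u w)"
  shows "- G (P x) (frechet_derivative (\<lambda>y. frechet_derivative P (at y) (Z y)) (at x) u
      + \<Gamma> (frechet_derivative P (at x) u) (frechet_derivative P (at x) u)) (N x) = shape_form G P N x u"
proof -
  let ?P' = "\<lambda>y. frechet_derivative P (at y)"
  let ?PZ = "\<lambda>y. ?P' y (Z y)"
  have PW: "P x \<in> W" using V by blast
  have L: "linear (\<lambda>v. G (P x) v (N x))" using bil[OF PW] by (simp add: bilinear_def)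
  note P_der = smooth_on_has_derivative[OF V(4,2)] and N_der = smooth_on_has_derivative[OF N V(2)]
  have PZ_der: "(?PZ has_derivative frechet_derivative ?PZ (at x)) (at x)"
    by (rule smooth_on_has_derivative[OF smooth_on_frechet_derivative_apply[OF V(1,4) Z(1)] V(2)])
  have "((\<lambda>y. 0 :: real) has_derivative (\<lambda>h. 0)) (at x)" by simp
  then have "((\<lambda>y. G (P y) (N y) (?PZ y)) has_derivative (\<lambda>h. 0)) (at x)"
    by (rule has_derivative_transform_within_open[OF _ V(1,2)]) (simp add: orth)
  from has_derivative_unique[OF has_derivative_form[OF V(1-3) W bil sm P_der N_der PZ_der] this]
  have "frechet_derivative (\<lambda>y. G y (N x) (?PZ x)) (at (P x)) (?P' x u) + G (P x) (frechet_derivative N (at x) u) (?PZ x)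
      + G (P x) (N x) (frechet_derivative ?PZ (at x) u) = 0" by metis
  \<comment> \<open>Compatibility with the metric rewrites both derivatives of \<open>G\<close> by
    \<open>\<Gamma>\<close>; the mixed terms \<Gamma>(N, DP u) and \<Gamma>(DP u, N) agree by
    symmetry, and only -G(\<Gamma>(DP u, DP u), N) remains beside the derivative of DP Z.\<close>
  then show ?thesis
    unfolding shape_form_def \<Gamma>(2) Z(2) linear_add[OF L]
    using sym[of "P x" "frechet_derivative ?PZ (at x) u" "N x"] sym[of "P x" "\<Gamma> (?P' x u) (?P' x u)" "N x"]
      sym[of "P x" "?P' x u" "\<Gamma> (N x) (?P' x u)"] \<Gamma>(1)[of "N x" "?P' x u"] by simp
qed

text \<open>Only first derivatives of \<open>P\<close> and \<open>N\<close> occur, so a change of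
  coordinates in the source acts through \<tau>' on \<open>u\<close> alone, without correction
  terms.\<close>

lemma shape_form_compose:
  fixes G :: "'e::euclidean_space \<Rightarrow> 'e \<Rightarrow> 'e \<Rightarrow> real" and P :: "'f::euclidean_space \<Rightarrow> 'e" and \<tau> :: "'f \<Rightarrow> 'f"
  assumes U: "open U" "z \<in> U" and \<tau>: "(\<tau> has_derivative \<tau>') (at z)"
    and P: "(P has_derivative P') (at (\<tau> z))" and N: "(N has_derivative N') (at (\<tau> z))"
    and eq: "\<And>y. y \<in> U \<Longrightarrow> Q y = P (\<tau> y)" "\<And>y. y \<in> U \<Longrightarrow> M y = N (\<tau> y)"
  shows "shape_form G Q M z u = shape_form G P N (\<tau> z) (\<tau>' u)"
proof -
  have "(Q has_derivative P' \<circ> \<tau>') (at z)"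
    by (rule has_derivative_transform_within_open[OF diff_chain_at[OF \<tau> P] U]) (simp add: eq)
  moreover have "(M has_derivative N' \<circ> \<tau>') (at z)"
    by (rule has_derivative_transform_within_open[OF diff_chain_at[OF \<tau> N] U]) (simp add: eq)
  ultimately have "frechet_derivative Q (at z) = P' \<circ> \<tau>'" "frechet_derivative M (at z) = N' \<circ> \<tau>'"
    "frechet_derivative P (at (\<tau> z)) = P'" "frechet_derivative N (at (\<tau> z)) = N'"
    using P N by (metis frechet_derivative_at)+
  then show ?thesis by (simp add: shape_form_def eq[OF U(2)])
qed

section \<open>Riemannian densities\<close>

lemma orthonormal_basisI:
  fixes b :: "'f::euclidean_space \<Rightarrow> 'f \<Rightarrow> real"
  assumes "bilinear b" "finite E" "card E = DIM('f)" "\<And>u v. u \<in> E \<Longrightarrow> v \<in> E \<Longrightarrow> b u v = (if u = v then 1 else 0)"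
  shows "orthonormal_basis b E"
proof -
  have ind: "independent E" by (rule orthonormal_independent[OF assms(1,2,4)])
  moreover have "span E = UNIV"
    using card_ge_dim_independent[of E UNIV] ind assms(3) by (auto simp: dim_UNIV)
  ultimately show ?thesis using assms(4) by (simp add: orthonormal_basis_def)
qed

context manifold
begin

definition volume_density :: "('a \<Rightarrow> 'e \<Rightarrow> 'e \<Rightarrow> real) \<Rightarrow> ('a, 'e) chart \<Rightarrow> 'e \<Rightarrow> real" where
  "volume_density g c x = sqrt (det (gram (metric_in_chart A g c x)))"

lemma metric_in_chart_pos:
  assumes "riemannian_metric A g" "c \<in> A" "x \<in> cimg c" "u \<noteq> 0"
  shows "metric_in_chart A g c x u u > 0"
proof -
  let ?p = "cinv c x"
  have p: "?p \<in> cdom c" using chart(7)[OF assms(2,3)] .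
  have "tangent_vector A c ?p u \<noteq> 0"
    using components_tangent_vector[OF assms(2) p, of u] linear_0[OF linear_components[OF assms(2) p]] assms(4) by metis
  then show ?thesis using assms(1) by (simp add: metric_in_chart_def riemannian_metric_def)
qed

lemma det_gram_metric_pos:
  assumes "riemannian_metric A g" "c \<in> A" "x \<in> cimg c"
  shows "det (gram (metric_in_chart A g c x)) > 0"
  using assms by (intro det_gram_pos bilinear_metric_in_chart symmetric_metric_in_chart metric_in_chart_pos)
    (auto simp: riemannian_metric_def)

lemma smooth_on_volume_density:
  assumes "riemannian_metric A g" "c \<in> A"
  shows "smooth_on (cimg c) (volume_density g c)"
  unfolding volume_density_def[abs_def] using assms
  by (intro smooth_on_sqrt smooth_on_det_gram chart(2) det_gram_metric_pos smooth_on_metric_in_chart)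
    (auto simp: riemannian_metric_def)

text \<open>The root of the squared determinant in \<open>det_gram_pullback\<close> is the absolute
  value demanded by \<open>density\<close>.\<close>

lemma density_volume_density:
  assumes g: "riemannian_metric A g"
  shows "density (volume_density g)"
  unfolding density_def
proof (intro conjI ballI)
  fix c d p assume c: "c \<in> A" and d: "d \<in> A" and "p \<in> cdom c \<inter> cdom d"
  then have p: "p \<in> cdom c" "p \<in> cdom d" by auto
  have bil: "bilinear (metric_in_chart A g d (cmap d p))"
    using g chart(5)[OF d p(2)] d by (intro bilinear_metric_in_chart) (auto simp: riemannian_metric_def)
  have "metric_in_chart A g c (cmap c p) = (\<lambda>u v. metric_in_chart A g d (cmap d p) (transition c d (cmap c p) u) (transition c d (cmap c p) v))"
    by (simp add: metric_in_chart_change[OF c d p])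
  then have "det (gram (metric_in_chart A g c (cmap c p)))
      = (det (coord_matrix (transition c d (cmap c p))))\<^sup>2 * det (gram (metric_in_chart A g d (cmap d p)))"
    using det_gram_pullback[OF bil linear_trans[OF c d p]] by simp
  then show "volume_density g c (cmap c p) = \<bar>det (coord_matrix (transition c d (cmap c p)))\<bar> * volume_density g d (cmap d p)"
    by (simp add: volume_density_def real_sqrt_mult)
qed (use smooth_on_volume_density[OF g] det_gram_metric_pos[OF g] in \<open>auto simp: volume_density_def\<close>)

text \<open>The divergence is half the metric trace of L_Z g. Differentiating w = sqrt(det g) by
  Jacobi's formula gives w/2 times the trace of the metric derivative, and the trace of Z' is
  rewritten in the orthonormal basis.\<close>

lemma divergence_volume_density:
  fixes Y :: "'a \<Rightarrow> 'e"
  assumes g: "riemannian_metric A g" and c: "c \<in> A" and x: "x \<in> cimg c"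
    and E: "orthonormal_basis (metric_in_chart A g c x) E" and Y: "smooth_on (cimg c) Z"
  shows "(\<Sum>b\<in>Basis. frechet_derivative (\<lambda>x. volume_density g c x *\<^sub>R Z x) (at x) b \<bullet> b)
    = volume_density g c x * (\<Sum>e\<in>E. (frechet_derivative (\<lambda>y. metric_in_chart A g c y e e) (at x) (Z x)
        + 2 * metric_in_chart A g c x (frechet_derivative Z (at x) e) e) / 2)"
proof -
  let ?G = "metric_in_chart A g c" and ?w = "volume_density g c"
  let ?Z' = "frechet_derivative Z (at x)" and ?w' = "frechet_derivative ?w (at x)"
  let ?dG = "\<lambda>e. frechet_derivative (\<lambda>y. ?G y e e) (at x)"
  have sg: "smooth_symmetric_form A g" using g by (simp add: riemannian_metric_def)
  note bil = bilinear_metric_in_chart[OF sg c]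
  have pos: "det (gram (?G x)) > 0" by (rule det_gram_metric_pos[OF g c x])
  have w: "(?w has_derivative ?w') (at x)"
    by (rule smooth_on_has_derivative[OF smooth_on_volume_density[OF g c] x])
  have Z: "(Z has_derivative ?Z') (at x)" by (rule smooth_on_has_derivative[OF Y x])
  have "((\<lambda>y. det (gram (?G y))) has_derivative (\<lambda>h. det (gram (?G x)) * (\<Sum>e\<in>E. ?dG e h))) (at x)"
    by (rule det_gram_has_derivative[where b = ?G and b' = "\<lambda>u v. frechet_derivative (\<lambda>y. ?G y u v) (at x)",
          OF chart(2)[OF c] x bil smooth_on_has_derivative[OF smooth_on_metric_in_chart[OF sg c] x] E])
  from DERIV_compose_FDERIV[OF DERIV_real_sqrt[OF pos] this]
  have "(?w has_derivative (\<lambda>h. det (gram (?G x)) * (\<Sum>e\<in>E. ?dG e h) * (inverse (sqrt (det (gram (?G x)))) / 2))) (at x)"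
    by (simp add: volume_density_def[abs_def])
  from has_derivative_unique[OF w this]
  have w': "?w' h = ?w x * (\<Sum>e\<in>E. ?dG e h) / 2" for h
  proof -
    have "det (gram (?G x)) * inverse (sqrt (det (gram (?G x)))) = ?w x"
      using pos by (simp add: volume_density_def field_simps)
    then show ?thesis using \<open>?w' = _\<close> by (simp add: mult_ac)
  qed
  have "(\<Sum>b\<in>Basis. frechet_derivative (\<lambda>x. ?w x *\<^sub>R Z x) (at x) b \<bullet> b)
      = (\<Sum>b\<in>Basis. ?w x * (?Z' b \<bullet> b) + (Z x \<bullet> b) *\<^sub>R ?w' b)"
    using frechet_derivative_at[OF has_derivative_scaleR[OF w Z], symmetric] by (simp add: inner_add_left mult.commute)
  also have "\<dots> = ?w x * (\<Sum>b\<in>Basis. ?Z' b \<bullet> b) + ?w' (Z x)"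
    using linear_sum_Basis[OF has_derivative_linear[OF w], of "Z x"] by (simp add: sum.distrib sum_distrib_left)
  also have "\<dots> = ?w x * (\<Sum>e\<in>E. ?G x (?Z' e) e) + ?w x * (\<Sum>e\<in>E. ?dG e (Z x)) / 2"
    by (simp add: trace_orthonormal_basis[OF bil[OF x] E has_derivative_linear[OF Z]] w')
  finally show ?thesis
    by (simp add: sum.distrib add_divide_distrib sum_divide_distrib[symmetric] sum_distrib_left[symmetric] algebra_simps)
qed

lemma orthonormal_basis_components:
  assumes g: "smooth_symmetric_form A g" and c: "c \<in> A" "p \<in> cdom c" and E: "orthonormal_basis (g p) E"
  shows "orthonormal_basis (metric_in_chart A g c (cmap c p)) (components A c p ` E)" and "inj_on (components A c p) E"
proof -
  have bil: "bilinear (g p)" using g by (simp add: smooth_symmetric_form_def)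
  show inj: "inj_on (components A c p) E"
    by (rule inj_on_inverseI[where g = "tangent_vector A c p"]) (rule tangent_vector_components[OF c])
  show "orthonormal_basis (metric_in_chart A g c (cmap c p)) (components A c p ` E)"
  proof (rule orthonormal_basisI)
    show "bilinear (metric_in_chart A g c (cmap c p))"
      by (rule bilinear_metric_in_chart[OF g c(1) chart(5)[OF c]])
    show "finite (components A c p ` E)" "card (components A c p ` E) = DIM('e)"
      using orthonormal_basis_expand[OF bil E] card_image[OF inj] by auto
    fix u v assume "u \<in> components A c p ` E" "v \<in> components A c p ` E"
    then show "metric_in_chart A g c (cmap c p) u v = (if u = v then 1 else 0)"
      using E inj by (auto simp: metric_in_chart_components[OF c] orthonormal_basis_def inj_on_def)
  qed
qed

end

section \<open>The Levi-Civita connection in a chart\<close>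

context manifold
begin

text \<open>\<open>christoffel\<close> is a definite description; Koszul's existence and uniqueness
  statement at the point makes its defining properties available.\<close>

lemma christoffel_properties:
  assumes g: "smooth_symmetric_form A g" and c: "c \<in> A" and x: "x \<in> cimg c"
    and nd: "\<And>p v. (\<And>w. g p v w = 0) \<Longrightarrow> v = 0"
  shows "christoffel A g c x u v = christoffel A g c x v u"
    and "frechet_derivative (\<lambda>y. metric_in_chart A g c y v w) (at x) u
      = metric_in_chart A g c x (christoffel A g c x u v) w + metric_in_chart A g c x v (christoffel A g c x u w)"
proof -
  let ?G = "metric_in_chart A g c"
  let ?D = "\<lambda>u v w. frechet_derivative (\<lambda>y. ?G y v w) (at x) u"
  let ?p = "cinv c x"
  have p: "?p \<in> cdom c" "cmap c ?p = x" using chart(7,8)[OF c x] .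
  have sym: "?G y u v = ?G y v u" for y u v by (rule symmetric_metric_in_chart[OF g])
  note bil = bilinear_metric_in_chart[OF g c]
  note sm = smooth_on_metric_in_chart[OF g c]
  have nd': "v = 0" if "\<And>w. ?G x v w = 0" for v
  proof -
    have "g ?p (tangent_vector A c ?p v) w = 0" for w
      using that[of "components A c ?p w"] tangent_vector_components[OF c p(1), of w]
      by (simp add: metric_in_chart_def)
    then have "tangent_vector A c ?p v = 0" by (rule nd)
    then show ?thesis
      using components_tangent_vector[OF c p(1), of v] linear_0[OF linear_components[OF c p(1)]] by simp
  qed
  have D2: "bilinear (\<lambda>v w. ?D u v w)" for u
    by (rule frechet_derivative_form_linear(2)[OF chart(2)[OF c] x bil sm])
  have "\<exists>!\<Gamma>. bilinear \<Gamma> \<and> (\<forall>u v. \<Gamma> u v = \<Gamma> v u) \<and> (\<forall>u v w. ?D u v w = ?G x (\<Gamma> u v) w + ?G x v (\<Gamma> u w))"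
  proof (rule levi_civita_form_unique[OF bil[OF x] sym nd'])
    show "linear (\<lambda>u. ?D u v w)" for v w
      by (rule frechet_derivative_form_linear(1)[OF chart(2)[OF c] x bil sm])
    show "linear (\<lambda>v. ?D u v w)" for u w using D2[of u] by (simp add: bilinear_def)
    show "?D u v w = ?D u w v" for u v w by (simp only: sym[of _ v w])
  qed
  from theI'[OF this]
  have "bilinear (christoffel A g c x) \<and> (\<forall>u v. christoffel A g c x u v = christoffel A g c x v u) \<and>
     (\<forall>u v w. ?D u v w = ?G x (christoffel A g c x u v) w + ?G x v (christoffel A g c x u w))"
    unfolding christoffel_def .
  then show "christoffel A g c x u v = christoffel A g c x v u"
    "?D u v w = ?G x (christoffel A g c x u v) w + ?G x v (christoffel A g c x u w)" by blast+
qed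

end

section \<open>Spacelike hypersurfaces\<close>

locale spacelike_hypersurface_in_spacetime =
  fixes A :: "('a::{t2_space,second_countable_topology}, 'f::euclidean_space) chart set"
    and B :: "('b::{t2_space,second_countable_topology}, 'e::euclidean_space) chart set"
    and gbar :: "'b \<Rightarrow> 'e \<Rightarrow> 'e \<Rightarrow> real" and X :: "'b \<Rightarrow> 'e" and \<psi> :: "'a \<Rightarrow> 'b" and N :: "'a \<Rightarrow> 'e"
  assumes spacetime: "spacetime B gbar X"
    and hypersurface: "spacelike_hypersurface A B gbar \<psi>"
    and normal: "future_unit_normal A B gbar X \<psi> N"
begin

sublocale M: manifold A
  using hypersurface by unfold_locales (simp add: spacelike_hypersurface_def)

sublocale B: manifold B
  using spacetime by unfold_locales (simp add: spacetime_def)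

abbreviation "d\<psi> \<equiv> differential A B \<psi>"
abbreviation "g \<equiv> pullback_metric A B gbar \<psi>"
abbreviation "rep c d \<equiv> cmap d \<circ> \<psi> \<circ> cinv c"
abbreviation "rep_dom c d \<equiv> cmap c ` (cdom c \<inter> \<psi> -` cdom d)"
abbreviation "G d \<equiv> metric_in_chart B gbar d"
abbreviation "normal_rep c d x \<equiv> components B d (\<psi> (cinv c x)) (N (cinv c x))"
abbreviation "field_rep d y \<equiv> components B d (cinv d y) (X (cinv d y))"

lemma form: "smooth_symmetric_form B gbar" "\<And>p. lorentzian_form (gbar p)"
  using spacetime by (auto simp: spacetime_def lorentzian_metric_def)

lemma gbar: "bilinear (gbar p)" "gbar p u v = gbar p v u"
  using form(1) by (auto simp: smooth_symmetric_form_def)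

lemma gbar_linear: "linear (gbar p u)" "linear (\<lambda>v. gbar p v u)"
  using gbar(1) by (auto simp: bilinear_def)

lemmas gbar_simps = linear_add[OF gbar_linear(1)] linear_add[OF gbar_linear(2)] linear_diff[OF gbar_linear(1)]
  linear_diff[OF gbar_linear(2)] linear_cmul[OF gbar_linear(1)] linear_cmul[OF gbar_linear(2)]

lemma gbar_nondegenerate: "(\<And>w. gbar p v w = 0) \<Longrightarrow> v = 0"
  using lorentzian_form_nondegenerate[OF form(2) gbar(1)] .

lemma g_riemannian: "riemannian_metric A g"
  using hypersurface by (simp add: spacelike_hypersurface_def)

lemma g_form: "smooth_symmetric_form A g"
  using g_riemannian by (simp add: riemannian_metric_def)

lemma g: "bilinear (g q)" "g q u v = g q v u" "u \<noteq> 0 \<Longrightarrow> g q u u > 0"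
  using g_riemannian by (auto simp: riemannian_metric_def smooth_symmetric_form_def)

lemma N: "gbar (\<psi> q) (N q) (d\<psi> q v) = 0" "gbar (\<psi> q) (N q) (N q) = -1" "gbar (\<psi> q) (N q) (X (\<psi> q)) < 0"
  using normal by (auto simp: future_unit_normal_def)

lemma smooth_map: "smooth_map A B \<psi>"
  using hypersurface by (simp add: spacelike_hypersurface_def immersion_def)

lemma open_vimage: "d \<in> B \<Longrightarrow> open (\<psi> -` cdom d)"
  using smooth_map B.chart(1) by (auto simp: smooth_map_def continuous_on_open_vimage[OF open_UNIV])

lemma open_rep_dom: "c \<in> A \<Longrightarrow> d \<in> B \<Longrightarrow> open (rep_dom c d)"
  by (intro M.open_chart_image open_vimage)

lemma rep_dom_iff: "c \<in> A \<Longrightarrow> x \<in> rep_dom c d \<longleftrightarrow> x \<in> cimg c \<and> \<psi> (cinv c x) \<in> cdom d"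
  by (simp add: M.chart_image_iff)

lemma smooth_on_rep: "c \<in> A \<Longrightarrow> d \<in> B \<Longrightarrow> smooth_on (rep_dom c d) (rep c d)"
  using smooth_map by (simp add: smooth_map_def)

lemma rep_image: "c \<in> A \<Longrightarrow> d \<in> B \<Longrightarrow> rep c d ` rep_dom c d \<subseteq> cimg d"
  by (auto simp: M.chart(6) intro!: B.chart(5))

lemma smooth_on_normal_rep: "c \<in> A \<Longrightarrow> d \<in> B \<Longrightarrow> smooth_on (rep_dom c d) (\<lambda>x. normal_rep c d x)"
  using normal by (simp add: future_unit_normal_def smooth_vector_field_along_def)

lemma smooth_on_field_rep: "d \<in> B \<Longrightarrow> smooth_on (cimg d) (\<lambda>y. field_rep d y)"
  using spacetime by (simp add: spacetime_def timelike_vector_field_def smooth_vector_field_def)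

lemma rep_has_derivative:
  assumes "c \<in> A" "d \<in> B" "q \<in> cdom c" "\<psi> q \<in> cdom d"
  shows "(rep c d has_derivative frechet_derivative (rep c d) (at (cmap c q))) (at (cmap c q))"
  by (rule smooth_on_has_derivative[OF smooth_on_rep[OF assms(1,2)]]) (use assms in auto)

text \<open>Chain rule through both changes of chart. It expresses the differential, defined in
  charts that jump with \<open>q\<close>, by the derivative of one fixed coordinate map.\<close>

lemma components_differential:
  assumes c: "c \<in> A" "q \<in> cdom c" and d: "d \<in> B" "\<psi> q \<in> cdom d"
  shows "components B d (\<psi> q) (d\<psi> q v) = frechet_derivative (rep c d) (at (cmap c q)) (components A c q v)"
proof -
  let ?c = "chart_at A q" and ?d = "chart_at B (\<psi> q)"
  let ?x = "cmap ?c q"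
  note c0 = M.chart_at[of q] and d0 = B.chart_at[of "\<psi> q"]
  note 1 = M.trans_has_derivative[OF c0(1) c(1) c0(2) c(2)]
  have 2: "(rep c d has_derivative frechet_derivative (rep c d) (at (cmap c q))) (at ((cmap c \<circ> cinv ?c) ?x))"
    using rep_has_derivative[OF c(1) d(1) c(2) d(2)] M.chart(6)[OF c0] by simp
  note 3 = rep_has_derivative[OF c0(1) d0(1) c0(2) d0(2)]
  have 4: "((cmap d \<circ> cinv ?d) has_derivative transition ?d d (cmap ?d (\<psi> q))) (at (rep ?c ?d ?x))"
    using B.trans_has_derivative[OF d0(1) d(1) d0(2) d(2)] M.chart(6)[OF c0] by simp
  let ?V = "cmap ?c ` (cdom ?c \<inter> (cdom c \<inter> (\<psi> -` cdom d \<inter> \<psi> -` cdom ?d)))"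
  have V: "open ?V" "?x \<in> ?V"
    using c d c0 d0 by (auto intro!: M.open_chart_image open_Int M.chart(1) open_vimage)
  have "(rep c d \<circ> (cmap c \<circ> cinv ?c)) y = (cmap d \<circ> cinv ?d \<circ> rep ?c ?d) y" if "y \<in> ?V" for y
    using that M.chart_image_iff[OF c0(1)] M.chart(6)[OF c(1)] B.chart(6)[OF d0(1)] by auto
  from has_derivative_transform_within_open[OF diff_chain_at[OF 1 2] V this]
  have "((cmap d \<circ> cinv ?d \<circ> rep ?c ?d) has_derivative
      frechet_derivative (rep c d) (at (cmap c q)) \<circ> transition ?c c ?x) (at ?x)" .
  from has_derivative_unique[OF this diff_chain_at[OF 3 4]]
  show ?thesis
    by (simp add: B.components_eq M.components_eq differential_def fun_eq_iff)
qed

lemma linear_differential: "linear (d\<psi> q)"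
proof -
  have "d\<psi> q = frechet_derivative (rep (chart_at A q) (chart_at B (\<psi> q))) (at (cmap (chart_at A q) q))"
    by (simp add: differential_def[abs_def])
  then show ?thesis
    using has_derivative_linear[OF rep_has_derivative[OF M.chart_at(1) B.chart_at(1) M.chart_at(2) B.chart_at(2)]] by simp
qed

lemma inj_differential: "inj (d\<psi> q)"
  using hypersurface by (simp add: spacelike_hypersurface_def immersion_def)

text \<open>The image of the differential has codimension 1 and misses \<open>N q\<close>: a tangent
  \<open>N q\<close> would be orthogonal to itself, whereas its square is -1. Together they span,
  and nondegeneracy finishes.\<close>

lemma tangent_normal_span:
  assumes "\<And>v. gbar (\<psi> q) z (d\<psi> q v) = 0" "gbar (\<psi> q) z (N q) = 0"
  shows "z = 0"
proof -
  have dim: "dim (range (d\<psi> q)) = DIM('f)"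
    using dim_image_eq[OF linear_differential[of q], where S = UNIV] inj_differential by (simp add: dim_UNIV)
  have sub: "subspace (range (d\<psi> q))"
    using linear_subspace_image[OF linear_differential subspace_UNIV] .
  then have sp: "span (range (d\<psi> q)) = range (d\<psi> q)"
    using span_eq_iff by blast
  have "N q \<notin> span (range (d\<psi> q))"
  proof
    assume "N q \<in> span (range (d\<psi> q))"
    then obtain v where "N q = d\<psi> q v" unfolding sp by blast
    then show False using N(1,2)[of q] by (metis zero_neq_neg_one)
  qed
  then have "dim (insert (N q) (range (d\<psi> q))) = DIM('e)"
    using hypersurface by (simp add: dim_insert dim spacelike_hypersurface_def)
  then have full: "span (insert (N q) (range (d\<psi> q))) = UNIV"
    using dim_eq_full by blast
  have "gbar (\<psi> q) z w = 0" for w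
  proof -
    have "w \<in> span (insert (N q) (range (d\<psi> q)))" using full by simp
    then obtain k where "w - k *\<^sub>R N q \<in> span (range (d\<psi> q))" by (auto simp: span_insert)
    then obtain v where "w - k *\<^sub>R N q = d\<psi> q v" unfolding sp by blast
    then have "w = k *\<^sub>R N q + d\<psi> q v" by (simp add: algebra_simps)
    then show ?thesis using assms by (simp add: gbar_simps)
  qed
  then show ?thesis by (rule gbar_nondegenerate)
qed

section \<open>Tangential and normal part of the conformal field\<close>

definition tangential_part :: "'a \<Rightarrow> 'f" where
  "tangential_part q = (SOME y. \<forall>v. g q y v = gbar (\<psi> q) (X (\<psi> q)) (d\<psi> q v))"

text \<open>The minus sign compensates gbar(N,N) = -1; with \<open>N\<close> future-pointing it
  makes the normal part positive.\<close>

definition normal_part :: "'a \<Rightarrow> real" where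
  "normal_part q = - gbar (\<psi> q) (X (\<psi> q)) (N q)"

abbreviation "tangential_rep c x \<equiv> components A c (cinv c x) (tangential_part (cinv c x))"

lemma tangential_part: "g q (tangential_part q) v = gbar (\<psi> q) (X (\<psi> q)) (d\<psi> q v)"
proof -
  have "\<exists>y. \<forall>v. g q y v = gbar (\<psi> q) (X (\<psi> q)) (d\<psi> q v)"
  proof (rule riesz_nondegenerate[OF g(1)])
    show "v = 0" if "\<And>w. g q v w = 0" for v using that[of v] g(3)[of v q] by force
    show "linear (\<lambda>v. gbar (\<psi> q) (X (\<psi> q)) (d\<psi> q v))"
      using linear_compose[OF linear_differential gbar_linear(1)] by (simp add: o_def)
  qed
  from someI_ex[OF this] show ?thesis by (simp add: tangential_part_def)
qed

lemma decomposition: "X (\<psi> q) = d\<psi> q (tangential_part q) + normal_part q *\<^sub>R N q"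
proof -
  have "X (\<psi> q) - d\<psi> q (tangential_part q) - normal_part q *\<^sub>R N q = 0"
  proof (rule tangent_normal_span)
    fix v
    have "gbar (\<psi> q) (d\<psi> q (tangential_part q)) (d\<psi> q v) = gbar (\<psi> q) (X (\<psi> q)) (d\<psi> q v)"
      using tangential_part[of q v] by (simp add: pullback_metric_def)
    then show "gbar (\<psi> q) (X (\<psi> q) - d\<psi> q (tangential_part q) - normal_part q *\<^sub>R N q) (d\<psi> q v) = 0"
      by (simp add: gbar_simps N)
    show "gbar (\<psi> q) (X (\<psi> q) - d\<psi> q (tangential_part q) - normal_part q *\<^sub>R N q) (N q) = 0"
      using N(1)[of q "tangential_part q"] gbar(2)[of "\<psi> q" "d\<psi> q (tangential_part q)" "N q"] by (simp add: gbar_simps N normal_part_def)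
  qed
  then show ?thesis by (simp add: algebra_simps)
qed

lemma norm_X: "- gbar (\<psi> q) (X (\<psi> q)) (X (\<psi> q)) = (normal_part q)\<^sup>2 - g q (tangential_part q) (tangential_part q)"
proof -
  have "gbar (\<psi> q) (X (\<psi> q)) (X (\<psi> q)) = gbar (\<psi> q) (X (\<psi> q)) (d\<psi> q (tangential_part q)) + normal_part q * gbar (\<psi> q) (X (\<psi> q)) (N q)"
    by (subst (2) decomposition) (simp add: gbar_simps)
  also have "\<dots> = g q (tangential_part q) (tangential_part q) - (normal_part q)\<^sup>2"
    by (simp add: tangential_part normal_part_def power2_eq_square)
  finally show ?thesis by simp
qed

section \<open>Coordinate expressions in a chart of the source and one of the target\<close>

lemma G_components: "d \<in> B \<Longrightarrow> p \<in> cdom d \<Longrightarrow> gbar p u v = G d (cmap d p) (components B d p u) (components B d p v)"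
  using B.metric_in_chart_components[of d p gbar u v] by simp

lemma rep_cmap: "c \<in> A \<Longrightarrow> q \<in> cdom c \<Longrightarrow> rep c d (cmap c q) = cmap d (\<psi> q)"
  by (simp add: M.chart)

lemma rep_dom_point:
  assumes "c \<in> A" "d \<in> B" "x \<in> rep_dom c d"
  obtains q where "q \<in> cdom c" "\<psi> q \<in> cdom d" "x = cmap c q" "cinv c x = q" "rep c d x = cmap d (\<psi> q)"
  using assms M.chart(6)[OF assms(1)] by auto

lemma orth_rep:
  assumes "c \<in> A" "d \<in> B" "x \<in> rep_dom c d"
  shows "G d (rep c d x) (normal_rep c d x) (frechet_derivative (rep c d) (at x) u) = 0"
proof -
  obtain q where q: "q \<in> cdom c" "\<psi> q \<in> cdom d" "x = cmap c q" "cinv c x = q" "rep c d x = cmap d (\<psi> q)"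
    using rep_dom_point[OF assms] .
  have "frechet_derivative (rep c d) (at x) u = components B d (\<psi> q) (d\<psi> q (tangent_vector A c q u))"
    using components_differential[OF assms(1) q(1) assms(2) q(2)] M.components_tangent_vector[OF assms(1) q(1)]
    by (simp add: q(3))
  then show ?thesis
    using N(1)[of q] G_components[OF assms(2) q(2)] by (simp only: q(4,5))
qed

lemma pullback_rep:
  assumes "c \<in> A" "d \<in> B" "x \<in> rep_dom c d"
  shows "metric_in_chart A g c x u v
    = G d (rep c d x) (frechet_derivative (rep c d) (at x) u) (frechet_derivative (rep c d) (at x) v)"
proof -
  obtain q where q: "q \<in> cdom c" "\<psi> q \<in> cdom d" "x = cmap c q" "cinv c x = q" "rep c d x = cmap d (\<psi> q)"
    using rep_dom_point[OF assms] .
  have "frechet_derivative (rep c d) (at x) w = components B d (\<psi> q) (d\<psi> q (tangent_vector A c q w))" for w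
    using components_differential[OF assms(1) q(1) assms(2) q(2)] M.components_tangent_vector[OF assms(1) q(1)]
    by (simp add: q(3))
  then show ?thesis
    using G_components[OF assms(2) q(2)] by (simp add: metric_in_chart_def[of A] q(4,5) pullback_metric_def)
qed

lemma decomposition_rep:
  assumes "c \<in> A" "d \<in> B" "x \<in> rep_dom c d"
  shows "field_rep d (rep c d x) = frechet_derivative (rep c d) (at x) (tangential_rep c x)
    + normal_part (cinv c x) *\<^sub>R normal_rep c d x"
proof -
  obtain q where q: "q \<in> cdom c" "\<psi> q \<in> cdom d" "x = cmap c q" "cinv c x = q" "rep c d x = cmap d (\<psi> q)"
    using rep_dom_point[OF assms] .
  have "field_rep d (rep c d x) = components B d (\<psi> q) (X (\<psi> q))"
    using B.chart(6)[OF assms(2) q(2)] by (simp only: q(5))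
  also have "\<dots> = components B d (\<psi> q) (d\<psi> q (tangential_part q)) + normal_part q *\<^sub>R components B d (\<psi> q) (N q)"
    using B.linear_components[OF assms(2) q(2)] by (subst decomposition) (simp add: linear_add linear_cmul)
  also have "components B d (\<psi> q) (d\<psi> q (tangential_part q)) = frechet_derivative (rep c d) (at x) (components A c q (tangential_part q))"
    using components_differential[OF assms(1) q(1) assms(2) q(2)] by (simp only: q(3))
  finally show ?thesis by (simp only: q(4))
qed

lemmas G_bilinear = B.bilinear_metric_in_chart[OF form(1)]
lemmas G_symmetric = B.symmetric_metric_in_chart[OF form(1)]
lemmas smooth_on_G = B.smooth_on_metric_in_chart[OF form(1)]

lemma smooth_on_X_form:
  assumes c: "c \<in> A" and d: "d \<in> B" and b: "smooth_on (rep_dom c d) b"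
  shows "smooth_on (rep_dom c d) (\<lambda>x. G d (rep c d x) (field_rep d (rep c d x)) (b x))"
  by (rule smooth_on_form[OF open_rep_dom[OF c d] smooth_on_rep[OF c d] _ b rep_image[OF c d] G_bilinear[OF d] smooth_on_G[OF d]])
    (intro smooth_on_compose[OF open_rep_dom[OF c d] rep_image[OF c d] smooth_on_field_rep[OF d] smooth_on_rep[OF c d]])

lemma smooth_on_normal_part:
  assumes c: "c \<in> A" and d: "d \<in> B"
  shows "smooth_on (rep_dom c d) (\<lambda>x. normal_part (cinv c x))"
proof (rule smooth_on_cong[OF open_rep_dom[OF c d] smooth_on_uminus[OF open_rep_dom[OF c d]
        smooth_on_X_form[OF c d smooth_on_normal_rep[OF c d]]]])
  fix x assume x: "x \<in> rep_dom c d"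
  obtain q where q: "q \<in> cdom c" "\<psi> q \<in> cdom d" "x = cmap c q" "cinv c x = q" "rep c d x = cmap d (\<psi> q)"
    using rep_dom_point[OF c d x] .
  show "- G d (rep c d x) (field_rep d (rep c d x)) (normal_rep c d x) = normal_part (cinv c x)"
    using B.chart(6)[OF d q(2)] G_components[OF d q(2)] by (simp only: q(4,5) normal_part_def)
qed

text \<open>The tangential part is a pointwise choice, but its components solve a linear system with
  Gram matrix of \<open>g\<close> and smooth right-hand side, so \<open>smooth_on_riesz\<close>
  applies. The right-hand side is checked locally, since a chart of the target covers only part of
  the image.\<close>

lemma smooth_tangential_part: "smooth_vector_field A tangential_part"
  unfolding smooth_vector_field_def
proof
  fix c assume c: "c \<in> A"
  let ?\<beta> = "\<lambda>x v. gbar (\<psi> (cinv c x)) (X (\<psi> (cinv c x))) (d\<psi> (cinv c x) (tangent_vector A c (cinv c x) v))"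
  show "smooth_on (cimg c) (\<lambda>x. tangential_rep c x)"
  proof (rule smooth_on_riesz[where b = "metric_in_chart A g c" and \<beta> = ?\<beta>])
    show "open (cimg c)" by (rule M.chart(2)[OF c])
    show "bilinear (metric_in_chart A g c x)" if "x \<in> cimg c" for x
      by (rule M.bilinear_metric_in_chart[OF g_form c that])
    show "det (gram (metric_in_chart A g c x)) \<noteq> 0" if "x \<in> cimg c" for x
      using M.det_gram_metric_pos[OF g_riemannian c that] by simp
    show "smooth_on (cimg c) (\<lambda>x. metric_in_chart A g c x u v)" for u v
      by (rule M.smooth_on_metric_in_chart[OF g_form c])
    show "metric_in_chart A g c x v (tangential_rep c x) = ?\<beta> x v" if "x \<in> cimg c" for x v
    proof -
      have "metric_in_chart A g c x v (tangential_rep c x) = g (cinv c x) (tangent_vector A c (cinv c x) v) (tangential_part (cinv c x))"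
        using M.tangent_vector_components[OF c M.chart(7)[OF c that]] by (simp add: metric_in_chart_def)
      then show ?thesis by (simp add: g(2)[of _ _ "tangential_part _"] tangential_part)
    qed
    show "smooth_on (cimg c) (\<lambda>x. ?\<beta> x v)" for v
    proof (rule smooth_on_local)
      fix x assume x: "x \<in> cimg c"
      let ?d = "chart_at B (\<psi> (cinv c x))"
      note d = B.chart_at[of "\<psi> (cinv c x)"]
      have xd: "x \<in> rep_dom c ?d" using x d(2) rep_dom_iff[OF c, of x ?d] by blast
      have "smooth_on (rep_dom c ?d) (\<lambda>x. ?\<beta> x v)"
      proof (rule smooth_on_cong[OF open_rep_dom[OF c d(1)] smooth_on_X_form[OF c d(1) smooth_on_frechet_derivative[OF smooth_on_rep[OF c d(1)]]]])
        fix y assume y: "y \<in> rep_dom c ?d"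
        obtain q where q: "q \<in> cdom c" "\<psi> q \<in> cdom ?d" "y = cmap c q" "cinv c y = q" "rep c ?d y = cmap ?d (\<psi> q)"
          using rep_dom_point[OF c d(1) y] .
        have "frechet_derivative (rep c ?d) (at y) v = components B ?d (\<psi> q) (d\<psi> q (tangent_vector A c q v))"
          using components_differential[OF c q(1) d(1) q(2)] M.components_tangent_vector[OF c q(1)] by (simp add: q(3))
        then show "G ?d (rep c ?d y) (field_rep ?d (rep c ?d y)) (frechet_derivative (rep c ?d) (at y) v) = ?\<beta> y v"
          using B.chart(6)[OF d(1) q(2)] G_components[OF d(1) q(2)] by (simp only: q(4,5))
      qed
      then show "\<exists>U. open U \<and> x \<in> U \<and> smooth_on U (\<lambda>x. ?\<beta> x v)"
        using open_rep_dom[OF c d(1)] xd by blast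
    qed
  qed
qed

section \<open>The second fundamental form in coordinates\<close>

abbreviation "shape c d \<equiv> shape_form (G d) (rep c d) (\<lambda>x. normal_rep c d x)"

text \<open>The mean curvature is computed in the distinguished chart at \<open>q\<close>, the
  divergence in an arbitrary chart \<open>c\<close>; this lemma compares the two.\<close>

lemma shape_change:
  assumes c: "c \<in> A" "q \<in> cdom c" and c': "c' \<in> A" "q \<in> cdom c'" and d: "d \<in> B" "\<psi> q \<in> cdom d"
  shows "shape c d (cmap c q) (components A c q v) = shape c' d (cmap c' q) (components A c' q v)"
proof -
  let ?U = "cmap c ` (cdom c \<inter> (cdom c' \<inter> \<psi> -` cdom d))"
  have U: "open ?U" "cmap c q \<in> ?U"
    using c c' d by (auto intro!: M.open_chart_image open_Int M.chart(1) open_vimage)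
  have \<tau>: "(cmap c' \<circ> cinv c) (cmap c q) = cmap c' q" using M.chart(6)[OF c] by simp
  have q': "cmap c' q \<in> rep_dom c' d" using c' d by blast
  have "shape c d (cmap c q) (components A c q v)
      = shape c' d ((cmap c' \<circ> cinv c) (cmap c q)) (transition c c' (cmap c q) (components A c q v))"
  proof (rule shape_form_compose[OF U M.trans_has_derivative[OF c(1) c'(1) c(2) c'(2)]])
    show "(rep c' d has_derivative frechet_derivative (rep c' d) (at (cmap c' q))) (at ((cmap c' \<circ> cinv c) (cmap c q)))"
      unfolding \<tau> by (rule smooth_on_has_derivative[OF smooth_on_rep[OF c'(1) d(1)] q'])
    show "((\<lambda>x. normal_rep c' d x) has_derivative frechet_derivative (\<lambda>x. normal_rep c' d x) (at (cmap c' q))) (at ((cmap c' \<circ> cinv c) (cmap c q)))"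
      unfolding \<tau> by (rule smooth_on_has_derivative[OF smooth_on_normal_rep[OF c'(1) d(1)] q'])
    fix y assume "y \<in> ?U"
    then have "cinv c' (cmap c' (cinv c y)) = cinv c y"
      using M.chart_image_iff[OF c(1)] M.chart(6)[OF c'(1)] by blast
    then show "rep c d y = rep c' d ((cmap c' \<circ> cinv c) y)" "normal_rep c d y = normal_rep c' d ((cmap c' \<circ> cinv c) y)"
      by simp_all
  qed
  then show ?thesis using M.components_change[OF c(1) c'(1) c(2) c'(2)] by (simp only: \<tau>)
qed

text \<open>The Levi-Civita term of the source is tangent and drops out against \<open>N\<close>;
  Weingarten's formula handles the ambient derivative. The result depends on \<open>V\<close> only
  through its value at \<open>q\<close>, so any chosen extension may be inserted.\<close>

lemma second_fundamental_form_shape: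
  assumes V: "smooth_vector_field A V" and v: "V q = v"
  shows "- gbar (\<psi> q) (second_fundamental_form A B gbar \<psi> V V q) (N q)
    = shape (chart_at A q) (chart_at B (\<psi> q)) (cmap (chart_at A q) q) v"
proof -
  let ?c = "chart_at A q" and ?d = "chart_at B (\<psi> q)"
  let ?x = "cmap ?c q"
  note c = M.chart_at[of q] and d = B.chart_at[of "\<psi> q"]
  let ?P' = "\<lambda>y. frechet_derivative (rep ?c ?d) (at y)"
  let ?Z = "\<lambda>y. components A ?c (cinv ?c y) (V (cinv ?c y))"
  let ?\<Gamma> = "christoffel B gbar ?d (cmap ?d (\<psi> q))"
  have x: "?x \<in> rep_dom ?c ?d" using c d by auto
  have P: "rep ?c ?d ?x = cmap ?d (\<psi> q)" by (rule rep_cmap[OF c])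
  have y: "cmap ?d (\<psi> q) \<in> cimg ?d" by (rule B.chart(5)[OF d])
  have Z: "smooth_on (rep_dom ?c ?d) ?Z" "?Z ?x = v"
    using smooth_on_subset[OF M.smooth_vector_field_components[OF V c(1)]] rep_dom_iff[OF c(1)] v
    by (auto simp: M.chart(6)[OF c] M.components_chart_at)
  have dv: "d\<psi> q v = ?P' ?x v"
    using components_differential[OF c d, of v] by (simp add: M.components_chart_at B.components_chart_at)
  have PZ: "(\<lambda>y. ?P' y (?Z y)) differentiable at ?x"
    using smooth_on_has_derivative[OF smooth_on_frechet_derivative_apply[OF open_rep_dom[OF c(1) d(1)] smooth_on_rep[OF c(1) d(1)] Z(1)] x]
    by (rule differentiableI)
  have "frechet_derivative (\<lambda>y. ?P' y (?Z y)) (at ?x)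
      = frechet_derivative (\<lambda>x. components B ?d (\<psi> (cinv ?c x)) (d\<psi> (cinv ?c x) (V (cinv ?c x)))) (at ?x)"
  proof (rule frechet_derivative_transform_within_open[OF PZ open_rep_dom[OF c(1) d(1)] x])
    fix y assume y: "y \<in> rep_dom ?c ?d"
    obtain p where p: "p \<in> cdom ?c" "\<psi> p \<in> cdom ?d" "y = cmap ?c p" "cinv ?c y = p" "rep ?c ?d y = cmap ?d (\<psi> p)"
      using rep_dom_point[OF c(1) d(1) y] .
    show "?P' y (?Z y) = components B ?d (\<psi> (cinv ?c y)) (d\<psi> (cinv ?c y) (V (cinv ?c y)))"
      using components_differential[OF c(1) p(1) d(1) p(2)] p(3,4) by simp
  qed
  then have cov: "covariant_derivative_along A B gbar \<psi> (\<lambda>p. d\<psi> p (V p)) q (V q)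
      = frechet_derivative (\<lambda>y. ?P' y (?Z y)) (at ?x) v + ?\<Gamma> (?P' ?x v) (?P' ?x v)"
    by (simp add: covariant_derivative_along_def Let_def v dv)
  have "- gbar (\<psi> q) (second_fundamental_form A B gbar \<psi> V V q) (N q)
      = - gbar (\<psi> q) (covariant_derivative_along A B gbar \<psi> (\<lambda>p. d\<psi> p (V p)) q (V q)) (N q)"
    using N(1)[of q] gbar(2)[of "\<psi> q" _ "N q"] by (simp add: second_fundamental_form_def gbar_simps)
  also have "\<dots> = - G ?d (rep ?c ?d ?x) (frechet_derivative (\<lambda>y. ?P' y (?Z y)) (at ?x) v + ?\<Gamma> (?P' ?x v) (?P' ?x v)) (normal_rep ?c ?d ?x)"
    unfolding P cov using G_components[OF d] by (simp add: M.chart(6)[OF c] B.components_chart_at)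
  also have "\<dots> = shape ?c ?d ?x v"
  proof (rule shape_form_weingarten[where \<Gamma> = ?\<Gamma> and G = "G ?d" and P = "rep ?c ?d" and Z = ?Z, OF open_rep_dom[OF c(1) d(1)] x rep_image[OF c(1) d(1)] smooth_on_rep[OF c(1) d(1)]
        B.chart(2)[OF d(1)] G_bilinear[OF d(1)] smooth_on_G[OF d(1)] G_symmetric smooth_on_normal_rep[OF c(1) d(1)] Z orth_rep[OF c(1) d(1)]])
    show "?\<Gamma> u v = ?\<Gamma> v u" for u v
      by (rule B.christoffel_properties(1)[OF form(1) d(1) y gbar_nondegenerate])
    show "frechet_derivative (\<lambda>y. G ?d y v w) (at (rep ?c ?d ?x)) u = G ?d (rep ?c ?d ?x) (?\<Gamma> u v) w + G ?d (rep ?c ?d ?x) v (?\<Gamma> u w)" for u v w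
      unfolding P by (rule B.christoffel_properties(2)[OF form(1) d(1) y gbar_nondegenerate])
  qed
  finally show ?thesis .
qed

text \<open>The same choice as inside \<open>metric_trace\<close>, so that the trace in the mean
  curvature is literally a sum over \<open>frame q\<close>.\<close>

definition frame :: "'a \<Rightarrow> 'f set" where
  "frame q = (SOME E. orthonormal_basis (g q) E)"

lemma frame: "orthonormal_basis (g q) (frame q)"
  unfolding frame_def by (rule someI_ex) (rule orthonormal_basis_exists[OF g])

lemma mean_curvature_shape:
  "real DIM('f) * mean_curvature A B gbar \<psi> N q
    = (\<Sum>e\<in>frame q. shape (chart_at A q) (chart_at B (\<psi> q)) (cmap (chart_at A q) q) e)"
proof -
  let ?II = "\<lambda>e. second_fundamental_form A B gbar \<psi> (vector_field_extending A q e) (vector_field_extending A q e) q"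
  have "real DIM('f) * mean_curvature A B gbar \<psi> N q = - gbar (\<psi> q) (\<Sum>e\<in>frame q. ?II e) (N q)"
    by (simp add: mean_curvature_def mean_curvature_vector_def metric_trace_def frame_def gbar_simps)
  also have "\<dots> = (\<Sum>e\<in>frame q. - gbar (\<psi> q) (?II e) (N q))"
    by (simp add: linear_sum[OF gbar_linear(2)] sum_negf)
  also have "\<dots> = (\<Sum>e\<in>frame q. shape (chart_at A q) (chart_at B (\<psi> q)) (cmap (chart_at A q) q) e)"
    by (intro sum.cong refl second_fundamental_form_shape M.vector_field_extending)
  finally show ?thesis .
qed

text \<open>\<open>lie_derivative\<close> is given in the distinguished chart at \<open>p\<close>,
  and only there are the components of a vector the vector itself. Hence the target chart in the
  divergence computation is \<open>chart_at B (\<psi> q)\<close>.\<close>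

lemma lie_derivative_rep:
  assumes conformal: "\<And>p u v. lie_derivative B X gbar p u v = 2 * \<eta> p * gbar p u v"
    and d: "d = chart_at B p" "y = cmap d p"
  shows "frechet_derivative (\<lambda>y. G d y a a) (at y) (field_rep d y)
    + 2 * G d y (frechet_derivative (\<lambda>y. field_rep d y) (at y) a) a = 2 * \<eta> p * G d y a a"
proof -
  have "d \<in> B" "p \<in> cdom d" using B.chart_at by (auto simp: d)
  then have "gbar p u v = G d y u v" "cinv d y = p" for u v
    using B.metric_in_chart_components[of d p gbar u v] B.components_chart_at[of p] B.chart(6) by (simp_all add: d)
  then show ?thesis
    using conformal[of p a a] B.components_chart_at[of p "X p"] G_symmetric[of d y a "frechet_derivative (\<lambda>y. field_rep d y) (at y) a"]
    by (simp add: lie_derivative_def Let_def d[symmetric])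
qed

text \<open>The source chart \<open>c\<close> must be arbitrary for the divergence theorem. The
  frame at \<open>q\<close> is transported to \<open>c\<close>; on each unit vector half of L_Y g is
  eta - phi S(e,e), and the sum of S over the frame is m H by \<open>shape_change\<close>.\<close>

theorem divergence_tangential_part:
  assumes conformal: "\<And>p u v. lie_derivative B X gbar p u v = 2 * \<eta> p * gbar p u v"
    and c: "c \<in> A" "q \<in> cdom c"
  shows "(\<Sum>b\<in>Basis. frechet_derivative (\<lambda>x. M.volume_density g c x *\<^sub>R tangential_rep c x) (at (cmap c q)) b \<bullet> b)
    = M.volume_density g c (cmap c q) *
      (real DIM('f) * (\<eta> (\<psi> q) - normal_part q * mean_curvature A B gbar \<psi> N q))"
proof -
  let ?d = "chart_at B (\<psi> q)" and ?x = "cmap c q"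
  note d = B.chart_at[of "\<psi> q"]
  let ?E = "components A c q ` frame q"
  let ?g = "metric_in_chart A g c"
  let ?P' = "\<lambda>y. frechet_derivative (rep c ?d) (at y)"
  let ?Y' = "frechet_derivative (\<lambda>x. tangential_rep c x) (at ?x)"
  have x: "?x \<in> rep_dom c ?d" and xc: "?x \<in> cimg c" using c d M.chart(5) by auto
  have q: "cinv c ?x = q" by (rule M.chart(6)[OF c])
  have P: "rep c ?d ?x = cmap ?d (\<psi> q)" by (rule rep_cmap[OF c])
  note E = M.orthonormal_basis_components[OF g_form c frame]
  have sub: "rep_dom c ?d \<subseteq> cimg c" using rep_dom_iff[OF c(1)] by blast
  note Y = M.smooth_vector_field_components[OF smooth_tangential_part c(1)]
  have Y2: "smooth_on (rep_dom c ?d) (\<lambda>x. tangential_rep c x)" by (rule smooth_on_subset[OF Y sub])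
  have term_eq: "frechet_derivative (\<lambda>y. ?g y u u) (at ?x) (tangential_rep c ?x) + 2 * ?g ?x (?Y' u) u
      = 2 * \<eta> (\<psi> q) * ?g ?x u u - 2 * normal_part q * shape c ?d ?x u" for u
  proof -
    have "frechet_derivative (\<lambda>y. ?g y u u) (at ?x)
        = frechet_derivative (\<lambda>y. G ?d (rep c ?d y) (?P' y u) (?P' y u)) (at ?x)"
      using differentiableI[OF smooth_on_has_derivative[OF M.smooth_on_metric_in_chart[OF g_form c(1)] xc]]
      by (rule frechet_derivative_transform_within_open[OF _ open_rep_dom[OF c(1) d(1)] x pullback_rep[OF c(1) d(1)]])
    moreover have "frechet_derivative (\<lambda>y. G ?d (rep c ?d y) (?P' y u) (?P' y u)) (at ?x) (tangential_rep c ?x)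
        + 2 * G ?d (rep c ?d ?x) (?P' ?x (?Y' u)) (?P' ?x u)
      = 2 * \<eta> (\<psi> q) * G ?d (rep c ?d ?x) (?P' ?x u) (?P' ?x u) - 2 * normal_part (cinv c ?x) * shape c ?d ?x u"
      by (rule lie_derivative_tangential_part[where G = "G ?d" and P = "rep c ?d" and X = "\<lambda>y. field_rep ?d y"
            and Y = "\<lambda>x. tangential_rep c x" and \<phi> = "\<lambda>x. normal_part (cinv c x)" and N = "\<lambda>x. normal_rep c ?d x",
          OF open_rep_dom[OF c(1) d(1)] x rep_image[OF c(1) d(1)] smooth_on_rep[OF c(1) d(1)]
            B.chart(2)[OF d(1)] G_bilinear[OF d(1)] smooth_on_G[OF d(1)] G_symmetric smooth_on_field_rep[OF d(1)] Y2
            smooth_on_normal_part[OF c(1) d(1)] smooth_on_normal_rep[OF c(1) d(1)] decomposition_rep[OF c(1) d(1)]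
            orth_rep[OF c(1) d(1)] lie_derivative_rep[OF conformal refl P]])
    ultimately show ?thesis
      by (simp only: pullback_rep[OF c(1) d(1) x] q)
  qed
  have one: "?g ?x e e = 1" if "e \<in> ?E" for e
  proof -
    have "\<forall>u\<in>?E. \<forall>v\<in>?E. ?g ?x u v = (if u = v then 1 else 0)"
      using E(1) unfolding orthonormal_basis_def by blast
    then show ?thesis using that by metis
  qed
  have card: "card ?E = DIM('f)"
    using orthonormal_basis_expand(3)[OF M.bilinear_metric_in_chart[OF g_form c(1) xc] E(1)] .
  have H: "(\<Sum>e\<in>?E. shape c ?d ?x e) = real DIM('f) * mean_curvature A B gbar \<psi> N q"
    unfolding mean_curvature_shape sum.reindex[OF E(2)] comp_apply[of _ "components A c q"]
    by (intro sum.cong refl) (simp only: shape_change[OF c M.chart_at d] M.components_chart_at)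
  have "(\<Sum>e\<in>?E. (frechet_derivative (\<lambda>y. ?g y e e) (at ?x) (tangential_rep c ?x) + 2 * ?g ?x (?Y' e) e) / 2)
      = (\<Sum>e\<in>?E. \<eta> (\<psi> q) - normal_part q * shape c ?d ?x e)"
    by (intro sum.cong refl) (simp add: term_eq one field_simps)
  also have "\<dots> = real DIM('f) * (\<eta> (\<psi> q) - normal_part q * mean_curvature A B gbar \<psi> N q)"
    by (simp add: sum_subtractf card sum_distrib_left[symmetric] H algebra_simps)
  finally show ?thesis
    unfolding M.divergence_volume_density[OF g_riemannian c(1) xc E(1) Y] by simp
qed

end

theorem theorem7:
  fixes B :: "('b::{t2_space,second_countable_topology}, 'e::euclidean_space) chart set"
    and gbar :: "'b \<Rightarrow> 'e \<Rightarrow> 'e \<Rightarrow> real"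
    and Xbar :: "'b \<Rightarrow> 'e"
    and \<eta> \<alpha> \<H> :: "'b \<Rightarrow> real"
    and A :: "('a::{t2_space,second_countable_topology}, 'f::euclidean_space) chart set"
    and \<psi> :: "'a \<Rightarrow> 'b"
    and N :: "'a \<Rightarrow> 'e"
  assumes spacetime: "spacetime B gbar Xbar"
    and smooth_\<eta>: "smooth_function B \<eta>"
    and pos_\<eta>: "\<And>p. \<eta> p > 0"
    and conformal: "\<And>p u v. lie_derivative B Xbar gbar p u v = 2 * \<eta> p * gbar p u v"
    and \<alpha>: "\<alpha> = (\<lambda>p. sqrt (- gbar p (Xbar p) (Xbar p)))"
    and \<H>: "\<H> = (\<lambda>p. \<eta> p / \<alpha> p)"
    and hypersurface: "spacelike_hypersurface A B gbar \<psi>"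
    and compact: "compact (UNIV :: 'a set)"
    and normal: "future_unit_normal A B gbar Xbar \<psi> N"
    and mean_curvature_ge: "\<And>q. mean_curvature A B gbar \<psi> N q \<ge> \<H> (\<psi> q)"
  shows "(\<forall>q V. gbar (\<psi> q) (Xbar (\<psi> q)) (differential A B \<psi> q V) = 0) \<and>
         (\<forall>q. mean_curvature A B gbar \<psi> N q = \<H> (\<psi> q))"
proof -
  interpret spacelike_hypersurface_in_spacetime A B gbar Xbar \<psi> N
    by unfold_locales (fact spacetime hypersurface normal)+
  let ?H = "mean_curvature A B gbar \<psi> N"
  let ?Y = tangential_part
  have \<alpha>_pos: "\<alpha> p > 0" for p
    using spacetime by (simp add: \<alpha> spacetime_def timelike_vector_field_def)
  have \<alpha>_sq: "(\<alpha> (\<psi> q))\<^sup>2 = (normal_part q)\<^sup>2 - g q (?Y q) (?Y q)" for q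
    using norm_X[of q] \<alpha>_pos[of "\<psi> q"] by (simp add: \<alpha> real_sqrt_pow2 less_imp_le)
  have Y_nonneg: "g q (?Y q) (?Y q) \<ge> 0" for q
    using g(3)[of "?Y q" q] linear_0[of "g q (?Y q)"] g(1)[of q] by (cases "?Y q = 0") (auto simp: bilinear_def)
  have \<phi>_pos: "normal_part q > 0" for q
    using N(3)[of q] gbar(2)[of "\<psi> q" "N q" "Xbar (\<psi> q)"] by (simp add: normal_part_def)
  \<comment> \<open>The squares are ordered by \<open>\<alpha>_sq\<close>; positivity of the normal
    part, due to the time orientation of \<open>N\<close>, fixes the sign.\<close>
  have \<phi>_ge: "normal_part q \<ge> \<alpha> (\<psi> q)" for q
    by (rule power2_le_imp_le) (use \<alpha>_sq[of q] Y_nonneg[of q] \<phi>_pos[of q] in linarith)+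
  have H_ge: "?H q \<ge> \<eta> (\<psi> q) / \<alpha> (\<psi> q)" for q using mean_curvature_ge[of q] by (simp add: \<H>)
  have le: "\<eta> (\<psi> q) \<le> normal_part q * (\<eta> (\<psi> q) / \<alpha> (\<psi> q))" for q
    using \<phi>_ge[of q] \<alpha>_pos[of "\<psi> q"] pos_\<eta>[of "\<psi> q"] by (simp add: field_simps)
  have le': "normal_part q * (\<eta> (\<psi> q) / \<alpha> (\<psi> q)) \<le> normal_part q * ?H q" for q
    using H_ge[of q] \<phi>_pos[of q] by (intro mult_left_mono) auto
  have nonpos: "real DIM('f) * (\<eta> (\<psi> q) - normal_part q * ?H q) \<le> 0" for q
    using le[of q] le'[of q] by (intro mult_nonneg_nonpos) auto
  have "real DIM('f) * (\<eta> (\<psi> q) - normal_part q * ?H q) = 0" for q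
    by (rule M.divergence_nonpos_imp_0[where w = "M.volume_density g" and Y = tangential_part
          and dv = "\<lambda>q. real DIM('f) * (\<eta> (\<psi> q) - normal_part q * ?H q)",
          OF compact M.density_volume_density[OF g_riemannian] smooth_tangential_part _ nonpos])
      (rule divergence_tangential_part[OF conformal, symmetric])
  then have eq: "normal_part q * ?H q = \<eta> (\<psi> q)" for q by simp
  have \<phi>_eq: "normal_part q = \<alpha> (\<psi> q)" for q
  proof -
    \<comment> \<open>The inequalities \<open>le\<close> and \<open>le'\<close> form a chain from
      eta to phi H, whose ends now coincide, so both are equalities; eta > 0 is then
      cancelled.\<close>
    have "\<eta> (\<psi> q) = normal_part q * (\<eta> (\<psi> q) / \<alpha> (\<psi> q))"
      using le[of q] le'[of q] eq[of q] by linarith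
    then show ?thesis using pos_\<eta>[of "\<psi> q"] \<alpha>_pos[of "\<psi> q"] by (simp add: field_simps)
  qed
  have "?Y q = 0" for q
    using \<alpha>_sq[of q] \<phi>_eq[of q] g(3)[of "?Y q" q] by fastforce
  then have "gbar (\<psi> q) (Xbar (\<psi> q)) (d\<psi> q V) = 0" for q V
    using tangential_part[of q V, symmetric] linear_0[of "\<lambda>u. g q u V"] g(1)[of q] by (simp add: bilinear_def)
  moreover have "?H q = \<H> (\<psi> q)" for q
    using eq[of q] \<phi>_eq[of q] \<alpha>_pos[of "\<psi> q"] by (simp add: \<H> field_simps)
  ultimately show ?thesis by blast
qed

end
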